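(* Let $\varphi$ be a free holomorphic self-map of the noncommutative ball $[B(\mathcal H)^n]_1$. If $C_\varphi$ is a compact composition operator on $H^2_{\bf ball}$, then the scalar representation of $\varphi$ has a unique fixed point $\xi\in\mathbb B_n$ and the spectrum $\sigma(C_\varphi)$ consists of $0$, $1$, and all possible products of the eigenvalues of the matrix $$[\langle\psi_i,e_j\rangle]_{n\times n},$$ where $\psi=(\psi_1,\ldots,\psi_n):=\Phi_\xi\circ\varphi\circ\Phi_\xi$, $\Phi_\xi$ is the involutive free holomorphic automorphism of $[B(\mathcal H)^n]_1$ associated with $\xi\in\mathbb B_n$, and $\psi_1,\ldots,\psi_n$ are seen as elements of the Fock space $F^2(H_n)$.
   Context: $n\ge1$; $\mathcal H$ is a separable infinite dimensional complex Hilbert space. $\mathbb F_n^+$ is the free semigroup with generators $g_1,\ldots,g_n$ and identity $g_0$; $|g_0|=0$, $|\alpha|=k$ if $\alpha=g_{i_1}\cdots g_{i_k}$; $X_\alpha:=X_{i_1}\cdots X_{i_k}$, $X_{g_0}:=I$. $[B(\mathcal H)^n]_1:=\{(X_1,\ldots,X_n)\in B(\mathcal H)^n:\ \|X_1X_1^*+\cdots+X_nX_n^*\|^{1/2}<1\}$. A free holomorphic function $f:[B(\mathcal H)^n]_1\to B(\mathcal H)$ is a map $f(X)=\sum_{k=0}^\infty\sum_{|\alpha|=k}a_\alpha X_\alpha$ (series over $k$ converging in operator norm) with $a_\alpha\in\mathbb C$ and $\limsup_{k\to\infty}(\sum_{|\alpha|=k}|a_\alpha|^2)^{1/2k}\le1$.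 A free holomorphic self-map $\varphi=(\varphi_1,\ldots,\varphi_n)$ of $[B(\mathcal H)^n]_1$ has each $\varphi_i$ free holomorphic and maps $[B(\mathcal H)^n]_1$ into itself. With $\varphi_\alpha:=\varphi_{i_1}\cdots\varphi_{i_k}$, the composition is $(f\circ\varphi)(X)=\sum_{k=0}^\infty\sum_{|\alpha|=k}a_\alpha\varphi_\alpha(X)$. $H^2_{\bf ball}$ is the Hilbert space of free holomorphic functions $f=\sum_\alpha a_\alpha X_\alpha$ on $[B(\mathcal H)^n]_1$ with $\|f\|_2^2:=\sum_\alpha|a_\alpha|^2<\infty$; $C_\varphi f:=f\circ\varphi$ is a bounded operator on $H^2_{\bf ball}$. $H^2_{\bf ball}$ is identified with the full Fock space $F^2(H_n)=\mathbb C1\oplus\bigoplus_{k\ge1}H_n^{\otimes k}$ ($H_n$ with orthonormal basis $e_1,\ldots,e_n$) via $\sum a_\alpha X_\alpha\mapsto\sum a_\alpha e_\alpha$, $e_\alpha=e_{i_1}\otimes\cdots\otimes e_{i_k}$; thus $\langle\psi_i,e_j\rangle$ is the coefficient of $X_j$ in $\psi_i$. $\mathbb B_n$ is the open Euclidean unit ball of $\mathbb C^n$; identifying $\lambda\in\mathbb B_n$ with $(\lambda_1I,\ldots,\lambda_nI)$, the scalar representation of $\varphi$ is $\mathbb B_n\ni\lambda\mapsto\varphi(\lambda)\in\mathbb B_n$. For $\lambda=(\lambda_1,\ldots,\lambda_n)\in\mathbb B_n$ (a row), $\Phi_\lambda(X):=\lambda-\Delta_\lambda\big(I-\sum_{i=1}^n\overline\lambda_iX_i\big)^{-1}[X_1,\ldots,X_n]\Delta_{\lambda^*}$,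 where $\Delta_\lambda=(1-\|\lambda\|_2^2)^{1/2}$ and $\Delta_{\lambda^*}=(I_{\mathbb C^n}-\lambda^*\lambda)^{1/2}\in M_{n\times n}(\mathbb C)$; it is an involutive free holomorphic automorphism of $[B(\mathcal H)^n]_1$ with $\Phi_\lambda(0)=\lambda$, $\Phi_\lambda(\lambda)=0$. Products of eigenvalues are finite nonempty products of not necessarily distinct eigenvalues. *)

theory Defs
  imports "HOL-Analysis.Analysis"
begin

section \<open>Complex Hilbert spaces and their bounded operators\<close>

text \<open>
  The complex inner product is linear in its first argument; its real part is the inner
  product of the underlying real Hilbert space, so the norm is the usual one.
\<close>

class complex_hilbert = real_inner + complete_space +
  fixes scaleC :: "complex \<Rightarrow> 'a \<Rightarrow> 'a" (infixr \<open>*\<^sub>C\<close> 75)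
    and cinner :: "'a \<Rightarrow> 'a \<Rightarrow> complex"
  assumes scaleC_add_right: "c *\<^sub>C (x + y) = c *\<^sub>C x + c *\<^sub>C y"
    and scaleC_add_left: "(c + d) *\<^sub>C x = c *\<^sub>C x + d *\<^sub>C x"
    and scaleC_scaleC: "c *\<^sub>C d *\<^sub>C x = (c * d) *\<^sub>C x"
    and scaleC_of_real: "complex_of_real r *\<^sub>C x = r *\<^sub>R x"
    and cinner_add_left: "cinner (x + y) z = cinner x z + cinner y z"
    and cinner_scaleC_left: "cinner (c *\<^sub>C x) y = c * cinner x y"
    and cinner_commute: "cinner x y = cnj (cinner y x)"
    and Re_cinner: "Re (cinner x y) = inner x y"

lemma vector_space_scaleC:
  "vector_space (scaleC :: complex \<Rightarrow> 'a \<Rightarrow> 'a::complex_hilbert)"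
proof
  show "1 *\<^sub>C x = x" for x :: 'a
    using scaleC_of_real[of 1 x] by simp
qed (simp_all add: scaleC_add_right scaleC_add_left scaleC_scaleC)

lemma norm_scaleC: "norm (c *\<^sub>C x) = cmod c * norm (x :: 'a::complex_hilbert)"
proof -
  have "cinner (c *\<^sub>C x) (c *\<^sub>C x) = c * cinner x (c *\<^sub>C x)"
    by (rule cinner_scaleC_left)
  also have "cinner x (c *\<^sub>C x) = cnj c * cnj (cinner x x)"
    by (subst cinner_commute) (simp add: cinner_scaleC_left)
  finally have "cinner (c *\<^sub>C x) (c *\<^sub>C x) = complex_of_real ((cmod c)\<^sup>2) * cinner x x"
    by (simp add: cinner_commute[of x x, symmetric] complex_norm_square del: of_real_power)
  then have "inner (c *\<^sub>C x) (c *\<^sub>C x) = (cmod c)\<^sup>2 * inner x x"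
    by (simp add: Re_cinner[symmetric])
  then show ?thesis
    by (simp add: norm_eq_sqrt_inner real_sqrt_mult)
qed

lemma bounded_linear_scaleC: "bounded_linear (\<lambda>x :: 'a::complex_hilbert. c *\<^sub>C x)"
proof
  show "c *\<^sub>C (r *\<^sub>R x) = r *\<^sub>R (c *\<^sub>C x)" for r and x :: 'a
    by (simp add: scaleC_of_real[symmetric] scaleC_scaleC mult.commute)
  show "\<exists>K. \<forall>x::'a. norm (c *\<^sub>C x) \<le> norm x * K"
    by (rule exI[of _ "cmod c"]) (simp add: norm_scaleC mult.commute)
qed (rule scaleC_add_right)

text \<open>
  \<open>'h op\<close> consists of the bounded real-linear maps with the operator norm; \<open>BH\<close> singles out
  the complex-linear ones.
\<close>

type_synonym 'h op = "'h \<Rightarrow>\<^sub>L 'h"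

definition BH :: "'h::complex_hilbert op set" where
  "BH = {T. \<forall>c x. blinfun_apply T (c *\<^sub>C x) = c *\<^sub>C blinfun_apply T x}"

definition scalar_op :: "complex \<Rightarrow> 'h::complex_hilbert op" where
  "scalar_op c = Blinfun (\<lambda>x. c *\<^sub>C x)"

lemma scalar_op_apply: "blinfun_apply (scalar_op c) x = c *\<^sub>C x"
  by (simp add: scalar_op_def bounded_linear_Blinfun_apply bounded_linear_scaleC)

definition op_adj :: "'h::complex_hilbert op \<Rightarrow> 'h op" where
  "op_adj T = (THE S. \<forall>x y. cinner (blinfun_apply T x) y = cinner x (blinfun_apply S y))"

definition op_inv :: "'h::complex_hilbert op \<Rightarrow> 'h op" where
  "op_inv T = (THE S. T o\<^sub>L S = id_blinfun \<and> S o\<^sub>L T = id_blinfun)"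

section \<open>Free holomorphic functions on the noncommutative ball\<close>

text \<open>
  The generators are indexed by the finite type \<open>'n\<close>, so \<open>n = CARD('n) \<ge> 1\<close>; elements of the
  free semigroup are words \<open>'n list\<close>, with the empty word as identity.
\<close>

primrec word_op :: "'h::complex_hilbert op ^ 'n \<Rightarrow> 'n list \<Rightarrow> 'h op" where
  "word_op X [] = id_blinfun"
| "word_op X (i # \<alpha>) = (X $ i) o\<^sub>L word_op X \<alpha>"

definition nc_ball :: "('h::complex_hilbert op ^ 'n::finite) set" where
  "nc_ball = {X. (\<forall>i. X $ i \<in> BH) \<and> sqrt (norm (\<Sum>i\<in>UNIV. (X $ i) o\<^sub>L op_adj (X $ i))) < 1}"

definition free_holomorphic_coeffs ::
  "('h::complex_hilbert op ^ 'n::finite \<Rightarrow> 'h op) \<Rightarrow> ('n list \<Rightarrow> complex) \<Rightarrow> bool" where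
  "free_holomorphic_coeffs f a \<longleftrightarrow>
     limsup (\<lambda>k. ereal (root (2 * k) (\<Sum>\<alpha> | length \<alpha> = k. (cmod (a \<alpha>))\<^sup>2))) \<le> 1 \<and>
     (\<forall>X\<in>nc_ball. (\<lambda>k. \<Sum>\<alpha> | length \<alpha> = k. scalar_op (a \<alpha>) o\<^sub>L word_op X \<alpha>) sums f X)"

definition free_holomorphic :: "('h::complex_hilbert op ^ 'n::finite \<Rightarrow> 'h op) \<Rightarrow> bool" where
  "free_holomorphic f \<longleftrightarrow> (\<exists>a. free_holomorphic_coeffs f a)"

text \<open>The coefficients are unique because the Hilbert space is infinite dimensional.\<close>

definition fh_coeff :: "('h::complex_hilbert op ^ 'n::finite \<Rightarrow> 'h op) \<Rightarrow> 'n list \<Rightarrow> complex" where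
  "fh_coeff f = (THE a. free_holomorphic_coeffs f a)"

definition free_holomorphic_selfmap ::
  "('h::complex_hilbert op ^ 'n::finite \<Rightarrow> 'h op ^ 'n) \<Rightarrow> bool" where
  "free_holomorphic_selfmap \<phi> \<longleftrightarrow>
     (\<forall>i. free_holomorphic (\<lambda>X. \<phi> X $ i)) \<and> (\<forall>X\<in>nc_ball. \<phi> X \<in> nc_ball)"

definition scalar_tuple :: "complex ^ 'n::finite \<Rightarrow> 'h::complex_hilbert op ^ 'n" where
  "scalar_tuple \<zeta> = (\<chi> i. scalar_op (\<zeta> $ i))"

definition scalar_rep ::
  "('h::complex_hilbert op ^ 'n::finite \<Rightarrow> 'h op ^ 'n) \<Rightarrow> complex ^ 'n \<Rightarrow> complex ^ 'n" where
  "scalar_rep \<phi> \<zeta> = (THE \<mu>. \<phi> (scalar_tuple \<zeta>) = scalar_tuple \<mu>)"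

section \<open>The involutive automorphisms\<close>

definition psd_matrix :: "complex ^ 'n ^ 'n::finite \<Rightarrow> bool" where
  "psd_matrix A \<longleftrightarrow> (\<forall>v. (\<Sum>i\<in>UNIV. cnj (v $ i) * (A *v v) $ i) \<in> \<real>\<^sub>\<ge>\<^sub>0)"

definition psd_sqrt :: "complex ^ 'n ^ 'n::finite \<Rightarrow> complex ^ 'n ^ 'n" where
  "psd_sqrt A = (THE B. psd_matrix B \<and> B ** B = A)"

text \<open>Since \<open>\<zeta>\<close> is a row, \<open>\<zeta>\<^sup>*\<zeta>\<close> is the matrix with entries \<open>cnj (\<zeta> $ i) * \<zeta> $ j\<close>.\<close>

definition defect_matrix :: "complex ^ 'n::finite \<Rightarrow> complex ^ 'n ^ 'n" where
  "defect_matrix \<zeta> = psd_sqrt (mat 1 - (\<chi> i j. cnj (\<zeta> $ i) * \<zeta> $ j))"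

definition ball_aut ::
  "complex ^ 'n::finite \<Rightarrow> 'h::complex_hilbert op ^ 'n \<Rightarrow> 'h op ^ 'n" where
  "ball_aut \<zeta> X = (\<chi> j. scalar_op (\<zeta> $ j) -
     sqrt (1 - (norm \<zeta>)\<^sup>2) *\<^sub>R
       (op_inv (id_blinfun - (\<Sum>i\<in>UNIV. scalar_op (cnj (\<zeta> $ i)) o\<^sub>L (X $ i))) o\<^sub>L
        (\<Sum>i\<in>UNIV. scalar_op (defect_matrix \<zeta> $ i $ j) o\<^sub>L (X $ i))))"

section \<open>The Hardy space and operators on it\<close>

text \<open>
  Elements of the Hardy space are total functions normalised to be \<open>0\<close> off the noncommutative
  ball, so that equality in HOL is equality of functions on the ball.
\<close>

definition H2 :: "('h::complex_hilbert op ^ 'n::finite \<Rightarrow> 'h op) set" where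
  "H2 = {f. free_holomorphic f \<and> (\<lambda>\<alpha>. (cmod (fh_coeff f \<alpha>))\<^sup>2) summable_on UNIV \<and>
            (\<forall>X. X \<notin> nc_ball \<longrightarrow> f X = 0)}"

definition H2_norm :: "('h::complex_hilbert op ^ 'n::finite \<Rightarrow> 'h op) \<Rightarrow> real" where
  "H2_norm f = sqrt (\<Sum>\<^sub>\<infinity>\<alpha>. (cmod (fh_coeff f \<alpha>))\<^sup>2)"

definition H2_topology :: "('h::complex_hilbert op ^ 'n::finite \<Rightarrow> 'h op) topology" where
  "H2_topology = Metric_space.mtopology H2 (\<lambda>f g. H2_norm (\<lambda>X. f X - g X))"

definition H2_bounded_op ::
  "(('h::complex_hilbert op ^ 'n::finite \<Rightarrow> 'h op) \<Rightarrow> ('h op ^ 'n \<Rightarrow> 'h op)) \<Rightarrow> bool" where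
  "H2_bounded_op T \<longleftrightarrow>
     (\<forall>f\<in>H2. T f \<in> H2) \<and>
     (\<forall>f\<in>H2. \<forall>g\<in>H2. T (\<lambda>X. f X + g X) = (\<lambda>X. T f X + T g X)) \<and>
     (\<forall>c. \<forall>f\<in>H2. T (\<lambda>X. scalar_op c o\<^sub>L f X) = (\<lambda>X. scalar_op c o\<^sub>L T f X)) \<and>
     (\<exists>K. \<forall>f\<in>H2. H2_norm (T f) \<le> K * H2_norm f)"

definition H2_compact_op ::
  "(('h::complex_hilbert op ^ 'n::finite \<Rightarrow> 'h op) \<Rightarrow> ('h op ^ 'n \<Rightarrow> 'h op)) \<Rightarrow> bool" where
  "H2_compact_op T \<longleftrightarrow> H2_bounded_op T \<and>
     compactin H2_topology (H2_topology closure_of (T ` {f \<in> H2. H2_norm f \<le> 1}))"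

definition H2_spectrum ::
  "(('h::complex_hilbert op ^ 'n::finite \<Rightarrow> 'h op) \<Rightarrow> ('h op ^ 'n \<Rightarrow> 'h op)) \<Rightarrow> complex set" where
  "H2_spectrum T = {z. \<not> (\<exists>S. H2_bounded_op S \<and>
     (\<forall>f\<in>H2. S (\<lambda>X. T f X - (scalar_op z o\<^sub>L f X)) = f \<and>
             (\<lambda>X. T (S f) X - (scalar_op z o\<^sub>L S f X)) = f))}"

text \<open>
  For a self-map \<open>\<phi>\<close> of the ball, the composition \<open>\<Sum>\<^sub>k \<Sum>\<^bsub>|\<alpha>|=k\<^esub> a\<^sub>\<alpha> \<phi>\<^sub>\<alpha>(X)\<close> is the series of \<open>f\<close>
  at the point \<open>\<phi> X\<close>, that is, \<open>f (\<phi> X)\<close>.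
\<close>

definition composition_op ::
  "('h::complex_hilbert op ^ 'n::finite \<Rightarrow> 'h op ^ 'n) \<Rightarrow>
   ('h op ^ 'n \<Rightarrow> 'h op) \<Rightarrow> ('h op ^ 'n \<Rightarrow> 'h op)" where
  "composition_op \<phi> f = (\<lambda>X. if X \<in> nc_ball then f (\<phi> X) else 0)"

section \<open>Eigenvalues\<close>

definition eigenvalues :: "complex ^ 'n ^ 'n::finite \<Rightarrow> complex set" where
  "eigenvalues A = {c. \<exists>v. v \<noteq> 0 \<and> A *v v = c *s v}"

text \<open>
  The coefficient of \<open>X\<^sub>j\<close> in \<open>\<psi>\<^sub>i\<close> is the Fock space inner product of \<open>\<psi>\<^sub>i\<close> with \<open>e\<^sub>j\<close>.
\<close>

definition linear_part_matrix ::
  "('h::complex_hilbert op ^ 'n::finite \<Rightarrow> 'h op ^ 'n) \<Rightarrow> complex ^ 'n ^ 'n" where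
  "linear_part_matrix \<psi> = (\<chi> i j. fh_coeff (\<lambda>X. \<psi> X $ i) [j])"

end

theory Submission
  imports Defs "HOL-Complex_Analysis.Complex_Analysis"
    "HOL-Computational_Algebra.Fundamental_Theorem_Algebra"
begin

text \<open>
  Let \<open>T = C\<^sub>\<phi>\<close>. Testing the compact operator \<open>T\<close> on normalised kernel functions shows that
  \<open>(1 - |\<lambda>|\<^sup>2) / (1 - |\<phi> \<lambda>|\<^sup>2)\<close> tends to \<open>0\<close> as \<open>|\<lambda>|\<close> tends to \<open>1\<close>. So \<open>\<phi>\<close> maps spheres near the
  boundary strictly inwards, and Brouwer's theorem yields a fixed point \<open>\<xi>\<close>; by the Schwarz lemma a
  second one would bound this ratio from below along a slice.

  For \<open>f\<close> in the Hardy space let \<open>g = f \<circ> \<Phi>\<^sub>\<xi>\<close>. As \<open>\<Phi>\<^sub>\<xi>\<close> is an involution, \<open>T f\<close> corresponds to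
  \<open>g \<circ> \<psi>\<close>, and as \<open>\<psi> 0 = 0\<close>, composition with \<open>\<psi>\<close> does not lower the order of vanishing at \<open>0\<close> and
  acts on the lowest homogeneous part of degree \<open>k\<close> by the \<open>k\<close>-th tensor power of the linear part \<open>A\<close>
  of \<open>\<psi>\<close>. Hence nonzero eigenvalues of \<open>T\<close> are products of eigenvalues of \<open>A\<close>, and by the Riesz theory
  of compact operators so are all nonzero spectral values. Conversely let \<open>z \<noteq> 0\<close> be such a product with
  the least number \<open>k\<close> of factors. If \<open>T - z\<close> were invertible, then by minimality it would pull functions
  of order \<open>k\<close> back to functions of order \<open>k\<close>; but a nonzero functional on the homogeneous part of degree \<open>k\<close>
  annihilates the image of the latter.
\<close>

text \<open>The Hardy space consists of functions, while compact operators are studied on a Hilbert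
  space type. Infinite dimension links the two: an orthonormal family indexed by words inside
  \<open>'h\<close> embeds the Hardy space isometrically into \<open>'h\<close> and carries the left
  creation operators. A series evaluated at multiples of these operators displays its coefficients,
  so they are unique and the \<open>THE\<close> in \<open>fh_coeff\<close> is meaningful. With
  respect to degree, composition with \<open>\<psi>\<close> is only block triangular: a coefficient
  of degree \<open>k\<close> of the image depends on all degrees up to \<open>k\<close>.
  Coefficients form row vectors, so an eigenfunction produces a left eigenvector of a tensor power
  of \<open>A\<close>, while the annihilating functional of the converse is a right eigenvector
  \<open>v\<close>. Pairing with \<open>v\<close> multiplies by \<open>z\<close> only on functions
  whose coefficients below degree \<open>k\<close> vanish. This is why the number of factors is
  taken least: no smaller tensor power has the eigenvalue \<open>z\<close>, so the resolvent
  equation itself forces those lower coefficients to vanish.\<close>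

no_notation fps_nth (infixl "$" 75)

section \<open>Complex Hilbert spaces\<close>

instance complex_hilbert \<subseteq> banach ..

lemma cinner_add_right: "cinner x (y + z) = cinner x y + cinner x (z :: 'a::complex_hilbert)"
  by (metis cinner_add_left cinner_commute complex_cnj_add)

lemma cinner_scaleC_right: "cinner x (c *\<^sub>C y) = cnj c * cinner x (y :: 'a::complex_hilbert)"
  by (metis cinner_scaleC_left cinner_commute complex_cnj_mult)

lemma scaleC_one [simp]: "1 *\<^sub>C (x :: 'a::complex_hilbert) = x"
  using vector_space.vector_space_assms(4)[OF vector_space_scaleC] .

lemma scaleC_zero_left [simp]: "0 *\<^sub>C (x :: 'a::complex_hilbert) = 0"
  using scaleC_of_real[of 0 x] by simp

lemma scaleC_minus_left: "(- c) *\<^sub>C (x :: 'a::complex_hilbert) = - (c *\<^sub>C x)"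
  using scaleC_add_left[of "- c" c x] by (simp add: eq_neg_iff_add_eq_0)

lemma scaleC_diff_left: "(c - d) *\<^sub>C (x :: 'a::complex_hilbert) = c *\<^sub>C x - d *\<^sub>C x"
  using scaleC_add_left[of c "- d" x] by (simp add: scaleC_minus_left)

lemma scaleC_sum_left: "(\<Sum>i\<in>A. c i) *\<^sub>C (x :: 'a::complex_hilbert) = (\<Sum>i\<in>A. c i *\<^sub>C x)"
  by (induction A rule: infinite_finite_induct) (auto simp: scaleC_add_left)

lemma scaleC_zero_right [simp]: "c *\<^sub>C (0 :: 'a::complex_hilbert) = 0"
  by (rule linear_0[OF bounded_linear.linear[OF bounded_linear_scaleC]])

lemma scaleC_diff_right: "c *\<^sub>C (x - y) = c *\<^sub>C x - c *\<^sub>C (y :: 'a::complex_hilbert)"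
  by (rule linear_diff[OF bounded_linear.linear[OF bounded_linear_scaleC]])

lemma scaleC_sum_right: "c *\<^sub>C (\<Sum>i\<in>A. f i) = (\<Sum>i\<in>A. c *\<^sub>C (f i :: 'a::complex_hilbert))"
  by (rule linear_sum[OF bounded_linear.linear[OF bounded_linear_scaleC]])

lemma scaleC_eq_0_iff [simp]: "c *\<^sub>C (x :: 'a::complex_hilbert) = 0 \<longleftrightarrow> c = 0 \<or> x = 0"
  using norm_scaleC[of c x] by (metis mult_eq_0_iff norm_eq_zero)

lemma scaleR_scaleC: "r *\<^sub>R (x :: 'a::complex_hilbert) = complex_of_real r *\<^sub>C x"
  by (simp add: scaleC_of_real)

lemma cinner_scaleR_left: "cinner (r *\<^sub>R x) y = of_real r * cinner x (y :: 'a::complex_hilbert)"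
  by (simp add: scaleR_scaleC cinner_scaleC_left)

text \<open>A unimodular factor rotates \<open>cinner x y\<close> onto the positive axis, where it
  agrees with the real inner product and the real Cauchy-Schwarz inequality applies.\<close>

lemma cinner_norm_le: "cmod (cinner x y) \<le> norm x * norm (y :: 'a::complex_hilbert)"
proof (cases "cinner x y = 0")
  case False
  define u where "u = cnj (cinner x y) / cmod (cinner x y)"
  have u: "cmod u = 1"
    using False by (simp add: u_def norm_divide)
  have "cinner (u *\<^sub>C x) y = cinner x y * cnj (cinner x y) / cmod (cinner x y)"
    by (simp add: u_def cinner_scaleC_left)
  also have "\<dots> = of_real (cmod (cinner x y))"
    unfolding complex_norm_square[symmetric] using False by (simp add: power2_eq_square)
  finally have "cinner (u *\<^sub>C x) y = of_real (cmod (cinner x y))" .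
  then have "cmod (cinner x y) = inner (u *\<^sub>C x) y"
    by (simp add: Re_cinner[symmetric])
  also have "\<dots> \<le> norm (u *\<^sub>C x) * norm y"
    by (rule norm_cauchy_schwarz)
  finally show ?thesis by (simp add: norm_scaleC u)
qed simp

lemma bounded_linear_cinner_left: "bounded_linear (\<lambda>x. cinner x (y :: 'a::complex_hilbert))"
  by (rule bounded_linear_intro[where K = "norm y"])
    (auto simp: cinner_add_left cinner_scaleR_left scaleR_conv_of_real cinner_norm_le)

lemma bounded_linear_cinner_right: "bounded_linear (\<lambda>y. cinner (x :: 'a::complex_hilbert) y)"
  by (rule bounded_linear_intro[where K = "norm x"])
    (auto simp: cinner_add_right scaleR_scaleC cinner_scaleC_right scaleR_conv_of_real
       mult.commute[of "norm _" "norm x"] cinner_norm_le)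

lemmas cinner_linear_left = bounded_linear.linear[OF bounded_linear_cinner_left]
lemmas cinner_linear_right = bounded_linear.linear[OF bounded_linear_cinner_right]
lemmas cinner_zero_left [simp] = linear_0[OF cinner_linear_left]
lemmas cinner_diff_left = linear_diff[OF cinner_linear_left]
lemmas cinner_diff_right = linear_diff[OF cinner_linear_right]
lemmas cinner_sum_left = linear_sum[OF cinner_linear_left]
lemmas cinner_sum_right = linear_sum[OF cinner_linear_right]

lemma cinner_same: "cinner x x = of_real ((norm (x :: 'a::complex_hilbert))\<^sup>2)"
proof -
  have "cinner x x = cnj (cinner x x)" by (rule cinner_commute)
  then have "Im (cinner x x) = 0" by (metis cnj.simps(2) neg_equal_zero)
  moreover have "Re (cinner x x) = (norm x)\<^sup>2"
    by (simp add: Re_cinner power2_norm_eq_inner)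
  ultimately show ?thesis by (simp add: complex_eq_iff)
qed

lemma Im_cinner_left: "Im (cinner x y) = - inner (\<i> *\<^sub>C x) (y :: 'a::complex_hilbert)"
  by (simp add: Re_cinner[symmetric] cinner_scaleC_left)

lemma cinner_eqI: "(\<And>x. cinner x y = cinner x z) \<Longrightarrow> y = (z :: 'a::complex_hilbert)"
  using cinner_same[of "y - z"] by (simp add: cinner_diff_right)

text \<open>The representing vector minimises \<open>\<parallel>x\<parallel>\<^sup>2 - 2 l x\<close>; a minimising sequence is Cauchy by the
  parallelogram law.\<close>

lemma riesz_representation:
  fixes l :: "'a::{real_inner,complete_space} \<Rightarrow> real"
  assumes "bounded_linear l"
  obtains y where "\<And>x. l x = inner x y"
proof -
  interpret l: bounded_linear l by fact
  obtain K where K: "\<And>x. norm (l x) \<le> norm x * K" using l.bounded by blast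
  define J where "J x = (norm x)\<^sup>2 - 2 * l x" for x
  have J_lower: "- K\<^sup>2 \<le> J x" for x
  proof -
    have "l x \<le> norm x * K" using K[of x] by simp
    moreover have "0 \<le> (norm x - K)\<^sup>2" by simp
    ultimately show ?thesis by (simp add: J_def power2_diff)
  qed
  define m where "m = Inf (range J)"
  have bdd: "bdd_below (range J)" using J_lower by (auto simp: bdd_below_def)
  have m_le: "m \<le> J x" for x unfolding m_def by (rule cInf_lower[OF _ bdd]) simp
  have "\<exists>x. J x < m + 1 / real (Suc n)" for n
  proof -
    have "Inf (range J) < m + 1 / real (Suc n)" by (simp add: m_def)
    then show ?thesis using cInf_less_iff[of "range J", OF _ bdd] by auto
  qed
  then obtain x where x: "\<And>n. J (x n) < m + 1 / real (Suc n)" by metis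
  \<comment> \<open>Parallelogram law; the linear terms of \<open>J\<close> cancel. Two points with
    values near the infimum are close, because the value at their midpoint is at least
    \<open>m\<close>.\<close>
  have par: "(norm (u - v))\<^sup>2 = 2 * J u + 2 * J v - 4 * J ((1/2) *\<^sub>R (u + v))" for u v
    by (simp add: J_def l.add l.scaleR power2_norm_eq_inner inner_diff inner_add inner_commute
        algebra_simps)
  have dist_le: "(norm (x n - x k))\<^sup>2 \<le> 4 / real (Suc N)" if "n \<ge> N" "k \<ge> N" for n k N
  proof -
    have "1 / real (Suc n) \<le> 1 / real (Suc N)" "1 / real (Suc k) \<le> 1 / real (Suc N)"
      using that by (simp_all add: frac_le)
    then show ?thesis
      using par[of "x n" "x k"] x[of n] x[of k] m_le[of "(1/2) *\<^sub>R (x n + x k)"] by simp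
  qed
  have "Cauchy x"
  proof (rule metric_CauchyI)
    fix e :: real assume e: "e > 0"
    obtain N where N: "4 / e\<^sup>2 < real N" using reals_Archimedean2 by blast
    have "4 / real (Suc N) < e\<^sup>2" using N e by (simp add: field_simps) (smt (verit) zero_less_power)
    then have "dist (x n) (x k) < e" if "n \<ge> N" "k \<ge> N" for n k
      using dist_le[OF that] e by (simp add: dist_norm) (smt (verit) power2_less_imp_less)
    then show "\<exists>M. \<forall>m\<ge>M. \<forall>n\<ge>M. dist (x m) (x n) < e" by blast
  qed
  then obtain y where y: "x \<longlonglongrightarrow> y" using Cauchy_convergent convergent_def by blast
  have "(\<lambda>n. J (x n)) \<longlonglongrightarrow> J y" unfolding J_def by (intro tendsto_intros y l.tendsto)
  moreover have "(\<lambda>n. m + 1 / real (Suc n)) \<longlonglongrightarrow> m + 0"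
    by (intro tendsto_intros LIMSEQ_Suc[OF lim_1_over_n])
  ultimately have "J y \<le> m + 0"
    by (rule LIMSEQ_le) (use x less_imp_le in blast)
  then have "J y \<le> m" by simp
  have "l v = inner v y" for v
  proof (rule ccontr)
    assume neq: "l v \<noteq> inner v y"
    define d where "d = l v - inner v y"
    have "v \<noteq> 0" using neq by auto
    then have v: "(norm v)\<^sup>2 > 0" by simp
    have J_line: "J (y + t *\<^sub>R v) = J y - 2 * t * d + t\<^sup>2 * (norm v)\<^sup>2" for t
      unfolding d_def J_def by (simp only: l.add l.scaleR power2_norm_eq_inner inner_add_left
          inner_add_right inner_scaleR_left inner_scaleR_right inner_commute[of v y])
        (simp add: algebra_simps power2_eq_square)
    \<comment> \<open>The coefficient \<open>d / (norm v)\<^sup>2\<close> minimises the quadratic in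
      \<open>J_line\<close>; a nonzero \<open>d\<close> would push the value below
      \<open>J y\<close>.\<close>
    have "J y \<le> J (y + (d / (norm v)\<^sup>2) *\<^sub>R v)" using \<open>J y \<le> m\<close> m_le order_trans by blast
    also have "\<dots> = J y - 2 * (d / (norm v)\<^sup>2) * d + (d / (norm v)\<^sup>2)\<^sup>2 * (norm v)\<^sup>2"
      by (rule J_line)
    also have "\<dots> = J y - d\<^sup>2 / (norm v)\<^sup>2"
      using v by (simp add: power2_eq_square field_simps)
    finally show False using v neq by (simp add: d_def divide_le_0_iff)
  qed
  then show ?thesis using that by blast
qed

text \<open>Riesz representation gives an adjoint for the real inner product. Since \<open>T\<close>
  commutes with multiplication by \<open>\<i>\<close> and the imaginary part of
  \<open>cinner\<close> is a rotated real part, the same operator serves the complex one.\<close>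

lemma adjoint_ex:
  fixes T :: "'h::complex_hilbert op"
  assumes "T \<in> BH"
  shows "\<exists>S :: 'h op. \<forall>x y. cinner (T x) y = cinner x (S y)"
proof -
  have "\<exists>z. \<forall>x. inner (T x) y = inner x z" for y
    using riesz_representation[of "\<lambda>x. inner (T x) y"]
    by (metis bounded_linear_inner_left_comp blinfun.bounded_linear_right)
  then obtain S where S: "\<And>x y. inner (T x) y = inner x (S y)" by metis
  have norm_S: "norm (S y) \<le> norm y * norm T" for y
  proof (cases "S y = 0")
    case False
    have "(norm (S y))\<^sup>2 = inner (T (S y)) y" by (simp add: S power2_norm_eq_inner)
    also have "\<dots> \<le> norm (T (S y)) * norm y" by (rule norm_cauchy_schwarz)
    also have "\<dots> \<le> norm T * norm (S y) * norm y" by (intro mult_right_mono norm_blinfun) simp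
    finally have "norm (S y) * norm (S y) \<le> norm (S y) * (norm y * norm T)"
      by (simp add: power2_eq_square mult.assoc mult.left_commute mult.commute)
    then show ?thesis using False by simp
  qed simp
  have "bounded_linear S"
  proof (rule bounded_linear_intro[where K = "norm T"])
    show "S (x + y) = S x + S y" for x y
      by (rule vector_eq_ldot[THEN iffD1]) (auto simp: S[symmetric] inner_add_right)
    show "S (r *\<^sub>R x) = r *\<^sub>R S x" for r x
      by (rule vector_eq_ldot[THEN iffD1]) (auto simp: S[symmetric])
  qed (rule norm_S)
  then have app: "Blinfun S y = S y" for y by (simp add: bounded_linear_Blinfun_apply)
  have "cinner (T x) y = cinner x (Blinfun S y)" for x y
  proof -
    have "\<i> *\<^sub>C T x = T (\<i> *\<^sub>C x)" using assms by (simp add: BH_def)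
    then show ?thesis by (simp add: complex_eq_iff Re_cinner Im_cinner_left app S)
  qed
  then show ?thesis by blast
qed

lemma op_adj:
  assumes "T \<in> BH"
  shows "cinner (blinfun_apply T x) y = cinner x (op_adj T y)"
proof -
  obtain S where S: "\<forall>x y. cinner (T x) y = cinner x (blinfun_apply S y)" using adjoint_ex[OF assms] by blast
  have "op_adj T = S" unfolding op_adj_def
  proof (rule the_equality)
    fix R :: "'a op" assume "\<forall>x y. cinner (T x) y = cinner x (R y)"
    with S show "R = S" by (intro blinfun_eqI) (metis cinner_eqI)
  qed (use S in blast)
  with S show ?thesis by simp
qed

lemma inner_op_adj: "T \<in> BH \<Longrightarrow> inner (blinfun_apply T x) y = inner x (op_adj T y)"
  using op_adj[of T x y] by (simp add: Re_cinner[symmetric])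

section \<open>Row contractions\<close>

text \<open>The row \<open>[X_1, ..., X_n]\<close> acting on the n-fold direct sum; the square of
  its norm is the norm of the sum of the \<open>X_i X_i^*\<close>.\<close>

definition rowop :: "'h::complex_hilbert op ^ 'n::finite \<Rightarrow> ('h ^ 'n) \<Rightarrow>\<^sub>L 'h" where
  "rowop X = Blinfun (\<lambda>x. \<Sum>i\<in>UNIV. (X $ i) (x $ i))"

lemma rowop_apply: "rowop X x = (\<Sum>i\<in>UNIV. (X $ i) (x $ i))"
proof -
  have "bounded_linear (\<lambda>x. \<Sum>i\<in>UNIV. blinfun_apply (X $ i) (x $ i))"
    by (intro bounded_linear_sum bounded_linear_compose[OF blinfun.bounded_linear_right]
        bounded_linear_vec_nth)
  then show ?thesis by (simp add: rowop_def bounded_linear_Blinfun_apply)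
qed

lemma norm_vec_power2: "(norm (x :: 'h::real_normed_vector ^ 'n::finite))\<^sup>2 = (\<Sum>i\<in>UNIV. (norm (x $ i))\<^sup>2)"
  by (simp add: norm_vec_def L2_set_def sum_nonneg)

lemma norm_rowop_le: "norm (rowop X) \<le> (\<Sum>i\<in>UNIV. norm (X $ i))"
proof (rule norm_blinfun_bound)
  fix x
  have "norm (rowop X x) \<le> (\<Sum>i\<in>UNIV. norm (X $ i) * norm (x $ i))"
    unfolding rowop_apply by (intro sum_norm_le norm_blinfun)
  also have "\<dots> \<le> (\<Sum>i\<in>UNIV. norm (X $ i) * norm x)"
    by (intro sum_mono mult_left_mono Finite_Cartesian_Product.norm_nth_le) auto
  finally show "norm (rowop X x) \<le> (\<Sum>i\<in>UNIV. norm (X $ i)) * norm x" by (simp add: sum_distrib_right)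
qed (simp add: sum_nonneg)

lemma norm_component_le_rowop: "norm (X $ i) \<le> norm (rowop X)"
proof (rule norm_blinfun_bound)
  fix x
  have "rowop X (axis i x) = (X $ i) x"
    by (simp add: rowop_apply axis_def if_distrib[of "blinfun_apply _"] cong: if_cong)
  moreover have "norm (axis i x :: 'a ^ 'b) = norm x"
    by (simp add: norm_vec_def L2_set_def axis_def if_distrib[of norm] if_distrib[of "\<lambda>x. x\<^sup>2"] cong: if_cong)
  ultimately show "norm ((X $ i) x) \<le> norm (rowop X) * norm x" by (metis norm_blinfun)
qed simp

lemma continuous_on_rowop [continuous_intros]:
  assumes "continuous_on S f" shows "continuous_on S (\<lambda>x. rowop (f x))"
proof -
  have "bounded_linear (rowop :: 'h::complex_hilbert op ^ 'n::finite \<Rightarrow> _)"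
  proof (rule bounded_linear_intro[where K = "real CARD('n)"])
    fix x y :: "'h op ^ 'n" and r
    show "rowop (x + y) = rowop x + rowop y"
      by (rule blinfun_eqI) (simp add: rowop_apply blinfun.add_left sum.distrib)
    show "rowop (r *\<^sub>R x) = r *\<^sub>R rowop x"
      by (rule blinfun_eqI) (simp add: rowop_apply blinfun.scaleR_left scaleR_sum_right)
    have "norm (rowop x) \<le> (\<Sum>i\<in>(UNIV :: 'n set). norm x)"
      using norm_rowop_le by (rule order_trans) (intro sum_mono Finite_Cartesian_Product.norm_nth_le)
    then show "norm (rowop x) \<le> norm x * real CARD('n)" by (simp add: mult.commute)
  qed
  then show ?thesis using assms by (rule bounded_linear.continuous_on)
qed

text \<open>\<open>V\<close> is the adjoint of the row \<open>R\<close>, so \<open>P = R R^*\<close>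
  and \<open>(norm (V y))\<^sup>2 = inner (P y) y\<close>. This yields both
  \<open>norm R \<le> sqrt (norm P)\<close> and \<open>norm P \<le> (norm R)\<^sup>2\<close>; from
  here on the ball is handled as the set of strict row contractions.\<close>

lemma nc_ball_iff:
  fixes X :: "'h::complex_hilbert op ^ 'n::finite"
  shows "X \<in> nc_ball \<longleftrightarrow> (\<forall>i. X $ i \<in> BH) \<and> norm (rowop X) < 1"
proof (cases "\<forall>i. X $ i \<in> BH")
  case True
  define P where "P = (\<Sum>i\<in>UNIV. (X $ i) o\<^sub>L op_adj (X $ i))"
  define V :: "'h \<Rightarrow> 'h ^ 'n" where "V y = (\<chi> i. op_adj (X $ i) y)" for y
  have P: "rowop X (V y) = P y" for y
    by (simp add: P_def V_def rowop_apply blinfun.sum_left)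
  have inn: "inner (rowop X x) y = inner x (V y)" for x y
    using True by (simp add: rowop_apply V_def inner_vec_def inner_sum_left inner_op_adj)
  have V: "(norm (V y))\<^sup>2 = inner (P y) y" for y
    by (simp add: power2_norm_eq_inner inn[symmetric] P)
  have "norm (rowop X) < 1" if "norm P < 1"
  proof -
    have Vle: "norm (V y) \<le> sqrt (norm P) * norm y" for y
    proof -
      have "(norm (V y))\<^sup>2 \<le> norm (P y) * norm y" unfolding V by (rule norm_cauchy_schwarz)
      also have "\<dots> \<le> norm P * norm y * norm y" by (intro mult_right_mono norm_blinfun) simp
      finally show ?thesis
        by (metis abs_norm_cancel mult.assoc power2_eq_square real_le_rsqrt real_sqrt_abs real_sqrt_mult)
    qed
    have "norm (rowop X) \<le> sqrt (norm P)"
    proof (rule norm_blinfun_bound)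
      fix x
      have "norm (rowop X x) * norm (rowop X x) = inner x (V (rowop X x))"
        by (simp add: inn[symmetric] power2_norm_eq_inner[symmetric] power2_eq_square)
      also have "\<dots> \<le> norm x * norm (V (rowop X x))" by (rule norm_cauchy_schwarz)
      also have "\<dots> \<le> norm x * (sqrt (norm P) * norm (rowop X x))" by (intro mult_left_mono Vle) simp
      finally have "norm (rowop X x) * norm (rowop X x) \<le> norm (rowop X x) * (sqrt (norm P) * norm x)"
        by (simp add: algebra_simps)
      then show "norm (rowop X x) \<le> sqrt (norm P) * norm x"
        by (cases "rowop X x = 0") auto
    qed simp
    then show ?thesis using that by (smt (verit) real_sqrt_lt_1_iff)
  qed
  moreover have "norm P < 1" if "norm (rowop X) < 1"
  proof -
    let ?r = "norm (rowop X)"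
    have Vle: "norm (V y) \<le> ?r * norm y" for y
    proof (cases "V y = 0")
      case False
      have "norm (V y) * norm (V y) \<le> norm (rowop X (V y)) * norm y"
        using V[of y] P[of y] norm_cauchy_schwarz[of "P y" y] by (simp add: power2_eq_square)
      also have "\<dots> \<le> ?r * norm (V y) * norm y" by (intro mult_right_mono norm_blinfun) simp
      finally have "norm (V y) * norm (V y) \<le> norm (V y) * (?r * norm y)" by (simp add: algebra_simps)
      then show ?thesis using False by simp
    qed simp
    have "norm P \<le> ?r * ?r"
    proof (rule norm_blinfun_bound)
      fix y
      have "norm (P y) \<le> ?r * norm (V y)" unfolding P[symmetric] by (rule norm_blinfun)
      also have "\<dots> \<le> ?r * (?r * norm y)" by (intro mult_left_mono Vle) simp
      finally show "norm (P y) \<le> ?r * ?r * norm y" by (simp add: mult.assoc)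
    qed simp
    also have "\<dots> < 1" using that by (metis norm_ge_zero mult_less_cancel_left2 mult_strict_mono' mult_1)
    finally show ?thesis .
  qed
  ultimately show ?thesis using True by (auto simp: nc_ball_def P_def[symmetric])
qed (auto simp: nc_ball_def)

lemma nc_ball_BH: "X \<in> nc_ball \<Longrightarrow> X $ i \<in> BH" and nc_ball_norm: "X \<in> nc_ball \<Longrightarrow> norm (rowop X) < 1"
  by (auto simp: nc_ball_iff)

section \<open>Orthonormal families\<close>

text \<open>A partial sum over a set containing \<open>F0\<close> differs from the sum over
  \<open>F0\<close> by a sum over a set disjoint from \<open>F0\<close>, which makes the net of
  partial sums Cauchy.\<close>

lemma summable_on_CauchyI:
  fixes f :: "'i \<Rightarrow> 'b::banach"
  assumes "\<And>\<epsilon>. \<epsilon> > 0 \<Longrightarrow> \<exists>F0. finite F0 \<and> F0 \<subseteq> A \<and>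
             (\<forall>F. finite F \<and> F \<subseteq> A \<and> F \<inter> F0 = {} \<longrightarrow> norm (sum f F) < \<epsilon>)"
  shows "f summable_on A"
proof -
  have "\<exists>P. eventually P (finite_subsets_at_top A) \<and>
          (\<forall>F F'. P F \<and> P F' \<longrightarrow> dist (sum f F) (sum f F') < e)" if "e > 0" for e
  proof -
    obtain F0 where F0: "finite F0" "F0 \<subseteq> A"
      "\<And>F. finite F \<and> F \<subseteq> A \<and> F \<inter> F0 = {} \<Longrightarrow> norm (sum f F) < e / 2"
      using assms[of "e / 2"] \<open>e > 0\<close> by auto
    define P where "P F \<longleftrightarrow> finite F \<and> F \<subseteq> A \<and> F0 \<subseteq> F" for F
    have "dist (sum f F) (sum f F0) < e / 2" if "P F" for F
      using that F0(3)[of "F - F0"] F0(1,2) by (simp add: P_def dist_norm sum_diff)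
        (metis (no_types) Diff_disjoint Int_commute finite_Diff order_trans[OF Diff_subset])
    then have "dist (sum f F) (sum f F') < e" if "P F" "P F'" for F F'
      using that dist_triangle_half_r[of "sum f F0" "sum f F" e "sum f F'"] by (metis dist_commute)
    moreover have "eventually P (finite_subsets_at_top A)"
      unfolding P_def eventually_finite_subsets_at_top using F0 by blast
    ultimately show ?thesis by blast
  qed
  then have "cauchy_filter (filtermap (sum f) (finite_subsets_at_top A))"
    by (simp add: cauchy_filter_metric_filtermap)
  moreover have "complete (UNIV :: 'b set)"
    by (meson Cauchy_convergent UNIV_I complete_def convergent_def)
  ultimately obtain L where "(sum f \<longlongrightarrow> L) (finite_subsets_at_top A)"
    using complete_uniform[where S = UNIV] by (force simp add: filterlim_def)
  then show ?thesis using summable_on_def has_sum_def by blast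
qed

section \<open>Square-summable families and orthonormal expansions\<close>

abbreviation square_summable :: "('i \<Rightarrow> complex) \<Rightarrow> bool" where
  "square_summable c \<equiv> (\<lambda>i. (cmod (c i))\<^sup>2) summable_on UNIV"

locale orthonormal =
  fixes e :: "'i \<Rightarrow> 'h::complex_hilbert"
  assumes orth: "cinner (e i) (e j) = (if i = j then 1 else 0)"
begin

text \<open>Synthesis operator, an isometry from square-summable families into \<open>'h\<close>.
  Applied to the coefficients \<open>cinner x (e i)\<close> of a vector it gives the orthogonal
  projection of \<open>x\<close> onto the closed span of \<open>e\<close>.\<close>

definition synth :: "('i \<Rightarrow> complex) \<Rightarrow> 'h" where
  "synth c = (\<Sum>\<^sub>\<infinity>i. c i *\<^sub>C e i)"

lemma norm_e [simp]: "norm (e i) = 1"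
proof -
  have "(norm (e i))\<^sup>2 = 1" using cinner_same[of "e i"] orth[of i i]
    by (metis of_real_eq_1_iff)
  then show ?thesis by (simp add: power2_eq_1_iff) (smt (verit) norm_ge_zero)
qed

lemma cinner_finite_sum:
  "finite F \<Longrightarrow> cinner (\<Sum>i\<in>F. c i *\<^sub>C e i) (e j) = (if j \<in> F then c j else 0)"
  by (simp add: cinner_sum_left cinner_scaleC_left orth if_distrib[of "(*) _"] cong: if_cong)

lemma norm_finite_sum: "finite F \<Longrightarrow> (norm (\<Sum>i\<in>F. c i *\<^sub>C e i))\<^sup>2 = (\<Sum>i\<in>F. (cmod (c i))\<^sup>2)"
proof -
  assume F: "finite F"
  have "complex_of_real ((norm (\<Sum>i\<in>F. c i *\<^sub>C e i))\<^sup>2) = (\<Sum>i\<in>F. cnj (c i) * c i)"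
    unfolding cinner_same[symmetric]
    by (subst cinner_sum_right) (auto simp: cinner_scaleC_right cinner_finite_sum F intro!: sum.cong)
  also have "\<dots> = of_real (\<Sum>i\<in>F. (cmod (c i))\<^sup>2)"
    by (simp add: complex_norm_square mult.commute del: of_real_power)
  finally show ?thesis using of_real_eq_iff by blast
qed

lemma synth_summable:
  assumes "square_summable c"
  shows "(\<lambda>i. c i *\<^sub>C e i) summable_on UNIV"
proof (rule summable_on_CauchyI)
  fix \<epsilon> :: real assume e: "\<epsilon> > 0"
  obtain F0 where F0: "finite F0" "dist (\<Sum>i\<in>F0. (cmod (c i))\<^sup>2) (\<Sum>\<^sub>\<infinity>i. (cmod (c i))\<^sup>2) \<le> \<epsilon>\<^sup>2 / 2"
    using infsum_finite_approximation[OF assms, of "\<epsilon>\<^sup>2 / 2"] e by auto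
  have "norm (\<Sum>i\<in>F. c i *\<^sub>C e i) < \<epsilon>" if F: "finite F" "F \<inter> F0 = {}" for F
  proof -
    have "(\<Sum>i\<in>F0 \<union> F. (cmod (c i))\<^sup>2) \<le> (\<Sum>\<^sub>\<infinity>i. (cmod (c i))\<^sup>2)"
      by (rule finite_sum_le_infsum) (use assms F0 F in auto)
    moreover have "(\<Sum>i\<in>F0 \<union> F. (cmod (c i))\<^sup>2) = (\<Sum>i\<in>F0. (cmod (c i))\<^sup>2) + (\<Sum>i\<in>F. (cmod (c i))\<^sup>2)"
      by (rule sum.union_disjoint) (use F0 F in auto)
    moreover have "0 < \<epsilon>\<^sup>2" using e by simp
    ultimately have *: "(\<Sum>i\<in>F. (cmod (c i))\<^sup>2) < \<epsilon>\<^sup>2"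
      using F0(2) unfolding dist_real_def abs_le_iff by linarith
    then have "(norm (\<Sum>i\<in>F. c i *\<^sub>C e i))\<^sup>2 < \<epsilon>\<^sup>2"
      by (simp only: norm_finite_sum[OF F(1)])
    then show ?thesis using e by (simp add: power2_less_imp_less)
  qed
  then show "\<exists>F0. finite F0 \<and> F0 \<subseteq> UNIV \<and>
      (\<forall>F. finite F \<and> F \<subseteq> UNIV \<and> F \<inter> F0 = {} \<longrightarrow> norm (\<Sum>i\<in>F. c i *\<^sub>C e i) < \<epsilon>)"
    using F0(1) by blast
qed

lemma synth_has_sum: "square_summable c \<Longrightarrow> ((\<lambda>i. c i *\<^sub>C e i) has_sum synth c) UNIV"
  unfolding synth_def by (rule has_sum_infsum[OF synth_summable])

lemma cinner_synth_has_sum: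
  "square_summable c \<Longrightarrow> ((\<lambda>i. c i * cinner (e i) y) has_sum cinner (synth c) y) UNIV"
  using has_sum_bounded_linear[OF bounded_linear_cinner_left synth_has_sum]
  by (simp add: cinner_scaleC_left)

lemma cinner_synth: "square_summable c \<Longrightarrow> cinner (synth c) (e j) = c j"
proof -
  assume "square_summable c"
  from cinner_synth_has_sum[OF this, of "e j"]
  have "((\<lambda>i. if i = j then c j else 0) has_sum cinner (synth c) (e j)) UNIV"
    by (rule has_sum_cong[THEN iffD1, rotated]) (simp add: orth)
  moreover have "((\<lambda>i. if i = j then c j else 0) has_sum c j) UNIV"
    by (rule has_sum_finite_neutralI[of "{j}"]) auto
  ultimately show ?thesis by (rule has_sum_unique)
qed

lemma norm_synth_has_sum:
  assumes "square_summable c"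
  shows "((\<lambda>i. (cmod (c i))\<^sup>2) has_sum (norm (synth c))\<^sup>2) UNIV"
proof -
  have "((\<lambda>i. c i * cnj (c i)) has_sum cinner (synth c) (synth c)) UNIV"
    using cinner_synth_has_sum[OF assms, of "synth c"] 
    by (rule has_sum_cong[THEN iffD1, rotated])
      (subst cinner_commute, simp add: cinner_synth[OF assms])
  then have "((\<lambda>i. complex_of_real ((cmod (c i))\<^sup>2)) has_sum of_real ((norm (synth c))\<^sup>2)) UNIV"
    by (simp only: cinner_same complex_norm_square)
  from has_sum_Re[OF this] show ?thesis by simp
qed

lemma norm_synth: "square_summable c \<Longrightarrow> norm (synth c) = sqrt (\<Sum>\<^sub>\<infinity>i. (cmod (c i))\<^sup>2)"
  using norm_synth_has_sum[THEN infsumI] by (metis norm_ge_zero real_sqrt_abs abs_of_nonneg)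

lemma bessel_finite: "finite F \<Longrightarrow> (\<Sum>i\<in>F. (cmod (cinner x (e i)))\<^sup>2) \<le> (norm x)\<^sup>2"
proof -
  assume F: "finite F"
  define p where "p = (\<Sum>i\<in>F. cinner x (e i) *\<^sub>C e i)"
  have p: "(norm p)\<^sup>2 = (\<Sum>i\<in>F. (cmod (cinner x (e i)))\<^sup>2)"
    unfolding p_def by (rule norm_finite_sum[OF F])
  have "cinner x p = (\<Sum>i\<in>F. cnj (cinner x (e i)) * cinner x (e i))"
    by (simp add: p_def cinner_sum_right cinner_scaleC_right)
  also have "\<dots> = of_real ((norm p)\<^sup>2)"
    by (simp add: p complex_norm_square mult.commute del: of_real_power)
  finally have "inner x p = (norm p)\<^sup>2" by (simp add: Re_cinner[symmetric])
  then have "(norm (x - p))\<^sup>2 = (norm x)\<^sup>2 - (norm p)\<^sup>2"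
    by (simp add: power2_norm_eq_inner inner_diff inner_commute)
  then show ?thesis using p by (smt (verit) zero_le_power2)
qed

lemma bessel_summable: "square_summable (\<lambda>i. cinner x (e i))"
proof (rule nonneg_bdd_above_summable_on)
  show "bdd_above (sum (\<lambda>i. (cmod (cinner x (e i)))\<^sup>2) ` {F. F \<subseteq> UNIV \<and> finite F})"
    by (rule bdd_aboveI2[where M = "(norm x)\<^sup>2"]) (simp add: bessel_finite)
qed simp

lemma norm_synth_le: "norm (synth (\<lambda>i. cinner x (e i))) \<le> norm x"
proof -
  have "(norm (synth (\<lambda>i. cinner x (e i))))\<^sup>2 \<le> (norm x)\<^sup>2"
    using norm_synth_has_sum[OF bessel_summable, of x] by (rule has_sum_le_finite_sums) (rule bessel_finite)
  then show ?thesis by (rule power2_le_imp_le) simp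
qed

lemma synth_coeff_synth: "square_summable c \<Longrightarrow> synth (\<lambda>i. cinner (synth c) (e i)) = synth c"
  by (simp add: cinner_synth)

end

lemma square_summable_add:
  assumes "square_summable c" "square_summable d"
  shows "square_summable (\<lambda>i. c i + d i)"
proof (rule summable_on_comparison_test)
  show "(\<lambda>i. 2 * (cmod (c i))\<^sup>2 + 2 * (cmod (d i))\<^sup>2) summable_on UNIV"
    by (intro summable_on_add summable_on_cmult_right assms)
  show "(cmod (c i + d i))\<^sup>2 \<le> 2 * (cmod (c i))\<^sup>2 + 2 * (cmod (d i))\<^sup>2" for i
  proof -
    have "(cmod (c i + d i))\<^sup>2 \<le> (cmod (c i) + cmod (d i))\<^sup>2" by (intro power_mono norm_triangle_ineq) simp
    also have "\<dots> \<le> 2 * (cmod (c i))\<^sup>2 + 2 * (cmod (d i))\<^sup>2"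
      using zero_le_power2[of "cmod (c i) - cmod (d i)"] by (simp add: power2_eq_square algebra_simps)
    finally show ?thesis .
  qed
qed auto

lemma square_summable_cmult: "square_summable c \<Longrightarrow> square_summable (\<lambda>i. z * c i)"
  by (simp add: norm_mult power_mult_distrib summable_on_cmult_right)

lemma square_summable_diff:
  "square_summable c \<Longrightarrow> square_summable d \<Longrightarrow> square_summable (\<lambda>i. c i - d i)"
  using square_summable_add[of c "\<lambda>i. (-1) * d i"] square_summable_cmult[of d "-1"] by simp

context orthonormal
begin

lemma synth_add:
  "square_summable c \<Longrightarrow> square_summable d \<Longrightarrow> synth (\<lambda>i. c i + d i) = synth c + synth d"
  using infsum_add[OF synth_summable[of c] synth_summable[of d]]
  by (simp add: synth_def scaleC_add_left)

lemma synth_cmult: "square_summable c \<Longrightarrow> synth (\<lambda>i. z * c i) = z *\<^sub>C synth c"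
  using has_sum_bounded_linear[OF bounded_linear_scaleC[of z] synth_has_sum[of c], THEN infsumI]
  by (simp add: synth_def scaleC_scaleC)

end

text \<open>Gram-Schmidt: no finite set spans, so some \<open>x\<close> lies outside the span of the
  vectors chosen so far; subtracting its projection and normalising gives the next one.\<close>

lemma orthonormal_sequence_ex:
  assumes "\<not> (\<exists>B :: 'h::complex_hilbert set. finite B \<and> module.span scaleC B = UNIV)"
  shows "\<exists>e :: nat \<Rightarrow> 'h. orthonormal e"
proof -
  interpret vs: vector_space "scaleC :: complex \<Rightarrow> 'h \<Rightarrow> 'h" by (rule vector_space_scaleC)
  define P where "P f n r \<longleftrightarrow> norm r = 1 \<and> (\<forall>m<n. cinner r (f m) = 0)" for f :: "nat \<Rightarrow> 'h" and n r
  have "\<exists>f. \<forall>n. P f n (f n)"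
  proof (rule dependent_wellorder_choice)
    show "P f n r = P g n r" if "\<And>m. m < n \<Longrightarrow> f m = g m" for r f g n
      using that by (simp add: P_def)
  next
    fix n f assume prev: "\<And>m. m < n \<Longrightarrow> P f m (f m)"
    have ort: "cinner (f i) (f j) = (if i = j then 1 else 0)" if "i < n" "j < n" for i j
    proof (cases i j rule: linorder_cases)
      case less then show ?thesis using prev[of j] that by (subst cinner_commute) (auto simp: P_def)
    next
      case equal then show ?thesis using prev[of j] that by (auto simp: P_def cinner_same)
    next
      case greater then show ?thesis using prev[of i] that by (auto simp: P_def)
    qed
    have "finite (f ` {..<n})" by simp
    then obtain x where x: "x \<notin> vs.span (f ` {..<n})" using assms by blast
    define y where "y = x - (\<Sum>m<n. cinner x (f m) *\<^sub>C f m)"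
    have "(\<Sum>m<n. cinner x (f m) *\<^sub>C f m) \<in> vs.span (f ` {..<n})"
      by (intro vs.span_sum vs.span_scale vs.span_base) auto
    then have "y \<noteq> 0" using x by (auto simp: y_def)
    have "cinner y (f k) = 0" if "k < n" for k
    proof -
      have "(\<Sum>m<n. cinner x (f m) * cinner (f m) (f k)) = (\<Sum>m<n. if m = k then cinner x (f m) else 0)"
        by (intro sum.cong) (auto simp: ort that)
      then show ?thesis using that
        by (simp add: y_def cinner_diff_left cinner_sum_left cinner_scaleC_left)
    qed
    then have "P f n ((1 / norm y) *\<^sub>R y)"
      using \<open>y \<noteq> 0\<close> by (simp add: P_def cinner_scaleR_left)
    then show "\<exists>r. P f n r" by blast
  qed
  then obtain f where f: "\<And>n. P f n (f n)" by blast
  have "cinner (f i) (f j) = (if i = j then 1 else 0)" for i j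
  proof (cases i j rule: linorder_cases)
    case less then show ?thesis using f[of j] by (subst cinner_commute) (auto simp: P_def)
  next
    case equal then show ?thesis using f[of j] by (auto simp: P_def cinner_same)
  next
    case greater then show ?thesis using f[of i] by (auto simp: P_def)
  qed
  then show ?thesis by (intro exI[of _ f]) (simp add: orthonormal_def)
qed

section \<open>Operators and words\<close>

lemma BH_apply: "T \<in> BH \<Longrightarrow> blinfun_apply T (c *\<^sub>C x) = c *\<^sub>C blinfun_apply T x"
  by (simp add: BH_def)

lemma BH_id [simp]: "id_blinfun \<in> BH" by (simp add: BH_def)
lemma BH_zero [simp]: "0 \<in> BH" by (simp add: BH_def)
lemma BH_compose: "S \<in> BH \<Longrightarrow> T \<in> BH \<Longrightarrow> S o\<^sub>L T \<in> BH" by (simp add: BH_def)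
lemma BH_add: "S \<in> BH \<Longrightarrow> T \<in> BH \<Longrightarrow> S + T \<in> BH"
  by (simp add: BH_def blinfun.add_left scaleC_add_right)
lemma BH_diff: "S \<in> BH \<Longrightarrow> T \<in> BH \<Longrightarrow> S - T \<in> BH"
  by (simp add: BH_def blinfun.diff_left scaleC_diff_right)
lemma BH_sum: "(\<And>i. i \<in> A \<Longrightarrow> f i \<in> BH) \<Longrightarrow> (\<Sum>i\<in>A. f i) \<in> BH"
  by (induction A rule: infinite_finite_induct) (auto intro: BH_add)
lemma BH_scalar_op [simp]: "scalar_op c \<in> BH"
  by (simp add: BH_def scalar_op_apply scaleC_scaleC mult.commute)
lemma BH_word_op: "(\<And>i. X $ i \<in> BH) \<Longrightarrow> word_op X \<alpha> \<in> BH"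
  by (induction \<alpha>) (auto intro: BH_compose)

lemma blinfun_compose_id [simp]: "id_blinfun o\<^sub>L T = T" "T o\<^sub>L id_blinfun = T"
  by (auto intro: blinfun_eqI)

lemma scalar_op_0 [simp]: "scalar_op 0 = 0"
  by (rule blinfun_eqI) (simp add: scalar_op_apply)
lemma scalar_op_1 [simp]: "scalar_op 1 = id_blinfun"
  by (rule blinfun_eqI) (simp add: scalar_op_apply)
lemma scalar_op_add: "scalar_op (c + d) = scalar_op c + scalar_op d"
  by (rule blinfun_eqI) (simp add: scalar_op_apply blinfun.add_left scaleC_add_left)
lemma scalar_op_mult: "scalar_op (c * d) = scalar_op c o\<^sub>L scalar_op d"
  by (rule blinfun_eqI) (simp add: scalar_op_apply scaleC_scaleC)
lemma scalar_op_sum: "scalar_op (\<Sum>i\<in>A. f i) = (\<Sum>i\<in>A. scalar_op (f i))"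
  by (induction A rule: infinite_finite_induct) (auto simp: scalar_op_add)

lemma norm_scalar_op_le: "norm (scalar_op c) \<le> cmod c"
  by (rule norm_blinfun_bound) (simp_all add: scalar_op_apply norm_scaleC)

lemma bounded_linear_scalar_op: "bounded_linear scalar_op"
proof (rule bounded_linear_intro[where K = 1])
  show "scalar_op (r *\<^sub>R x) = r *\<^sub>R (scalar_op x :: 'a op)" for r x
    by (rule blinfun_eqI)
      (simp add: scalar_op_apply blinfun.scaleR_left scaleR_scaleC scaleC_scaleC scaleR_conv_of_real)
qed (simp_all add: scalar_op_add norm_scalar_op_le)

section \<open>Sums over words grouped by length\<close>

lemma finite_words [simp]: "finite {\<alpha> :: 'n::finite list. length \<alpha> = k}"
  using finite_lists_length_eq[of "UNIV :: 'n set" k] by simp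

lemma finite_words_less [simp]: "finite {\<alpha> :: 'n::finite list. length \<alpha> < k}"
proof -
  have "{\<alpha> :: 'n list. length \<alpha> < k} = (\<Union>j<k. {\<alpha>. length \<alpha> = j})" by auto
  then show ?thesis by simp
qed

lemma sum_words_Suc:
  "(\<Sum>\<alpha> :: 'n::finite list | length \<alpha> = Suc k. f \<alpha>) = (\<Sum>i\<in>UNIV. \<Sum>\<alpha> | length \<alpha> = k. f (i # \<alpha>))"
proof -
  have "(\<Sum>i\<in>UNIV. \<Sum>\<alpha> | length \<alpha> = k. f (i # \<alpha>)) = (\<Sum>(i, \<alpha>)\<in>UNIV \<times> {\<alpha>. length \<alpha> = k}. f (i # \<alpha>))"
    by (simp add: sum.cartesian_product)
  also have "\<dots> = (\<Sum>\<alpha> :: 'n::finite list | length \<alpha> = Suc k. f \<alpha>)"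
    by (rule sum.reindex_bij_witness[of _ "\<lambda>\<beta>. (hd \<beta>, tl \<beta>)" "\<lambda>(i, \<alpha>). i # \<alpha>"])
      (auto simp: length_Suc_conv)
  finally show ?thesis ..
qed

lemma sum_words_less_Suc:
  "(\<Sum>\<alpha> :: 'n::finite list | length \<alpha> < Suc k. f \<alpha>) =
    (\<Sum>\<alpha> | length \<alpha> < k. f \<alpha>) + (\<Sum>\<alpha> | length \<alpha> = k. f \<alpha>)"
proof -
  have "{\<alpha> :: 'n list. length \<alpha> < Suc k} = {\<alpha>. length \<alpha> < k} \<union> {\<alpha>. length \<alpha> = k}" by auto
  then show ?thesis by (simp add: sum.union_disjoint disjoint_iff)
qed

lemma sum_words_less: "(\<Sum>\<alpha> :: 'n::finite list | length \<alpha> < k. f \<alpha>) = (\<Sum>j<k. \<Sum>\<alpha> | length \<alpha> = j. f \<alpha>)"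
  by (induction k) (simp_all add: sum_words_less_Suc)

text \<open>There are finitely many letters, so the words shorter than \<open>N\<close> form finite
  sets that eventually contain every given finite set of words; the partial sums by length therefore
  follow the net of the unordered sum.\<close>

lemma has_sum_words_imp_sums:
  assumes "(f has_sum s) (UNIV :: 'n::finite list set)"
  shows "(\<lambda>k. \<Sum>\<alpha> | length \<alpha> = k. f \<alpha>) sums s"
proof -
  have "filterlim (\<lambda>N. {\<alpha> :: 'n list. length \<alpha> < N}) (finite_subsets_at_top UNIV) sequentially"
  proof (rule filterlim_finite_subsets_at_top[THEN iffD2], intro allI impI)
    fix F :: "'n list set" assume "finite F \<and> F \<subseteq> UNIV"
    then have F: "finite F" by simp
    show "\<forall>\<^sub>F N in sequentially. finite {\<alpha> :: 'n list. length \<alpha> < N} \<and>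
        F \<subseteq> {\<alpha>. length \<alpha> < N} \<and> {\<alpha> :: 'n list. length \<alpha> < N} \<subseteq> UNIV"
    proof (rule eventually_sequentiallyI)
      fix N assume "Suc (Max (length ` F)) \<le> N"
      then have "length \<alpha> < N" if "\<alpha> \<in> F" for \<alpha>
        using F that by (meson Max_ge finite_imageI imageI le_imp_less_Suc order_less_le_trans)
      then show "finite {\<alpha> :: 'n list. length \<alpha> < N} \<and>
          F \<subseteq> {\<alpha>. length \<alpha> < N} \<and> {\<alpha> :: 'n list. length \<alpha> < N} \<subseteq> UNIV" by auto
    qed
  qed
  from filterlim_compose[OF assms[unfolded has_sum_def] this]
  show ?thesis by (simp add: sums_def sum_words_less)
qed

lemma word_op_append: "word_op X (\<alpha> @ \<beta>) = word_op X \<alpha> o\<^sub>L word_op X \<beta>"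
  by (induction \<alpha>) (auto intro!: blinfun_eqI)

text \<open>The words of length \<open>k\<close> form the k-th power of the row: splitting off the
  first letter writes the sum as \<open>rowop X\<close> applied to a column of sums over shorter
  words. The bound thus does not depend on the number of words.\<close>

lemma word_row_bound:
  fixes X :: "'h::complex_hilbert op ^ 'n::finite"
  shows "norm (\<Sum>\<alpha> | length \<alpha> = k. word_op X \<alpha> (x \<alpha>)) \<le>
    norm (rowop X) ^ k * L2_set (\<lambda>\<alpha>. norm (x \<alpha>)) {\<alpha>. length \<alpha> = k}"
proof (induction k arbitrary: x)
  case 0
  then show ?case by simp
next
  case (Suc k)
  let ?\<rho> = "norm (rowop X)"
  define y :: "'h ^ 'n" where "y = (\<chi> i. \<Sum>\<alpha> | length \<alpha> = k. word_op X \<alpha> (x (i # \<alpha>)))"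
  have "(\<Sum>\<alpha> | length \<alpha> = Suc k. word_op X \<alpha> (x \<alpha>)) = rowop X y"
    by (simp add: sum_words_Suc rowop_apply y_def blinfun.sum_right)
  then have "norm (\<Sum>\<alpha> | length \<alpha> = Suc k. word_op X \<alpha> (x \<alpha>)) \<le> ?\<rho> * norm y"
    by (metis norm_blinfun)
  also have "\<dots> \<le> ?\<rho> * (?\<rho> ^ k * L2_set (\<lambda>\<alpha>. norm (x \<alpha>)) {\<alpha>. length \<alpha> = Suc k})"
  proof (rule mult_left_mono, rule power2_le_imp_le)
    have "(norm y)\<^sup>2 = (\<Sum>i\<in>UNIV. (norm (y $ i))\<^sup>2)" by (rule norm_vec_power2)
    also have "\<dots> \<le> (\<Sum>i\<in>UNIV. (?\<rho> ^ k * L2_set (\<lambda>\<alpha>. norm (x (i # \<alpha>))) {\<alpha>. length \<alpha> = k})\<^sup>2)"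
      unfolding y_def by (intro sum_mono power_mono) (use Suc.IH in auto)
    also have "\<dots> = (?\<rho> ^ k * L2_set (\<lambda>\<alpha>. norm (x \<alpha>)) {\<alpha>. length \<alpha> = Suc k})\<^sup>2"
      by (simp add: power_mult_distrib L2_set_def sum_nonneg sum_words_Suc sum_distrib_left)
    finally show "(norm y)\<^sup>2 \<le> \<dots>" .
  qed simp_all
  finally show ?case by (simp add: algebra_simps)
qed

section \<open>Homogeneous components\<close>

definition hom_part :: "'h::complex_hilbert op ^ 'n::finite \<Rightarrow> ('n list \<Rightarrow> complex) \<Rightarrow> nat \<Rightarrow> 'h op" where
  "hom_part X a k = (\<Sum>\<alpha> | length \<alpha> = k. scalar_op (a \<alpha>) o\<^sub>L word_op X \<alpha>)"

definition level_norm :: "('n::finite list \<Rightarrow> complex) \<Rightarrow> nat \<Rightarrow> real" where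
  "level_norm a k = L2_set (\<lambda>\<alpha>. cmod (a \<alpha>)) {\<alpha>. length \<alpha> = k}"

lemma hom_part_apply: "hom_part X a k x = (\<Sum>\<alpha> | length \<alpha> = k. a \<alpha> *\<^sub>C word_op X \<alpha> x)"
  by (simp add: hom_part_def blinfun.sum_left scalar_op_apply)

lemma level_norm_nonneg [simp]: "0 \<le> level_norm a k"
  by (simp add: level_norm_def)

lemma norm_hom_part_le:
  assumes "\<And>i. X $ i \<in> BH"
  shows "norm (hom_part X a k) \<le> norm (rowop X) ^ k * level_norm a k"
proof (rule norm_blinfun_bound)
  fix x
  have "hom_part X a k x = (\<Sum>\<alpha> | length \<alpha> = k. word_op X \<alpha> (a \<alpha> *\<^sub>C x))"
    by (simp add: hom_part_apply BH_apply BH_word_op assms)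
  then have "norm (hom_part X a k x) \<le>
      norm (rowop X) ^ k * L2_set (\<lambda>\<alpha>. norm (a \<alpha> *\<^sub>C x)) {\<alpha>. length \<alpha> = k}"
    by (simp add: word_row_bound)
  also have "L2_set (\<lambda>\<alpha>. norm (a \<alpha> *\<^sub>C x)) {\<alpha>. length \<alpha> = k} = level_norm a k * norm x"
    by (simp add: norm_scaleC level_norm_def L2_set_left_distrib)
  finally show "norm (hom_part X a k x) \<le> norm (rowop X) ^ k * level_norm a k * norm x"
    by (simp add: mult.assoc)
qed simp

lemma norm_le_level_norm: "cmod (a \<alpha>) \<le> level_norm a (length \<alpha>)"
  unfolding level_norm_def by (rule member_le_L2_set) auto

lemma level_norm_square: "(level_norm a k)\<^sup>2 = (\<Sum>\<alpha> | length \<alpha> = k. (cmod (a \<alpha>))\<^sup>2)"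
  by (simp add: level_norm_def L2_set_def sum_nonneg)

lemma BH_hom_part: "(\<And>i. X $ i \<in> BH) \<Longrightarrow> hom_part X a k \<in> BH"
  unfolding hom_part_def by (intro BH_sum BH_compose BH_word_op BH_scalar_op)

lemma hom_part_add: "hom_part X (\<lambda>\<alpha>. a \<alpha> + b \<alpha>) k = hom_part X a k + hom_part X b k"
  by (rule blinfun_eqI) (simp add: hom_part_apply scaleC_add_left sum.distrib blinfun.add_left)

lemma hom_part_diff: "hom_part X (\<lambda>\<alpha>. a \<alpha> - b \<alpha>) k = hom_part X a k - hom_part X b k"
  by (rule blinfun_eqI) (simp add: hom_part_apply scaleC_diff_left sum_subtractf blinfun.diff_left)

lemma hom_part_cmult: "hom_part X (\<lambda>\<alpha>. c * a \<alpha>) k = scalar_op c o\<^sub>L hom_part X a k"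
  by (rule blinfun_eqI) (simp add: hom_part_apply scalar_op_apply scaleC_sum_right scaleC_scaleC)

lemma hom_part_delta:
  "hom_part X (\<lambda>\<alpha>. if \<alpha> = \<beta> then 1 else 0) k = (if k = length \<beta> then word_op X \<beta> else 0)"
proof -
  have "hom_part X (\<lambda>\<alpha>. if \<alpha> = \<beta> then 1 else 0) k =
      (\<Sum>\<alpha> | length \<alpha> = k. if \<alpha> = \<beta> then word_op X \<beta> else 0)"
    unfolding hom_part_def by (intro sum.cong) auto
  then show ?thesis by simp
qed

text \<open>Root-free form of the limsup condition: the l2-norms of the homogeneous parts of the
  coefficients are dominated by every geometric sequence of ratio above 1.\<close>

definition subexponential :: "('n::finite list \<Rightarrow> complex) \<Rightarrow> bool" where
  "subexponential a \<longleftrightarrow> (\<forall>r. 0 < r \<and> r < 1 \<longrightarrow> (\<exists>M. \<forall>k. r ^ k * level_norm a k \<le> M))"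

lemma limsup_imp_subexponential:
  assumes "limsup (\<lambda>k. ereal (root (2 * k) (\<Sum>\<alpha> | length \<alpha> = k. (cmod (a \<alpha>))\<^sup>2))) \<le> 1"
  shows "subexponential a"
  unfolding subexponential_def
proof (intro allI impI)
  fix r :: real assume r: "0 < r \<and> r < 1"
  then have "limsup (\<lambda>k. ereal (root (2 * k) (\<Sum>\<alpha> | length \<alpha> = k. (cmod (a \<alpha>))\<^sup>2))) < ereal (1 / r)"
    by (intro le_less_trans[OF assms]) (simp add: one_ereal_def)
  then have "\<forall>\<^sub>F k in sequentially. root (2 * k) (\<Sum>\<alpha> | length \<alpha> = k. (cmod (a \<alpha>))\<^sup>2) < 1 / r"
    using Limsup_lessD by fastforce
  \<comment> \<open>\<open>root 0\<close> is 0 whatever its argument, so the root condition carries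
    information only for \<open>k > 0\<close>.\<close>
  then have "\<forall>\<^sub>F k in sequentially. r ^ k * level_norm a k \<le> 1"
    using eventually_gt_at_top[of 0]
  proof eventually_elim
    case (elim k)
    have "(level_norm a k)\<^sup>2 = root (2 * k) (\<Sum>\<alpha> | length \<alpha> = k. (cmod (a \<alpha>))\<^sup>2) ^ (2 * k)"
      using elim by (simp add: level_norm_square sum_nonneg)
    also have "\<dots> \<le> (1 / r) ^ (2 * k)"
      by (intro power_mono real_root_ge_zero sum_nonneg) (use elim in auto)
    also have "\<dots> = ((1 / r) ^ k)\<^sup>2" by (simp add: power_mult[symmetric] mult.commute)
    finally have "level_norm a k \<le> (1 / r) ^ k" by (rule power2_le_imp_le) (use r in simp)
    then show ?case using r by (simp add: field_simps)
  qed
  then obtain N where N: "\<And>k. k \<ge> N \<Longrightarrow> r ^ k * level_norm a k \<le> 1"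
    unfolding eventually_sequentially by blast
  have "r ^ k * level_norm a k \<le> 1 + (\<Sum>j<N. r ^ j * level_norm a j)" for k
  proof (cases "k < N")
    case True
    then have "r ^ k * level_norm a k \<le> (\<Sum>j<N. r ^ j * level_norm a j)"
      by (intro member_le_sum) (use r in auto)
    then show ?thesis by simp
  next
    case False
    moreover have "0 \<le> (\<Sum>j<N. r ^ j * level_norm a j)" by (intro sum_nonneg) (use r in auto)
    ultimately show ?thesis using N[of k] by simp
  qed
  then show "\<exists>M. \<forall>k. r ^ k * level_norm a k \<le> M" by blast
qed

lemma subexponential_imp_limsup:
  assumes "subexponential a"
  shows "limsup (\<lambda>k. ereal (root (2 * k) (\<Sum>\<alpha> | length \<alpha> = k. (cmod (a \<alpha>))\<^sup>2))) \<le> 1"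
proof (rule ereal_le_epsilon2[rule_format])
  fix \<epsilon> :: real assume \<epsilon>: "0 < \<epsilon>"
  define y where "y = 1 + \<epsilon>"
  \<comment> \<open>Chosen to satisfy \<open>1 / y < r < 1\<close>: then
    \<open>1 / (r * y) < 1\<close>, and the bound \<open>M / r ^ k\<close> eventually drops below
    \<open>y ^ k\<close>.\<close>
  define r where "r = 1 / (1 + \<epsilon> / 2)"
  have y: "y > 1" and r: "0 < r" "r < 1" "1 / r < y" using \<epsilon> by (auto simp: y_def r_def)
  then obtain M where M: "\<And>k. r ^ k * level_norm a k \<le> M"
    using assms unfolding subexponential_def by blast
  have q: "0 \<le> 1 / (r * y)" "1 / (r * y) < 1"
    using y r by (auto simp: field_simps)
  have "(\<lambda>k. M * (1 / (r * y)) ^ k) \<longlonglongrightarrow> M * 0"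
    by (intro tendsto_mult tendsto_const LIMSEQ_realpow_zero q)
  then have "\<forall>\<^sub>F k in sequentially. M * (1 / (r * y)) ^ k < 1"
    by (intro order_tendstoD) auto
  then have "\<forall>\<^sub>F k in sequentially. ereal (root (2 * k) (\<Sum>\<alpha> | length \<alpha> = k. (cmod (a \<alpha>))\<^sup>2)) \<le> ereal y"
    using eventually_gt_at_top[of 0]
  proof eventually_elim
    case (elim k)
    have "level_norm a k \<le> M / r ^ k" using M[of k] r by (simp add: field_simps)
    also have "\<dots> \<le> y ^ k" using elim y r by (simp add: field_simps power_mult_distrib)
    finally have "(level_norm a k)\<^sup>2 \<le> (y ^ k)\<^sup>2" by (intro power_mono) auto
    also have "\<dots> = y ^ (2 * k)" by (simp add: power_mult[symmetric] mult.commute)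
    finally have "root (2 * k) (\<Sum>\<alpha> | length \<alpha> = k. (cmod (a \<alpha>))\<^sup>2) \<le> root (2 * k) (y ^ (2 * k))"
      using elim by (simp add: level_norm_square del: real_root_power_cancel)
    also have "\<dots> = y" using elim y by (simp add: real_root_power_cancel)
    finally show ?case by simp
  qed
  then have "limsup (\<lambda>k. ereal (root (2 * k) (\<Sum>\<alpha> | length \<alpha> = k. (cmod (a \<alpha>))\<^sup>2))) \<le> ereal y"
    by (rule Limsup_bounded)
  then show "limsup (\<lambda>k. ereal (root (2 * k) (\<Sum>\<alpha> | length \<alpha> = k. (cmod (a \<alpha>))\<^sup>2))) \<le> 1 + ereal \<epsilon>"
    by (simp add: y_def one_ereal_def)
qed

lemma subexponential_summable:
  assumes "subexponential a" "0 \<le> \<rho>" "\<rho> < 1"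
  shows "summable (\<lambda>k. \<rho> ^ k * level_norm a k)"
proof -
  define r where "r = (\<rho> + 1) / 2"
  have r: "0 < r" "r < 1" "\<rho> < r" using assms by (auto simp: r_def)
  then obtain M where M: "\<And>k. r ^ k * level_norm a k \<le> M"
    using assms unfolding subexponential_def by blast
  have "summable (\<lambda>k. M * (\<rho> / r) ^ k)"
    by (intro summable_mult summable_geometric) (use r assms in auto)
  then show ?thesis
  proof (rule summable_comparison_test'[where N = 0])
    fix k
    have "\<rho> ^ k * level_norm a k = (\<rho> / r) ^ k * (r ^ k * level_norm a k)"
      using r by (simp add: power_divide)
    also have "\<dots> \<le> (\<rho> / r) ^ k * M" by (intro mult_left_mono M) (use r assms in auto)
    finally show "norm (\<rho> ^ k * level_norm a k) \<le> M * (\<rho> / r) ^ k"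
      using assms by (simp add: mult.commute)
  qed
qed

lemma square_summable_imp_subexponential:
  assumes "square_summable a"
  shows "subexponential a"
  unfolding subexponential_def
proof (intro allI impI)
  fix r :: real assume r: "0 < r \<and> r < 1"
  have "r ^ k * level_norm a k \<le> sqrt (\<Sum>\<^sub>\<infinity>\<alpha>. (cmod (a \<alpha>))\<^sup>2)" for k
  proof -
    have "(level_norm a k)\<^sup>2 \<le> (\<Sum>\<^sub>\<infinity>\<alpha>. (cmod (a \<alpha>))\<^sup>2)"
      unfolding level_norm_square by (rule finite_sum_le_infsum) (use assms in auto)
    then have "level_norm a k \<le> sqrt (\<Sum>\<^sub>\<infinity>\<alpha>. (cmod (a \<alpha>))\<^sup>2)" by (rule real_le_rsqrt)
    moreover have "r ^ k * level_norm a k \<le> 1 * level_norm a k"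
      by (intro mult_right_mono power_le_one) (use r in auto)
    ultimately show ?thesis by simp
  qed
  then show "\<exists>M. \<forall>k. r ^ k * level_norm a k \<le> M" by blast
qed

section \<open>Power series on the noncommutative ball\<close>

text \<open>Absolute convergence takes the place of the growth condition. It passes directly to
  sums, products and compositions, and inside \<open>fock\<close> this notion is equivalent to
  \<open>free_holomorphic_coeffs\<close>.\<close>

definition power_series ::
  "('h::complex_hilbert op ^ 'n::finite \<Rightarrow> 'h op) \<Rightarrow> ('n list \<Rightarrow> complex) \<Rightarrow> bool" where
  "power_series f a \<longleftrightarrow> (\<forall>X\<in>nc_ball. summable (\<lambda>k. norm (hom_part X a k)) \<and> hom_part X a sums f X)"

lemma power_series_sums: "power_series f a \<Longrightarrow> X \<in> nc_ball \<Longrightarrow> hom_part X a sums f X"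
  by (simp add: power_series_def)

lemma power_series_summable:
  fixes f :: "'h::complex_hilbert op ^ 'n::finite \<Rightarrow> 'h op" and X :: "'h op ^ 'n"
  shows "power_series f a \<Longrightarrow> X \<in> nc_ball \<Longrightarrow> summable (\<lambda>k. norm (hom_part X a k))"
  by (simp add: power_series_def)

lemma subexponential_hom_part_summable:
  assumes "subexponential a" "X \<in> nc_ball"
  shows "summable (\<lambda>k. norm (hom_part X a k))"
proof (rule summable_comparison_test'[OF subexponential_summable[OF assms(1), of "norm (rowop X)"]])
  show "norm (norm (hom_part X a k)) \<le> norm (rowop X) ^ k * level_norm a k" for k
    using norm_hom_part_le[of X a k] nc_ball_BH[OF assms(2)] by simp
qed (use nc_ball_norm[OF assms(2)] in auto)

lemma free_holomorphic_coeffs_iff: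
  "free_holomorphic_coeffs f a \<longleftrightarrow> subexponential a \<and> power_series f a"
proof -
  have "free_holomorphic_coeffs f a \<longleftrightarrow>
      limsup (\<lambda>k. ereal (root (2 * k) (\<Sum>\<alpha> | length \<alpha> = k. (cmod (a \<alpha>))\<^sup>2))) \<le> 1 \<and>
      (\<forall>X\<in>nc_ball. hom_part X a sums f X)"
    unfolding free_holomorphic_coeffs_def hom_part_def[abs_def] ..
  also have "\<dots> \<longleftrightarrow> subexponential a \<and> (\<forall>X\<in>nc_ball. hom_part X a sums f X)"
    using limsup_imp_subexponential subexponential_imp_limsup by blast
  also have "\<dots> \<longleftrightarrow> subexponential a \<and> power_series f a"
  proof -
    have "subexponential a \<Longrightarrow> \<forall>X\<in>nc_ball. hom_part X a sums f X \<Longrightarrow> power_series f a"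
      unfolding power_series_def
      by (intro ballI conjI) (erule (1) subexponential_hom_part_summable, erule (1) bspec)
    moreover have "power_series f a \<Longrightarrow> \<forall>X\<in>nc_ball. hom_part X a sums f X"
      by (intro ballI) (rule power_series_sums)
    ultimately show ?thesis by blast
  qed
  finally show ?thesis .
qed

lemma power_series_cong: "power_series f a \<Longrightarrow> (\<And>X. X \<in> nc_ball \<Longrightarrow> f X = g X) \<Longrightarrow> power_series g a"
  by (simp add: power_series_def)

lemma power_series_add:
  "power_series f a \<Longrightarrow> power_series g b \<Longrightarrow> power_series (\<lambda>X. f X + g X) (\<lambda>\<alpha>. a \<alpha> + b \<alpha>)"
  unfolding power_series_def
proof (intro ballI conjI)
  fix X :: "'a op ^ 'b"
  assume f: "\<forall>X\<in>nc_ball. summable (\<lambda>k. norm (hom_part X a k)) \<and> hom_part X a sums f X"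
    and g: "\<forall>X\<in>nc_ball. summable (\<lambda>k. norm (hom_part X b k)) \<and> hom_part X b sums g X"
    and X: "X \<in> nc_ball"
  have "summable (\<lambda>k. norm (hom_part X a k) + norm (hom_part X b k))"
    using f g X by (intro summable_add) auto
  then show "summable (\<lambda>k. norm (hom_part X (\<lambda>\<alpha>. a \<alpha> + b \<alpha>) k))"
    by (rule summable_comparison_test'[where N = 0])
      (simp only: hom_part_add[of X a b] real_norm_def abs_norm_cancel norm_triangle_ineq)
  have "(\<lambda>k. hom_part X a k + hom_part X b k) sums (f X + g X)"
    using f g X by (intro sums_add) auto
  moreover have "hom_part X (\<lambda>\<alpha>. a \<alpha> + b \<alpha>) = (\<lambda>k. hom_part X a k + hom_part X b k)"
    by (rule ext) (rule hom_part_add)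
  ultimately show "hom_part X (\<lambda>\<alpha>. a \<alpha> + b \<alpha>) sums (f X + g X)" by (simp only:)
qed

lemma power_series_cmult:
  assumes "power_series f a"
  shows "power_series (\<lambda>X. scalar_op c o\<^sub>L f X) (\<lambda>\<alpha>. c * a \<alpha>)"
  unfolding power_series_def
proof (intro ballI conjI)
  fix X :: "'a op ^ 'b" assume X: "X \<in> nc_ball"
  have bl: "bounded_linear (\<lambda>T. scalar_op c o\<^sub>L T :: 'a op)"
    by (rule bounded_bilinear.bounded_linear_right[OF bounded_bilinear_blinfun_compose])
  then obtain K where K: "\<And>T. norm (scalar_op c o\<^sub>L T :: 'a op) \<le> norm T * K"
    using bounded_linear.bounded by blast
  show "summable (\<lambda>k. norm (hom_part X (\<lambda>\<alpha>. c * a \<alpha>) k))"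
    unfolding hom_part_cmult
    by (rule summable_comparison_test'[OF summable_mult2[OF power_series_summable[OF assms X], of K]])
      (simp add: K)
  show "hom_part X (\<lambda>\<alpha>. c * a \<alpha>) sums (scalar_op c o\<^sub>L f X)"
    unfolding hom_part_cmult
    using bounded_linear.sums[OF bl power_series_sums[OF assms X]] by simp
qed

lemma power_series_diff:
  "power_series f a \<Longrightarrow> power_series g b \<Longrightarrow> power_series (\<lambda>X. f X - g X) (\<lambda>\<alpha>. a \<alpha> - b \<alpha>)"
proof -
  assume f: "power_series f a" and g: "power_series g b"
  have "scalar_op (-1) o\<^sub>L T = - T" for T :: "'a op"
    by (rule blinfun_eqI) (simp add: scalar_op_apply scaleC_minus_left blinfun.minus_left)
  then show ?thesis
    using power_series_add[OF f power_series_cmult[OF g, of "-1"]] by simp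
qed

lemma power_series_zero: "power_series (\<lambda>X. 0) (\<lambda>\<alpha>. 0)"
proof -
  have "hom_part X (\<lambda>\<alpha>. 0) = (\<lambda>k. 0)" for X :: "'a op ^ 'b"
    by (simp add: fun_eq_iff hom_part_def)
  then show ?thesis by (simp add: power_series_def)
qed

lemma power_series_sum:
  "(\<And>i. i \<in> A \<Longrightarrow> power_series (f i) (a i)) \<Longrightarrow>
    power_series (\<lambda>X. \<Sum>i\<in>A. f i X) (\<lambda>\<alpha>. \<Sum>i\<in>A. a i \<alpha>)"
  by (induction A rule: infinite_finite_induct) (auto intro: power_series_add power_series_zero)

lemma power_series_word: "power_series (\<lambda>X. word_op X \<beta>) (\<lambda>\<alpha>. if \<alpha> = \<beta> then 1 else 0)"
  unfolding power_series_def
proof (intro ballI conjI)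
  fix X :: "'a op ^ 'b"
  show "summable (\<lambda>k. norm (hom_part X (\<lambda>\<alpha>. if \<alpha> = \<beta> then 1 else 0) k))"
    by (rule summable_finite[of "{length \<beta>}"]) (auto simp: hom_part_delta)
  show "hom_part X (\<lambda>\<alpha>. if \<alpha> = \<beta> then 1 else 0) sums word_op X \<beta>"
    by (subst ext[OF hom_part_delta]) (rule sums_single)
qed

lemma power_series_id: "power_series (\<lambda>X. id_blinfun) (\<lambda>\<alpha>. if \<alpha> = [] then 1 else 0)"
  using power_series_word[of "[]"] by simp

lemma power_series_const: "power_series (\<lambda>X. scalar_op c) (\<lambda>\<alpha>. if \<alpha> = [] then c else 0)"
  using power_series_cmult[OF power_series_id, of c] by (simp add: if_distrib cong: if_cong)

lemma power_series_var: "power_series (\<lambda>X. X $ i) (\<lambda>\<alpha>. if \<alpha> = [i] then 1 else 0)"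
  using power_series_word[of "[i]"] by simp

lemma power_series_BH:
  assumes "power_series f a" "X \<in> nc_ball"
  shows "f X \<in> BH"
proof -
  have "blinfun_apply (f X) (c *\<^sub>C x) = c *\<^sub>C f X x" for c x
  proof -
    have s: "(\<lambda>k. hom_part X a k y) sums f X y" for y
      using bounded_linear.sums[OF blinfun.bounded_linear_left power_series_sums[OF assms]] .
    have "(\<lambda>k. c *\<^sub>C hom_part X a k x) sums (c *\<^sub>C f X x)"
      by (rule bounded_linear.sums[OF bounded_linear_scaleC s])
    moreover have "c *\<^sub>C hom_part X a k x = hom_part X a k (c *\<^sub>C x)" for k
      using BH_hom_part[of X a k] nc_ball_BH[OF assms(2)] by (simp add: BH_apply)
    ultimately show ?thesis using s[of "c *\<^sub>C x"] sums_unique2 by simp blast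
  qed
  then show ?thesis by (simp add: BH_def)
qed

section \<open>The left creation operators\<close>

text \<open>\<open>e\<close> plays the role of the canonical basis \<open>e\<^sub>\<alpha>\<close> of a copy of the Fock space inside \<open>'h\<close>.\<close>

locale fock = orthonormal e for e :: "'n::finite list \<Rightarrow> 'h::complex_hilbert"
begin

lemma synth_delta: "synth (\<lambda>\<alpha>. if \<alpha> = \<beta> then c else 0) = c *\<^sub>C e \<beta>"
  unfolding synth_def by (rule infsumI, rule has_sum_finite_neutralI[of "{\<beta>}"]) auto

text \<open>\<open>row_shift\<close> is the row of left creation operators: the j-th one sends
  \<open>e \<alpha>\<close> to \<open>e (j # \<alpha>)\<close> and vanishes on the orthogonal
  complement of the family. Their ranges are mutually orthogonal, so the row is a
  contraction.\<close>

definition row_coeff :: "'h ^ 'n \<Rightarrow> 'n list \<Rightarrow> complex" where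
  "row_coeff x \<beta> = (case \<beta> of [] \<Rightarrow> 0 | j # \<alpha> \<Rightarrow> cinner (x $ j) (e \<alpha>))"

lemma row_coeff_finite_sum:
  assumes "finite F"
  shows "(\<Sum>\<beta>\<in>F. (cmod (row_coeff x \<beta>))\<^sup>2) \<le> (norm x)\<^sup>2"
proof -
  have "(\<Sum>\<beta>\<in>F. (cmod (row_coeff x \<beta>))\<^sup>2) = (\<Sum>\<beta>\<in>F - {[]}. (cmod (row_coeff x \<beta>))\<^sup>2)"
    by (rule sum.mono_neutral_right) (use assms in \<open>auto simp: row_coeff_def\<close>)
  also have "\<dots> \<le> (\<Sum>\<beta>\<in>(\<lambda>(j, \<alpha>). j # \<alpha>) ` (UNIV \<times> tl ` F). (cmod (row_coeff x \<beta>))\<^sup>2)"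
  proof (rule sum_mono2)
    show "F - {[]} \<subseteq> (\<lambda>(j, \<alpha>). j # \<alpha>) ` (UNIV \<times> tl ` F)"
    proof
      fix \<beta> assume "\<beta> \<in> F - {[]}"
      then show "\<beta> \<in> (\<lambda>(j, \<alpha>). j # \<alpha>) ` (UNIV \<times> tl ` F)"
        by (intro image_eqI[of _ _ "(hd \<beta>, tl \<beta>)"]) auto
    qed
  qed (use assms in auto)
  also have "\<dots> = (\<Sum>(j, \<alpha>)\<in>UNIV \<times> tl ` F. (cmod (cinner (x $ j) (e \<alpha>)))\<^sup>2)"
    by (subst sum.reindex) (auto simp: inj_on_def row_coeff_def intro!: sum.cong)
  also have "\<dots> = (\<Sum>j\<in>UNIV. \<Sum>\<alpha>\<in>tl ` F. (cmod (cinner (x $ j) (e \<alpha>)))\<^sup>2)"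
    by (simp add: sum.cartesian_product)
  also have "\<dots> \<le> (\<Sum>j\<in>UNIV. (norm (x $ j))\<^sup>2)"
    by (intro sum_mono bessel_finite) (use assms in auto)
  finally show ?thesis by (simp add: norm_vec_power2)
qed

lemma row_coeff_summable: "square_summable (row_coeff x)"
proof (rule nonneg_bdd_above_summable_on)
  show "bdd_above (sum (\<lambda>\<beta>. (cmod (row_coeff x \<beta>))\<^sup>2) ` {F. F \<subseteq> UNIV \<and> finite F})"
    by (rule bdd_aboveI2[where M = "(norm x)\<^sup>2"]) (simp add: row_coeff_finite_sum)
qed simp

definition row_shift :: "'h ^ 'n \<Rightarrow> 'h" where
  "row_shift x = synth (row_coeff x)"

lemma norm_row_shift_le: "norm (row_shift x) \<le> norm x"
proof -
  have "(norm (row_shift x))\<^sup>2 \<le> (norm x)\<^sup>2"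
    unfolding row_shift_def using norm_synth_has_sum[OF row_coeff_summable]
    by (rule has_sum_le_finite_sums) (rule row_coeff_finite_sum)
  then show ?thesis by (rule power2_le_imp_le) simp
qed

lemma row_shift_add: "row_shift (x + y) = row_shift x + row_shift y"
proof -
  have "row_coeff (x + y) = (\<lambda>\<alpha>. row_coeff x \<alpha> + row_coeff y \<alpha>)"
    by (auto simp: row_coeff_def fun_eq_iff cinner_add_left split: list.split)
  then show ?thesis by (simp add: row_shift_def synth_add row_coeff_summable)
qed

lemma row_shift_cmult: "row_shift (\<chi> i. c *\<^sub>C (x $ i)) = c *\<^sub>C row_shift x"
proof -
  have "row_coeff (\<chi> i. c *\<^sub>C (x $ i)) = (\<lambda>\<alpha>. c * row_coeff x \<alpha>)"
    by (auto simp: row_coeff_def fun_eq_iff cinner_scaleC_left split: list.split)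
  then show ?thesis by (simp add: row_shift_def synth_cmult row_coeff_summable)
qed

lemma bounded_linear_row_shift: "bounded_linear row_shift"
proof (rule bounded_linear_intro[where K = 1])
  show "row_shift (r *\<^sub>R x) = r *\<^sub>R row_shift x" for r x
    using row_shift_cmult[of "of_real r" x] by (simp add: scaleR_vec_def scaleC_of_real)
qed (simp_all add: row_shift_add norm_row_shift_le)

text \<open>The creation tuple scaled by \<open>r\<close> lies in the ball for
  \<open>0 \<le> r < 1\<close>. A series evaluated there on the vacuum vector \<open>e []\<close>
  displays all its coefficients, weighted by \<open>r ^ length \<alpha>\<close>.\<close>

definition creation :: "real \<Rightarrow> 'h op ^ 'n" where
  "creation r = (\<chi> i. Blinfun (\<lambda>y. of_real r *\<^sub>C row_shift (axis i y)))"

lemma bounded_linear_axis: "bounded_linear (axis i :: 'h \<Rightarrow> 'h ^ 'n)"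
proof (rule bounded_linear_intro[where K = 1])
  show "axis i (x + y) = axis i x + (axis i y :: 'h ^ 'n)" for x y by (simp add: axis_def vec_eq_iff)
  show "axis i (r *\<^sub>R x) = r *\<^sub>R (axis i x :: 'h ^ 'n)" for r x by (simp add: axis_def vec_eq_iff)
  show "norm (axis i x :: 'h ^ 'n) \<le> norm x * 1" for x
    by (simp add: norm_vec_def L2_set_def axis_def if_distrib[of norm] if_distrib[of "\<lambda>x. x\<^sup>2"] cong: if_cong)
qed

lemma creation_apply: "(creation r $ i) y = of_real r *\<^sub>C row_shift (axis i y)"
  unfolding creation_def
  by (simp add: bounded_linear_Blinfun_apply bounded_linear_axis bounded_linear_compose[OF bounded_linear_scaleC
      bounded_linear_compose[OF bounded_linear_row_shift bounded_linear_axis]])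

lemma creation_BH: "creation r $ i \<in> BH"
proof -
  have "axis i (c *\<^sub>C x) = (\<chi> j. c *\<^sub>C ((axis i x :: 'h ^ 'n) $ j))" for c x
    by (simp add: axis_def vec_eq_iff)
  then show ?thesis
    by (simp add: BH_def creation_apply row_shift_cmult scaleC_scaleC mult.commute)
qed

lemma norm_rowop_creation_le:
  assumes "0 \<le> r" shows "norm (rowop (creation r)) \<le> r"
proof (rule norm_blinfun_bound)
  fix x :: "'h ^ 'n"
  have "(\<Sum>i\<in>UNIV. axis i (x $ i)) = x"
    by (simp add: vec_eq_iff axis_def if_distrib cong: if_cong)
  then have "rowop (creation r) x = of_real r *\<^sub>C row_shift x"
    by (simp add: rowop_apply creation_apply scaleC_sum_right[symmetric]
        linear_sum[OF bounded_linear.linear[OF bounded_linear_row_shift], symmetric])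
  then show "norm (rowop (creation r) x) \<le> r * norm x"
    using assms norm_row_shift_le[of x] by (simp add: norm_scaleC mult_left_mono)
qed fact

lemma creation_in_nc_ball: "0 \<le> r \<Longrightarrow> r < 1 \<Longrightarrow> creation r \<in> nc_ball"
  using norm_rowop_creation_le[of r] creation_BH by (auto simp: nc_ball_iff)

lemma creation_e: "(creation r $ i) (e \<alpha>) = of_real r *\<^sub>C e (i # \<alpha>)"
proof -
  have "row_coeff (axis i (e \<alpha>)) = (\<lambda>\<beta>. if \<beta> = i # \<alpha> then 1 else 0)"
    by (auto simp: fun_eq_iff row_coeff_def axis_def orth split: list.split)
  then show ?thesis by (simp add: creation_apply row_shift_def synth_delta)
qed

lemma word_creation_e: "word_op (creation r) \<beta> (e \<alpha>) = of_real (r ^ length \<beta>) *\<^sub>C e (\<beta> @ \<alpha>)"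
proof (induction \<beta>)
  case (Cons i \<beta>)
  then show ?case
    by (simp add: BH_apply[OF creation_BH] creation_e scaleC_scaleC mult.commute)
qed simp

lemma hom_part_creation:
  "hom_part (creation r) a k (e []) = (\<Sum>\<alpha> | length \<alpha> = k. (of_real (r ^ k) * a \<alpha>) *\<^sub>C e \<alpha>)"
  unfolding hom_part_apply by (intro sum.cong) (auto simp: word_creation_e scaleC_scaleC mult.commute)

lemma cinner_hom_part_creation:
  "cinner (hom_part (creation r) a k (e [])) (e \<beta>) = (if length \<beta> = k then of_real (r ^ k) * a \<beta> else 0)"
  by (simp add: hom_part_creation cinner_finite_sum)

lemma level_norm_le_norm_hom_part:
  assumes "0 \<le> r"
  shows "r ^ k * level_norm a k \<le> norm (hom_part (creation r) a k)"
proof -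
  have "(norm (hom_part (creation r) a k (e [])))\<^sup>2 = (r ^ k * level_norm a k)\<^sup>2"
    unfolding hom_part_creation
    by (simp add: norm_finite_sum norm_mult norm_power power_mult_distrib level_norm_square sum_distrib_left assms)
  then have "r ^ k * level_norm a k = norm (hom_part (creation r) a k (e []))"
    using assms by (simp add: power2_eq_iff_nonneg)
  also have "\<dots> \<le> norm (hom_part (creation r) a k) * norm (e [])" by (rule norm_blinfun)
  finally show ?thesis by simp
qed

text \<open>The terms of a convergent series are bounded, and at \<open>creation r\<close> the k-th
  term dominates \<open>r ^ k * level_norm a k\<close>.\<close>

lemma power_series_imp_subexponential:
  fixes f :: "'h op ^ 'n \<Rightarrow> 'h op"
  assumes "power_series f a"
  shows "subexponential a"
  unfolding subexponential_def
proof (intro allI impI)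
  fix r :: real assume r: "0 < r \<and> r < 1"
  then have "summable (\<lambda>k. norm (hom_part (creation r) a k))"
    using power_series_summable[OF assms creation_in_nc_ball] by simp
  then have "Bseq (\<lambda>k. norm (hom_part (creation r) a k))"
    by (intro convergent_imp_Bseq convergentI[OF summable_LIMSEQ_zero])
  then obtain K where "\<And>k. norm (hom_part (creation r) a k) \<le> K"
    unfolding Bseq_def by auto
  then show "\<exists>M. \<forall>k. r ^ k * level_norm a k \<le> M"
    using level_norm_le_norm_hom_part[of r] r by (meson less_imp_le order_trans)
qed

lemma free_holomorphic_coeffs_iff_power_series:
  fixes f :: "'h op ^ 'n \<Rightarrow> 'h op"
  shows "free_holomorphic_coeffs f a \<longleftrightarrow> power_series f a"
  using free_holomorphic_coeffs_iff power_series_imp_subexponential by blast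

lemma cinner_power_series_creation:
  fixes f :: "'h op ^ 'n \<Rightarrow> 'h op"
  assumes "power_series f a" "0 \<le> r" "r < 1"
  shows "cinner (f (creation r) (e [])) (e \<beta>) = of_real (r ^ length \<beta>) * a \<beta>"
proof -
  have "hom_part (creation r) a sums f (creation r)"
    using power_series_sums[OF assms(1) creation_in_nc_ball] assms by simp
  then have "(\<lambda>k. hom_part (creation r) a k (e [])) sums f (creation r) (e [])"
    by (rule bounded_linear.sums[OF blinfun.bounded_linear_left])
  from bounded_linear.sums[OF bounded_linear_cinner_left this, of "e \<beta>"]
  have "(\<lambda>k. if length \<beta> = k then of_real (r ^ k) * a \<beta> else 0) sums cinner (f (creation r) (e [])) (e \<beta>)"
    by (simp add: cinner_hom_part_creation)
  moreover have "(\<lambda>k. if length \<beta> = k then of_real (r ^ k) * a \<beta> else 0) sums (of_real (r ^ length \<beta>) * a \<beta>)"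
    using sums_single[of "length \<beta>" "\<lambda>k. of_real (r ^ k) * a \<beta>"] by (simp only: eq_commute)
  ultimately show ?thesis by (rule sums_unique2)
qed

lemma power_series_unique:
  fixes f :: "'h op ^ 'n \<Rightarrow> 'h op"
  assumes "power_series f a" "power_series f b"
  shows "a = b"
proof
  fix \<beta>
  show "a \<beta> = b \<beta>"
    using cinner_power_series_creation[OF assms(1), of "1/2" \<beta>]
      cinner_power_series_creation[OF assms(2), of "1/2" \<beta>] by simp
qed

lemma fh_coeff_eq:
  fixes f :: "'h op ^ 'n \<Rightarrow> 'h op"
  assumes "power_series f a" shows "fh_coeff f = a"
  unfolding fh_coeff_def free_holomorphic_coeffs_iff_power_series
  using assms power_series_unique by blast

lemma free_holomorphic_iff:
  fixes f :: "'h op ^ 'n \<Rightarrow> 'h op"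
  shows "free_holomorphic f \<longleftrightarrow> power_series f (fh_coeff f)"
  unfolding free_holomorphic_def free_holomorphic_coeffs_iff_power_series using fh_coeff_eq by metis

text \<open>Bessel's inequality for the value at \<open>creation r\<close> on the vacuum vector
  bounds the weighted coefficients; the weights tend to 1 as \<open>r\<close> does.\<close>

lemma bounded_power_series_square_summable:
  fixes f :: "'h op ^ 'n \<Rightarrow> 'h op"
  assumes f: "power_series f a" and M: "\<And>X. X \<in> nc_ball \<Longrightarrow> norm (f X) \<le> M"
  shows "square_summable a"
proof -
  have "(\<Sum>\<alpha>\<in>F. (cmod (a \<alpha>))\<^sup>2) \<le> M\<^sup>2" if F: "finite F" for F
  proof -
    have "(\<Sum>\<alpha>\<in>F. (cmod (of_real (r ^ length \<alpha>) * a \<alpha>))\<^sup>2) \<le> M\<^sup>2" if r: "0 < r" "r < 1" for r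
    proof -
      have "(\<Sum>\<alpha>\<in>F. (cmod (of_real (r ^ length \<alpha>) * a \<alpha>))\<^sup>2) \<le> (norm (f (creation r) (e [])))\<^sup>2"
        using bessel_finite[OF F, of "f (creation r) (e [])"] cinner_power_series_creation[OF f, of r] r by simp
      also have "norm (f (creation r) (e [])) \<le> norm (f (creation r)) * norm (e [])" by (rule norm_blinfun)
      then have "norm (f (creation r) (e [])) \<le> M"
        using M[OF creation_in_nc_ball, of r] r by simp
      then have "(norm (f (creation r) (e [])))\<^sup>2 \<le> M\<^sup>2" by (intro power_mono) auto
      finally show ?thesis .
    qed
    then have "\<forall>\<^sub>F r in at_left 1. (\<Sum>\<alpha>\<in>F. (cmod (of_real (r ^ length \<alpha>) * a \<alpha>))\<^sup>2) \<le> M\<^sup>2"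
      by (intro eventually_at_leftI[of 0]) auto
    moreover have "((\<lambda>r. \<Sum>\<alpha>\<in>F. (cmod (of_real (r ^ length \<alpha>) * a \<alpha>))\<^sup>2) \<longlongrightarrow>
        (\<Sum>\<alpha>\<in>F. (cmod (of_real (1 ^ length \<alpha>) * a \<alpha>))\<^sup>2)) (at_left 1)"
      by (intro tendsto_intros)
    ultimately show ?thesis
      using tendsto_upperbound by fastforce
  qed
  then have "bdd_above (sum (\<lambda>\<alpha>. (cmod (a \<alpha>))\<^sup>2) ` {F. F \<subseteq> UNIV \<and> finite F})"
    by (intro bdd_aboveI2[where M = "M\<^sup>2"]) simp
  then show ?thesis by (intro nonneg_bdd_above_summable_on) auto
qed

end

lemma fock_ex:
  assumes "\<not> (\<exists>B :: 'h::complex_hilbert set. finite B \<and> module.span scaleC B = UNIV)"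
  shows "\<exists>e :: 'n::finite list \<Rightarrow> 'h. fock e"
proof -
  obtain f :: "nat \<Rightarrow> 'h" where "orthonormal f" using orthonormal_sequence_ex[OF assms] by blast
  then interpret f: orthonormal f .
  have "fock (\<lambda>\<alpha> :: 'n list. f (to_nat \<alpha>))"
    unfolding fock_def orthonormal_def by (simp add: f.orth)
  then show ?thesis by blast
qed

section \<open>Products of power series\<close>

lemma abs_summable_product_nat:
  fixes A B :: "nat \<Rightarrow> real"
  assumes "summable A" "summable B" "\<And>i. 0 \<le> A i" "\<And>i. 0 \<le> B i"
  shows "(\<lambda>(i, j). A i * B j) summable_on UNIV \<times> UNIV"
proof (rule nonneg_bdd_above_summable_on)
  have "(\<Sum>(i, j)\<in>F. A i * B j) \<le> suminf A * suminf B" if F: "finite F" for F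
  proof -
    have "(\<Sum>(i, j)\<in>F. A i * B j) \<le> (\<Sum>(i, j)\<in>fst ` F \<times> snd ` F. A i * B j)"
    proof (rule sum_mono2)
      show "F \<subseteq> fst ` F \<times> snd ` F" by force
    qed (use F assms in auto)
    also have "\<dots> = (\<Sum>i\<in>fst ` F. A i) * (\<Sum>j\<in>snd ` F. B j)"
      by (simp add: sum_product sum.cartesian_product)
    also have "\<dots> \<le> suminf A * suminf B"
      by (intro mult_mono sum_le_suminf) (use F assms in \<open>auto intro: sum_nonneg suminf_nonneg\<close>)
    finally show ?thesis .
  qed
  then show "bdd_above (sum (\<lambda>(i, j). A i * B j) ` {F. F \<subseteq> UNIV \<times> UNIV \<and> finite F})"
    by (intro bdd_aboveI2[where M = "suminf A * suminf B"]) auto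
qed (use assms in auto)

text \<open>Absolute summability of the double family permits two orders of summation: by rows it
  gives \<open>a o\<^sub>L b\<close>, along antidiagonals the Cauchy product.\<close>

lemma blinfun_Cauchy_product:
  fixes A B :: "nat \<Rightarrow> 'h::banach \<Rightarrow>\<^sub>L 'h"
  assumes A: "summable (\<lambda>k. norm (A k))" "A sums a" and B: "summable (\<lambda>k. norm (B k))" "B sums b"
  shows "summable (\<lambda>k. norm (\<Sum>i\<le>k. A i o\<^sub>L B (k - i)))"
    and "(\<lambda>k. \<Sum>i\<le>k. A i o\<^sub>L B (k - i)) sums (a o\<^sub>L b)"
proof -
  have "summable (\<lambda>k. \<Sum>i\<le>k. norm (A i) * norm (B (k - i)))"
    by (rule summable_Cauchy_product) (use A B in simp_all)
  then show "summable (\<lambda>k. norm (\<Sum>i\<le>k. A i o\<^sub>L B (k - i)))"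
  proof (rule summable_comparison_test'[where N = 0])
    fix k
    have "norm (\<Sum>i\<le>k. A i o\<^sub>L B (k - i)) \<le> (\<Sum>i\<le>k. norm (A i) * norm (B (k - i)))"
      by (rule sum_norm_le) (rule norm_blinfun_compose)
    then show "norm (norm (\<Sum>i\<le>k. A i o\<^sub>L B (k - i))) \<le> (\<Sum>i\<le>k. norm (A i) * norm (B (k - i)))"
      by simp
  qed
  have hA: "(A has_sum a) UNIV" and hB: "(B has_sum b) UNIV"
    by (rule norm_summable_imp_has_sum[OF A], rule norm_summable_imp_has_sum[OF B])
  have "(\<lambda>(i, j). norm (A i) * norm (B j)) summable_on UNIV \<times> UNIV"
    using A B by (intro abs_summable_product_nat) auto
  then have "(\<lambda>(i, j). A i o\<^sub>L B j) summable_on UNIV \<times> UNIV"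
    by (rule abs_summable_summable[OF summable_on_comparison_test])
      (auto simp: norm_blinfun_compose)
  then obtain S where S: "((\<lambda>(i, j). A i o\<^sub>L B j) has_sum S) (UNIV \<times> UNIV)"
    using summable_on_def by blast
  have "((\<lambda>j. A i o\<^sub>L B j) has_sum (A i o\<^sub>L b)) UNIV" for i
    by (rule has_sum_bounded_linear[OF bounded_bilinear.bounded_linear_right[OF
          bounded_bilinear_blinfun_compose] hB])
  then have "((\<lambda>i. A i o\<^sub>L b) has_sum S) UNIV"
    using has_sum_SigmaD[OF S, of "\<lambda>i. A i o\<^sub>L b"] by simp
  moreover have "((\<lambda>i. A i o\<^sub>L b) has_sum (a o\<^sub>L b)) UNIV"
    by (rule has_sum_bounded_linear[OF bounded_bilinear.bounded_linear_left[OF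
          bounded_bilinear_blinfun_compose] hA])
  ultimately have "S = a o\<^sub>L b" by (rule has_sum_unique)
  have "((\<lambda>(k, i). A i o\<^sub>L B (k - i)) has_sum S) (SIGMA k:UNIV. {..k})"
    using S by (rule has_sum_reindex_bij_witness[of _ "\<lambda>(k, i). (i, k - i)" "\<lambda>(i, j). (i + j, i)", THEN iffD1, rotated -1])
      auto
  then have "((\<lambda>k. \<Sum>i\<le>k. A i o\<^sub>L B (k - i)) has_sum S) UNIV"
    by (rule has_sum_SigmaD) (auto intro: has_sum_finite)
  then show "(\<lambda>k. \<Sum>i\<le>k. A i o\<^sub>L B (k - i)) sums (a o\<^sub>L b)"
    unfolding \<open>S = a o\<^sub>L b\<close> by (rule has_sum_imp_sums)
qed

text \<open>Coefficients of a product: a word arises from each of its splittings into a prefix and a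
  suffix, either of which may be empty.\<close>

definition word_conv :: "('n list \<Rightarrow> complex) \<Rightarrow> ('n list \<Rightarrow> complex) \<Rightarrow> 'n list \<Rightarrow> complex" where
  "word_conv a b \<gamma> = (\<Sum>j\<le>length \<gamma>. a (take j \<gamma>) * b (drop j \<gamma>))"

lemma hom_part_word_conv:
  fixes X :: "'h::complex_hilbert op ^ 'n::finite"
  assumes X: "\<And>i. X $ i \<in> BH"
  shows "hom_part X (word_conv a b) k = (\<Sum>j\<le>k. hom_part X a j o\<^sub>L hom_part X b (k - j))"
proof -
  have "hom_part X (word_conv a b) k =
      (\<Sum>\<gamma> | length \<gamma> = k. \<Sum>j\<le>k. scalar_op (a (take j \<gamma>) * b (drop j \<gamma>)) o\<^sub>L word_op X \<gamma>)"
    unfolding hom_part_def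
  proof (intro sum.cong refl)
    fix \<gamma> :: "'n list" assume "\<gamma> \<in> {\<gamma>. length \<gamma> = k}"
    then show "scalar_op (word_conv a b \<gamma>) o\<^sub>L word_op X \<gamma> =
        (\<Sum>j\<le>k. scalar_op (a (take j \<gamma>) * b (drop j \<gamma>)) o\<^sub>L word_op X \<gamma>)"
      by (simp add: word_conv_def scalar_op_sum bounded_bilinear.sum_left[OF bounded_bilinear_blinfun_compose])
  qed
  also have "\<dots> = (\<Sum>j\<le>k. \<Sum>\<gamma> | length \<gamma> = k. scalar_op (a (take j \<gamma>) * b (drop j \<gamma>)) o\<^sub>L word_op X \<gamma>)"
    by (rule sum.swap)
  also have "\<dots> = (\<Sum>j\<le>k. hom_part X a j o\<^sub>L hom_part X b (k - j))"
  proof (intro sum.cong refl)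
    fix j assume "j \<in> {..k}"
    then have j: "j \<le> k" by simp
    have comm: "(scalar_op c o\<^sub>L word_op X \<alpha>) o\<^sub>L (scalar_op d o\<^sub>L word_op X \<beta>) =
        scalar_op (c * d) o\<^sub>L word_op X (\<alpha> @ \<beta>)" for c d \<alpha> \<beta>
      by (rule blinfun_eqI)
        (simp add: scalar_op_apply scaleC_scaleC word_op_append BH_apply BH_word_op X)
    have "hom_part X a j o\<^sub>L hom_part X b (k - j) =
        (\<Sum>(\<alpha>, \<beta>)\<in>{\<alpha>. length \<alpha> = j} \<times> {\<beta>. length \<beta> = k - j}.
           scalar_op (a \<alpha> * b \<beta>) o\<^sub>L word_op X (\<alpha> @ \<beta>))"
      unfolding sum.cartesian_product[symmetric] hom_part_def
      by (simp add: bounded_bilinear.sum_left[OF bounded_bilinear_blinfun_compose]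
          bounded_bilinear.sum_right[OF bounded_bilinear_blinfun_compose] comm) (rule sum.swap)
    also have "\<dots> = (\<Sum>\<gamma> | length \<gamma> = k. scalar_op (a (take j \<gamma>) * b (drop j \<gamma>)) o\<^sub>L word_op X \<gamma>)"
      by (rule sum.reindex_bij_witness[of _ "\<lambda>\<gamma>. (take j \<gamma>, drop j \<gamma>)" "\<lambda>(\<alpha>, \<beta>). \<alpha> @ \<beta>"])
        (use j in auto)
    finally show "(\<Sum>\<gamma> | length \<gamma> = k. scalar_op (a (take j \<gamma>) * b (drop j \<gamma>)) o\<^sub>L word_op X \<gamma>) =
        hom_part X a j o\<^sub>L hom_part X b (k - j)" ..
  qed
  finally show ?thesis .
qed

lemma power_series_mult:
  assumes "power_series f a" "power_series g b"
  shows "power_series (\<lambda>X. f X o\<^sub>L g X) (word_conv a b)"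
  unfolding power_series_def
proof (intro ballI)
  fix X :: "'a op ^ 'b" assume X: "X \<in> nc_ball"
  have "hom_part X (word_conv a b) = (\<lambda>k. \<Sum>j\<le>k. hom_part X a j o\<^sub>L hom_part X b (k - j))"
    by (rule ext) (rule hom_part_word_conv[OF nc_ball_BH[OF X]])
  then show "summable (\<lambda>k. norm (hom_part X (word_conv a b) k)) \<and>
      hom_part X (word_conv a b) sums (f X o\<^sub>L g X)"
    using blinfun_Cauchy_product[of "hom_part X a" "f X" "hom_part X b" "g X"]
      power_series_sums[OF assms(1) X] power_series_sums[OF assms(2) X]
      power_series_summable[OF assms(1) X] power_series_summable[OF assms(2) X] by simp
qed

primrec word_coeff :: "('n \<Rightarrow> 'n list \<Rightarrow> complex) \<Rightarrow> 'n list \<Rightarrow> 'n list \<Rightarrow> complex" where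
  "word_coeff p [] = (\<lambda>\<gamma>. if \<gamma> = [] then 1 else 0)"
| "word_coeff p (i # \<alpha>) = word_conv (p i) (word_coeff p \<alpha>)"

lemma power_series_word_op:
  assumes "\<And>i. power_series (\<lambda>X. \<phi> X $ i) (p i)"
  shows "power_series (\<lambda>X. word_op (\<phi> X) \<alpha>) (word_coeff p \<alpha>)"
  by (induction \<alpha>) (auto intro: power_series_id power_series_mult assms)

text \<open>Coefficients of the composition with the truncation of \<open>f\<close> to degrees below
  \<open>N\<close>. If the inner map has constant terms, a coefficient may change with every
  \<open>N\<close>; hence the limit in \<open>power_series_comp\<close>.\<close>

definition partial_coeff ::
  "('n::finite list \<Rightarrow> complex) \<Rightarrow> ('n \<Rightarrow> 'n list \<Rightarrow> complex) \<Rightarrow> nat \<Rightarrow> 'n list \<Rightarrow> complex" where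
  "partial_coeff a p N \<gamma> = (\<Sum>\<alpha> | length \<alpha> < N. a \<alpha> * word_coeff p \<alpha> \<gamma>)"

lemma power_series_partial:
  assumes "\<And>i. power_series (\<lambda>X. \<phi> X $ i) (p i)"
  shows "power_series (\<lambda>X. \<Sum>k<N. hom_part (\<phi> X) a k) (partial_coeff a p N)"
proof -
  have "power_series (\<lambda>X. \<Sum>\<alpha> | length \<alpha> < N. scalar_op (a \<alpha>) o\<^sub>L word_op (\<phi> X) \<alpha>) (partial_coeff a p N)"
    unfolding partial_coeff_def[abs_def]
    by (intro power_series_sum power_series_cmult power_series_word_op assms)
  then show ?thesis by (simp add: sum_words_less hom_part_def)
qed

section \<open>Continuity and dilations\<close>

lemma continuous_on_word_op: "continuous_on S (\<lambda>X :: 'h::complex_hilbert op ^ 'n::finite. word_op X \<alpha>)"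
proof (induction \<alpha>)
  case (Cons i \<alpha>)
  then show ?case
    by (auto intro!: bounded_bilinear.continuous_on[OF bounded_bilinear_blinfun_compose]
        continuous_on_component)
qed auto

lemma continuous_on_hom_part: "continuous_on S (\<lambda>X :: 'h::complex_hilbert op ^ 'n::finite. hom_part X a k)"
  unfolding hom_part_def
  by (intro continuous_on_sum bounded_bilinear.continuous_on[OF bounded_bilinear_blinfun_compose]
      continuous_on_const continuous_on_word_op)

text \<open>The Weierstrass test asks for one majorant on the whole set; on a ball of radius
  \<open>\<rho> < 1\<close> the growth condition supplies it.\<close>

lemma power_series_continuous_on:
  fixes f :: "'h::complex_hilbert op ^ 'n::finite \<Rightarrow> 'h op"
  assumes f: "power_series f a" "subexponential a" and \<rho>: "\<rho> < 1"
  shows "continuous_on {X \<in> nc_ball. norm (rowop X) \<le> \<rho>} f"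
proof (cases "0 \<le> \<rho>")
  case True
  let ?S = "{X :: 'h op ^ 'n. X \<in> nc_ball \<and> norm (rowop X) \<le> \<rho>}"
  have "uniform_limit ?S (\<lambda>N X. \<Sum>k<N. hom_part X a k) (\<lambda>X. \<Sum>k. hom_part X a k) sequentially"
  proof (rule Weierstrass_m_test[OF _ subexponential_summable[OF f(2) True \<rho>]])
    fix k X assume "X \<in> ?S"
    then have X: "\<And>i. X $ i \<in> BH" "norm (rowop X) \<le> \<rho>" using nc_ball_BH by auto
    have "norm (hom_part X a k) \<le> norm (rowop X) ^ k * level_norm a k"
      by (rule norm_hom_part_le[OF X(1)])
    also have "\<dots> \<le> \<rho> ^ k * level_norm a k"
      by (intro mult_right_mono power_mono X) auto
    finally show "norm (hom_part X a k) \<le> \<rho> ^ k * level_norm a k" .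
  qed
  then have "continuous_on ?S (\<lambda>X. \<Sum>k. hom_part X a k)"
    by (rule uniform_limit_theorem[rotated])
      (auto intro!: always_eventually continuous_on_sum continuous_on_hom_part)
  then show ?thesis
    by (rule continuous_on_cong[THEN iffD1, rotated -1])
      (use power_series_sums[OF f(1)] in \<open>auto simp: sums_iff\<close>)
next
  case False
  then have "{X :: 'h op ^ 'n. X \<in> nc_ball \<and> norm (rowop X) \<le> \<rho>} = {}"
    by auto (smt (verit) norm_ge_zero)
  then show ?thesis by (simp only: continuous_on_empty)
qed

definition dilate :: "complex \<Rightarrow> 'h::complex_hilbert op ^ 'n::finite \<Rightarrow> 'h op ^ 'n" where
  "dilate z X = (\<chi> i. scalar_op z o\<^sub>L X $ i)"

lemma dilate_nth: "dilate z X $ i = scalar_op z o\<^sub>L X $ i"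
  by (simp add: dilate_def)

lemma dilate_BH: "(\<And>i. X $ i \<in> BH) \<Longrightarrow> dilate z X $ i \<in> BH"
  by (simp add: dilate_def BH_compose)

lemma norm_rowop_dilate_le: "norm (rowop (dilate z X)) \<le> cmod z * norm (rowop X)"
proof -
  have "rowop (dilate z X) = scalar_op z o\<^sub>L rowop X"
    by (rule blinfun_eqI) (simp add: rowop_apply dilate_def scalar_op_apply scaleC_sum_right)
  then have "norm (rowop (dilate z X)) \<le> norm (scalar_op z :: 'a op) * norm (rowop X)"
    using norm_blinfun_compose[of "scalar_op z" "rowop X"] by simp
  also have "\<dots> \<le> cmod z * norm (rowop X)"
    by (intro mult_right_mono norm_scalar_op_le) simp
  finally show ?thesis .
qed

lemma dilate_in_nc_ball: "X \<in> nc_ball \<Longrightarrow> cmod z * norm (rowop X) < 1 \<Longrightarrow> dilate z X \<in> nc_ball"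
  using norm_rowop_dilate_le[of z X] dilate_BH[of X z] by (auto simp: nc_ball_iff)

lemma word_op_dilate:
  assumes "\<And>i. X $ i \<in> BH"
  shows "word_op (dilate z X) \<alpha> = scalar_op (z ^ length \<alpha>) o\<^sub>L word_op X \<alpha>"
proof (induction \<alpha>)
  case (Cons i \<alpha>)
  show ?case
    by (rule blinfun_eqI)
      (simp add: Cons.IH dilate_nth scalar_op_apply BH_apply assms scaleC_scaleC)
qed simp

lemma hom_part_dilate:
  assumes "\<And>i. X $ i \<in> BH"
  shows "hom_part (dilate z X) a k = scalar_op (z ^ k) o\<^sub>L hom_part X a k"
  by (rule blinfun_eqI)
    (auto simp: hom_part_apply word_op_dilate[OF assms] scalar_op_apply scaleC_sum_right scaleC_scaleC
      mult.commute intro!: sum.cong)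

lemma continuous_on_dilate: "continuous_on S (\<lambda>z. dilate z X)"
  unfolding dilate_def
  by (intro continuous_on_vec_lambda bounded_bilinear.continuous_on[OF bounded_bilinear_blinfun_compose]
      continuous_on_const bounded_linear.continuous_on[OF bounded_linear_scalar_op] continuous_on_id)

section \<open>Cauchy estimates\<close>

lemma scalar_power_series_zero:
  fixes a :: "nat \<Rightarrow> complex"
  assumes "r > 0" and s: "\<And>z. cmod z < r \<Longrightarrow> (\<lambda>n. a n * z ^ n) sums 0"
  shows "a n = 0"
proof (rule ccontr)
  assume "a n \<noteq> 0"
  have "(\<lambda>n. a n * 0 ^ n) sums a 0" by (rule powser_sums_zero)
  then have a0: "a 0 = 0" using s[of 0] assms(1) sums_unique2 by force
  with \<open>a n \<noteq> 0\<close> have "n > 0" by (metis gr0I)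
  show False
  proof (rule powser_0_nonzero[of r 0 a "\<lambda>_. 0" n])
    show "(\<lambda>n. a n * (x - 0) ^ n) sums 0" if "norm (x - 0) < r" for x
      using assms(2)[of x] that by simp
    fix s :: real assume s: "0 < s" "\<And>z :: complex. z \<in> cball 0 s - {0} \<Longrightarrow> (0 :: complex) \<noteq> 0"
    have "complex_of_real s \<in> cball 0 s - {0}" using s(1) by simp
    from s(2)[OF this] show False by simp
  qed (use assms \<open>n > 0\<close> \<open>a n \<noteq> 0\<close> in auto)
qed

lemma scalar_Cauchy_estimate:
  fixes c :: "nat \<Rightarrow> complex"
  assumes "0 < R" "R < R'"
    and s: "\<And>z. cmod z < R' \<Longrightarrow> (\<lambda>n. c n * z ^ n) sums h z"
    and B: "\<And>z. cmod z = R \<Longrightarrow> cmod (h z) \<le> B"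
  shows "cmod (c k) \<le> B / R ^ k"
proof -
  have hol: "h holomorphic_on ball 0 R'"
    by (rule power_series_holomorphic[of _ _ c]) (use s in simp)
  have bound: "cmod ((deriv ^^ k) h 0) \<le> fact k * B / R ^ k"
  proof (rule Cauchy_inequality)
    show "h holomorphic_on ball 0 R" by (rule holomorphic_on_subset[OF hol]) (use assms in auto)
    show "continuous_on (cball 0 R) h"
      by (rule holomorphic_on_imp_continuous_on[OF holomorphic_on_subset[OF hol]]) (use assms in auto)
  qed (use assms in auto)
  have "c k - (deriv ^^ k) h 0 / fact k = 0"
  proof (rule scalar_power_series_zero[of R' "\<lambda>n. c n - (deriv ^^ n) h 0 / fact n"])
    fix z assume z: "cmod z < R'"
    show "(\<lambda>n. (c n - (deriv ^^ n) h 0 / fact n) * z ^ n) sums 0"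
      using sums_diff[OF s[OF z] holomorphic_power_series[OF hol, of z]] z by (simp add: algebra_simps)
  qed (use assms in auto)
  then have "c k = (deriv ^^ k) h 0 / fact k" by simp
  then have "cmod (c k) = cmod ((deriv ^^ k) h 0) / fact k" by (simp add: norm_divide)
  also have "\<dots> \<le> (fact k * B / R ^ k) / fact k" by (rule divide_right_mono[OF bound]) simp
  finally show ?thesis by simp
qed

text \<open>On the slice formed by the dilations of \<open>X\<close> by complex \<open>z\<close>,
  the k-th Taylor coefficient of \<open>F\<close> is the homogeneous part at \<open>X\<close>. The
  scalar estimate applies to its pairing with any \<open>y\<close>; taking \<open>y\<close> to be
  \<open>hom_part X c k x\<close> turns it into a norm bound.\<close>

lemma power_series_Cauchy_estimate:
  fixes F :: "'h::complex_hilbert op ^ 'n::finite \<Rightarrow> 'h op"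
  assumes F: "power_series F c" and X: "X \<in> nc_ball" and R: "0 < R" "R * norm (rowop X) < 1"
    and M: "\<And>z. cmod z = R \<Longrightarrow> norm (F (dilate z X)) \<le> M"
  shows "norm (hom_part X c k) \<le> M / R ^ k"
proof -
  have "0 \<le> M" using M[of "of_real R"] R norm_ge_zero order_trans by (metis abs_of_pos norm_of_real)
  \<comment> \<open>The slice has to be analytic beyond the circle of radius \<open>R\<close>; half
    of the gap \<open>1 - R * norm (rowop X)\<close> can be added to \<open>R\<close> because
    \<open>norm (rowop X) < 1\<close>.\<close>
  obtain R' where R': "R < R'" "R' * norm (rowop X) < 1"
  proof
    show "R < R + (1 - R * norm (rowop X)) / 2" using R by simp
    have "norm (rowop X) < 1" by (rule nc_ball_norm[OF X])
    then have le: "(1 - R * norm (rowop X)) / 2 * norm (rowop X) \<le> (1 - R * norm (rowop X)) / 2 * 1"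
      using R by (intro mult_left_mono) auto
    show "(R + (1 - R * norm (rowop X)) / 2) * norm (rowop X) < 1"
    proof -
      have "t + v < 1" if "v \<le> (1 - t) / 2 * 1" "t < 1" for t v :: real
        using that by (simp add: field_simps)
      then show ?thesis unfolding distrib_right using le R(2) by blast
    qed
  qed
  show ?thesis
  proof (rule norm_blinfun_bound)
    fix x
    define y where "y = hom_part X c k x"
    have "cmod (cinner (hom_part X c k x) y) \<le> (M * norm x * norm y) / R ^ k"
    proof (rule scalar_Cauchy_estimate[OF R(1) R'(1)])
      fix z assume z: "cmod z < R'"
      have "cmod z * norm (rowop X) \<le> R' * norm (rowop X)" using z by (intro mult_right_mono) auto
      then have "dilate z X \<in> nc_ball" using R'(2) by (intro dilate_in_nc_ball[OF X]) simp
      then have "hom_part (dilate z X) c sums F (dilate z X)" by (rule power_series_sums[OF F])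
      then have "(\<lambda>k. hom_part (dilate z X) c k x) sums F (dilate z X) x"
        by (rule bounded_linear.sums[OF blinfun.bounded_linear_left])
      from bounded_linear.sums[OF bounded_linear_cinner_left this, of y]
      show "(\<lambda>k. cinner (hom_part X c k x) y * z ^ k) sums cinner (F (dilate z X) x) y"
        by (simp add: hom_part_dilate nc_ball_BH[OF X] scalar_op_apply cinner_scaleC_left mult.commute)
    next
      fix z assume "cmod z = R"
      have "cmod (cinner (F (dilate z X) x) y) \<le> norm (F (dilate z X) x) * norm y" by (rule cinner_norm_le)
      also have "\<dots> \<le> norm (F (dilate z X)) * norm x * norm y" by (intro mult_right_mono norm_blinfun) simp
      also have "\<dots> \<le> M * norm x * norm y" by (intro mult_right_mono M) (use \<open>cmod z = R\<close> in auto)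
      finally show "cmod (cinner (F (dilate z X) x) y) \<le> M * norm x * norm y" .
    qed
    then have *: "norm y * norm y \<le> norm y * (M / R ^ k * norm x)"
      by (simp add: y_def[symmetric] cinner_same norm_power power2_eq_square norm_mult algebra_simps)
    show "norm (hom_part X c k x) \<le> M / R ^ k * norm x"
    proof (cases "y = 0")
      case True
      then show ?thesis using \<open>0 \<le> M\<close> R by (simp add: y_def)
    next
      case False
      then show ?thesis unfolding y_def[symmetric] by (intro mult_left_le_imp_le[OF *]) simp
    qed
  qed (use \<open>0 \<le> M\<close> R in auto)
qed

section \<open>Composition\<close>

lemma dilation_bound:
  fixes \<phi> :: "'h::complex_hilbert op ^ 'n::finite \<Rightarrow> 'h op ^ 'n"
  assumes \<phi>: "\<And>i. power_series (\<lambda>X. \<phi> X $ i) (p i)" "\<And>i. subexponential (p i)"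
    and maps: "\<And>X. X \<in> nc_ball \<Longrightarrow> \<phi> X \<in> nc_ball"
    and X: "X \<in> nc_ball" and R: "0 < R" "R * norm (rowop X) < 1"
  obtains \<rho> where "0 \<le> \<rho>" "\<rho> < 1" "\<And>z. cmod z \<le> R \<Longrightarrow> dilate z X \<in> nc_ball"
    "\<And>z. cmod z \<le> R \<Longrightarrow> norm (rowop (\<phi> (dilate z X))) \<le> \<rho>"
proof -
  let ?S = "{Y :: 'h op ^ 'n. Y \<in> nc_ball \<and> norm (rowop Y) \<le> R * norm (rowop X)}"
  have le: "cmod z * norm (rowop X) \<le> R * norm (rowop X)" if "cmod z \<le> R" for z
    using that by (intro mult_right_mono) auto
  have ball: "dilate z X \<in> nc_ball" if "cmod z \<le> R" for z
    using le[OF that] R by (intro dilate_in_nc_ball[OF X]) simp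
  have "dilate z X \<in> ?S" if "cmod z \<le> R" for z
    using ball[OF that] norm_rowop_dilate_le[of z X] le[OF that] by auto
  moreover have "continuous_on ?S (\<lambda>Y. \<phi> Y $ i)" for i
    by (rule power_series_continuous_on[OF \<phi> R(2)])
  ultimately have "continuous_on (cball 0 R) (\<lambda>z. \<phi> (dilate z X) $ i)" for i
    by (intro continuous_on_compose2[of ?S "\<lambda>Y. \<phi> Y $ i", OF _ continuous_on_dilate]) auto
  then have "continuous_on (cball 0 R) (\<lambda>z. \<chi> i. \<phi> (dilate z X) $ i)"
    by (rule continuous_on_vec_lambda)
  then have "continuous_on (cball 0 R) (\<lambda>z. norm (rowop (\<phi> (dilate z X))))"
    by (intro continuous_intros) simp
  then obtain w where w: "w \<in> cball 0 R"
    "\<And>z. z \<in> cball 0 R \<Longrightarrow> norm (rowop (\<phi> (dilate z X))) \<le> norm (rowop (\<phi> (dilate w X)))"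
    using continuous_attains_sup[OF compact_cball, of "0 :: complex" R] R by force
  show ?thesis
  proof (rule that[of "norm (rowop (\<phi> (dilate w X)))"])
    show "norm (rowop (\<phi> (dilate w X))) < 1" using w(1) by (intro nc_ball_norm maps ball) simp
  qed (use w ball in auto)
qed

lemma partial_sum_tail:
  fixes Y :: "'h::complex_hilbert op ^ 'n::finite"
  assumes a: "subexponential a" and \<rho>: "0 \<le> \<rho>" "\<rho> < 1" and Y: "Y \<in> nc_ball" "norm (rowop Y) \<le> \<rho>"
    and "N \<le> M"
  shows "norm ((\<Sum>k<M. hom_part Y a k) - (\<Sum>k<N. hom_part Y a k)) \<le> (\<Sum>k. \<rho> ^ (k + N) * level_norm a (k + N))"
proof -
  have sm: "summable (\<lambda>k. \<rho> ^ k * level_norm a k)" by (rule subexponential_summable[OF a \<rho>])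
  have "{..<M} = {..<N} \<union> {N..<M}" using \<open>N \<le> M\<close> by auto
  then have "(\<Sum>k<M. hom_part Y a k) = (\<Sum>k<N. hom_part Y a k) + (\<Sum>k\<in>{N..<M}. hom_part Y a k)"
    by (simp add: sum.union_disjoint ivl_disj_int)
  then have "(\<Sum>k<M. hom_part Y a k) - (\<Sum>k<N. hom_part Y a k) = (\<Sum>k\<in>{N..<M}. hom_part Y a k)" by simp
  also have "norm \<dots> \<le> (\<Sum>k\<in>{N..<M}. \<rho> ^ k * level_norm a k)"
  proof (rule sum_norm_le)
    fix k
    have "norm (hom_part Y a k) \<le> norm (rowop Y) ^ k * level_norm a k"
      by (rule norm_hom_part_le) (rule nc_ball_BH[OF Y(1)])
    also have "\<dots> \<le> \<rho> ^ k * level_norm a k" by (intro mult_right_mono power_mono Y) auto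
    finally show "norm (hom_part Y a k) \<le> \<rho> ^ k * level_norm a k" .
  qed
  also have "\<dots> = (\<Sum>k<M - N. \<rho> ^ (k + N) * level_norm a (k + N))"
    by (rule sum.reindex_bij_witness[of _ "\<lambda>k. k + N" "\<lambda>k. k - N"]) auto
  also have "\<dots> \<le> (\<Sum>k. \<rho> ^ (k + N) * level_norm a (k + N))"
    by (rule sum_le_suminf) (use \<rho> summable_ignore_initial_segment[OF sm, of N] in auto)
  finally show ?thesis .
qed

text \<open>The coefficients of the composition are the limits of those of the compositions with the
  partial sums of \<open>f\<close>; the Cauchy estimates on the slices \<open>z \<mapsto> f (\<phi> (z X))\<close> make this convergence
  uniform enough to be summed.\<close>

lemma (in fock) power_series_comp:
  fixes f :: "'h op ^ 'n \<Rightarrow> 'h op" and \<phi> :: "'h op ^ 'n \<Rightarrow> 'h op ^ 'n"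
  assumes f: "power_series f a" and \<phi>: "\<And>i. power_series (\<lambda>X. \<phi> X $ i) (p i)"
    and maps: "\<And>X. X \<in> nc_ball \<Longrightarrow> \<phi> X \<in> nc_ball"
  shows "\<exists>b. power_series (\<lambda>X. f (\<phi> X)) b \<and> (\<forall>\<gamma>. (\<lambda>N. partial_coeff a p N \<gamma>) \<longlonglongrightarrow> b \<gamma>)"
proof -
  have a: "subexponential a" and p: "\<And>i. subexponential (p i)"
    using f \<phi> power_series_imp_subexponential by blast+
  define B where "B = partial_coeff a p"
  define S where "S N X = (\<Sum>k<N. hom_part (\<phi> X) a k)" for N X
  have S: "power_series (S N) (B N)" for N
    unfolding S_def[abs_def] B_def by (rule power_series_partial[OF \<phi>])
  have main: "\<exists>R \<epsilon>. 1 < R \<and> \<epsilon> \<longlonglongrightarrow> (0 :: real) \<and>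
      (\<forall>N M k. N \<le> M \<longrightarrow> norm (hom_part X (\<lambda>\<gamma>. B M \<gamma> - B N \<gamma>) k) \<le> \<epsilon> N / R ^ k)"
    if X: "X \<in> nc_ball" for X :: "'h op ^ 'n"
  proof -
    \<comment> \<open>This value satisfies \<open>1 < R\<close> and
      \<open>R * norm (rowop X) < 1\<close> at once, since
      \<open>norm (rowop X) < 1\<close>.\<close>
    define R where "R = 2 / (1 + norm (rowop X))"
    have "norm (rowop X) < 1" by (rule nc_ball_norm[OF X])
    moreover have pos: "0 < 1 + norm (rowop X)" by (smt (verit) norm_ge_zero)
    ultimately have R: "1 < R" "R * norm (rowop X) < 1" by (auto simp: R_def field_simps)
    then have "0 < R" by simp
    from dilation_bound[OF \<phi> p maps X this R(2)] obtain \<rho> where \<rho>: "0 \<le> \<rho>" "\<rho> < 1"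
      "\<And>z. cmod z \<le> R \<Longrightarrow> dilate z X \<in> nc_ball"
      "\<And>z. cmod z \<le> R \<Longrightarrow> norm (rowop (\<phi> (dilate z X))) \<le> \<rho>" by metis
    define \<epsilon> where "\<epsilon> N = (\<Sum>k. \<rho> ^ (k + N) * level_norm a (k + N))" for N
    have "\<epsilon> \<longlonglongrightarrow> 0"
      unfolding \<epsilon>_def by (rule suminf_exist_split2[OF subexponential_summable[OF a \<rho>(1,2)]])
    moreover have "norm (hom_part X (\<lambda>\<gamma>. B M \<gamma> - B N \<gamma>) k) \<le> \<epsilon> N / R ^ k" if "N \<le> M" for N M k
    proof (rule power_series_Cauchy_estimate[OF power_series_diff[OF S S] X \<open>0 < R\<close> R(2)])
      fix z assume "cmod z = R"
      then show "norm (S M (dilate z X) - S N (dilate z X)) \<le> \<epsilon> N"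
        unfolding S_def \<epsilon>_def by (intro partial_sum_tail a \<rho> maps that) auto
    qed
    ultimately show ?thesis using R(1) by blast
  qed
  have "\<exists>l. (\<lambda>N. B N \<gamma>) \<longlonglongrightarrow> l" for \<gamma>
  proof -
    let ?k = "length \<gamma>"
    \<comment> \<open>At \<open>creation (1/2)\<close> single coefficients can be read off; the
      weight \<open>(1/2) ^ ?k\<close> costs only a constant factor for a fixed word.\<close>
    obtain R \<epsilon> where R: "1 < R" and \<epsilon>: "\<epsilon> \<longlonglongrightarrow> (0 :: real)"
      and est: "\<And>N M k. N \<le> M \<Longrightarrow> norm (hom_part (creation (1/2)) (\<lambda>\<gamma>. B M \<gamma> - B N \<gamma>) k) \<le> \<epsilon> N / R ^ k"
      using main[OF creation_in_nc_ball[of "1/2"]] by auto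
    have bd: "cmod (B M \<gamma> - B N \<gamma>) \<le> 2 ^ ?k * \<epsilon> N" if "N \<le> M" for N M
    proof -
      have "(1/2) ^ ?k * cmod (B M \<gamma> - B N \<gamma>) \<le> (1/2) ^ ?k * level_norm (\<lambda>\<gamma>. B M \<gamma> - B N \<gamma>) ?k"
        by (intro mult_left_mono norm_le_level_norm[of "\<lambda>\<gamma>. B M \<gamma> - B N \<gamma>"]) simp
      also have "\<dots> \<le> norm (hom_part (creation (1/2)) (\<lambda>\<gamma>. B M \<gamma> - B N \<gamma>) ?k)"
        by (rule level_norm_le_norm_hom_part) simp
      also have est': "\<dots> \<le> \<epsilon> N / R ^ ?k" by (rule est[OF that])
      also have "\<dots> \<le> \<epsilon> N"
      proof -
        have "0 \<le> \<epsilon> N / R ^ ?k" using est' norm_ge_zero order_trans by blast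
        moreover have "0 < R ^ ?k" using R by simp
        ultimately have "0 \<le> \<epsilon> N" by (simp only: zero_le_divide_iff) auto
        moreover have "1 \<le> R ^ ?k" using R by simp
        ultimately have "\<epsilon> N / R ^ ?k \<le> \<epsilon> N / 1" by (intro divide_left_mono) auto
        then show ?thesis by simp
      qed
      finally show ?thesis by (simp add: field_simps power_divide)
    qed
    have "Cauchy (\<lambda>N. B N \<gamma>)"
    proof (rule metric_CauchyI)
      fix \<delta> :: real assume \<delta>: "\<delta> > 0"
      have "(\<lambda>N. 2 ^ ?k * \<epsilon> N) \<longlonglongrightarrow> 2 ^ ?k * 0" by (intro tendsto_intros \<epsilon>)
      then have "\<forall>\<^sub>F N in sequentially. 2 ^ ?k * \<epsilon> N < \<delta> / 2"
        by (rule order_tendstoD) (use \<delta> in auto)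
      then obtain N where N: "2 ^ ?k * \<epsilon> N < \<delta> / 2" by (meson eventually_sequentially order_refl)
      have *: "dist (B M \<gamma>) (B N \<gamma>) < \<delta> / 2" if "M \<ge> N" for M
        using bd[OF that] N by (simp add: dist_norm)
      have "dist (B m \<gamma>) (B n \<gamma>) < \<delta>" if "m \<ge> N" "n \<ge> N" for m n
        using *[OF that(1)] *[OF that(2)] dist_triangle_half_l by blast
      then show "\<exists>M. \<forall>m\<ge>M. \<forall>n\<ge>M. dist (B m \<gamma>) (B n \<gamma>) < \<delta>" by blast
    qed
    then show ?thesis using Cauchy_convergent convergent_def by blast
  qed
  then obtain b where b: "\<And>\<gamma>. (\<lambda>N. B N \<gamma>) \<longlonglongrightarrow> b \<gamma>" by metis
  have "power_series (\<lambda>X. f (\<phi> X)) b"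
    unfolding power_series_def
  proof (intro ballI)
    fix X :: "'h op ^ 'n" assume X: "X \<in> nc_ball"
    obtain R \<epsilon> where R: "1 < R" and \<epsilon>: "\<epsilon> \<longlonglongrightarrow> (0 :: real)"
      and est: "\<And>N M k. N \<le> M \<Longrightarrow> norm (hom_part X (\<lambda>\<gamma>. B M \<gamma> - B N \<gamma>) k) \<le> \<epsilon> N / R ^ k"
      using main[OF X] by blast
    have est_b: "norm (hom_part X (\<lambda>\<gamma>. b \<gamma> - B N \<gamma>) k) \<le> \<epsilon> N / R ^ k" for N k
    proof (rule tendsto_upperbound)
      show "(\<lambda>M. norm (hom_part X (\<lambda>\<gamma>. B M \<gamma> - B N \<gamma>) k)) \<longlonglongrightarrow> norm (hom_part X (\<lambda>\<gamma>. b \<gamma> - B N \<gamma>) k)"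
        unfolding hom_part_def
        by (intro tendsto_norm tendsto_sum bounded_bilinear.tendsto[OF bounded_bilinear_blinfun_compose]
            bounded_linear.tendsto[OF bounded_linear_scalar_op] tendsto_diff b tendsto_const)
      show "\<forall>\<^sub>F M in sequentially. norm (hom_part X (\<lambda>\<gamma>. B M \<gamma> - B N \<gamma>) k) \<le> \<epsilon> N / R ^ k"
        using eventually_ge_at_top[of N] by eventually_elim (rule est)
    qed simp
    have geo: "summable (\<lambda>k. \<epsilon> N / R ^ k)" for N
    proof -
      have "summable (\<lambda>k. \<epsilon> N * (1 / R) ^ k)" using R by (intro summable_mult summable_geometric) auto
      then show ?thesis by (simp add: power_divide)
    qed
    have sum_diff: "summable (\<lambda>k. norm (hom_part X (\<lambda>\<gamma>. b \<gamma> - B N \<gamma>) k))" for N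
      by (rule summable_comparison_test'[OF geo[of N], where N = 0]) (simp add: est_b)
    \<comment> \<open>The empty truncation has zero coefficients, so the estimate for
      \<open>N = 0\<close> is already the absolute convergence of the limit series.\<close>
    have "B 0 = (\<lambda>\<gamma>. 0)" by (simp add: B_def partial_coeff_def fun_eq_iff)
    then have summ: "summable (\<lambda>k. norm (hom_part X b k))" using sum_diff[of 0] by simp
    define s where "s = (\<Sum>k. hom_part X b k)"
    have s: "hom_part X b sums s"
      using summable_norm_cancel[OF summ] unfolding s_def by (rule summable_sums)
    have close: "norm (s - S N X) \<le> \<epsilon> N * (\<Sum>k. 1 / R ^ k)" for N
    proof -
      have "hom_part X (\<lambda>\<gamma>. b \<gamma> - B N \<gamma>) = (\<lambda>k. hom_part X b k - hom_part X (B N) k)"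
        by (rule ext) (rule hom_part_diff)
      then have "hom_part X (\<lambda>\<gamma>. b \<gamma> - B N \<gamma>) sums (s - S N X)"
        using sums_diff[OF s power_series_sums[OF S X]] by simp
      then have "s - S N X = (\<Sum>k. hom_part X (\<lambda>\<gamma>. b \<gamma> - B N \<gamma>) k)" by (rule sums_unique)
      also have "norm \<dots> \<le> (\<Sum>k. norm (hom_part X (\<lambda>\<gamma>. b \<gamma> - B N \<gamma>) k))"
        by (rule summable_norm[OF sum_diff])
      also have "\<dots> \<le> (\<Sum>k. \<epsilon> N / R ^ k)" by (intro suminf_le est_b sum_diff geo)
      also have "\<dots> = \<epsilon> N * (\<Sum>k. 1 / R ^ k)"
      proof -
        have "summable (\<lambda>k. (1 / R) ^ k)" using R by (intro summable_geometric) auto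
        then show ?thesis by (subst suminf_mult[symmetric]) (auto simp: power_divide)
      qed
      finally show ?thesis .
    qed
    have "(\<lambda>N. S N X - s) \<longlonglongrightarrow> 0"
    proof (rule Lim_null_comparison)
      show "\<forall>\<^sub>F N in sequentially. norm (S N X - s) \<le> \<epsilon> N * (\<Sum>k. 1 / R ^ k)"
        using close by (simp add: norm_minus_commute)
      show "(\<lambda>N. \<epsilon> N * (\<Sum>k. 1 / R ^ k)) \<longlonglongrightarrow> 0"
        using tendsto_mult_left_zero[OF \<epsilon>] .
    qed
    then have "(\<lambda>N. S N X) \<longlonglongrightarrow> s" by (simp add: LIM_zero_iff)
    moreover have "(\<lambda>N. S N X) \<longlonglongrightarrow> f (\<phi> X)"
      using power_series_sums[OF f maps[OF X]] by (simp add: sums_def S_def)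
    ultimately have "s = f (\<phi> X)" by (rule LIMSEQ_unique)
    with s summ show "summable (\<lambda>k. norm (hom_part X b k)) \<and> hom_part X b sums f (\<phi> X)" by simp
  qed
  with b show ?thesis unfolding B_def by blast
qed

section \<open>Compact operators on a Hilbert space\<close>

lemma riesz_lemma:
  fixes M :: "'a::real_normed_vector set"
  assumes "subspace M" "closed M" "u \<in> V" "u \<notin> M" "M \<subseteq> V" "subspace V"
  obtains x where "x \<in> V" "norm x = 1" "\<And>w. w \<in> M \<Longrightarrow> 1 / 2 \<le> norm (x - w)"
proof -
  have ne: "M \<noteq> {}" using subspace_0[OF assms(1)] by blast
  define d where "d = infdist u M"
  have d: "d > 0"
    unfolding d_def using assms(2,4) ne in_closed_iff_infdist_zero[of M u] infdist_nonneg[of u M] by force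
  \<comment> \<open>A point of \<open>M\<close> within twice the distance from \<open>u\<close>:
    after normalising \<open>u - v\<close>, the distance to \<open>M\<close> is at least one
    half.\<close>
  have "\<exists>v\<in>M. dist u v < 2 * d"
  proof (rule ccontr)
    assume "\<not> ?thesis"
    then have "2 * d \<le> infdist u M"
      unfolding infdist_def using ne by (auto intro!: cINF_greatest simp: not_less)
    then show False using d by (simp add: d_def)
  qed
  then obtain v where v: "v \<in> M" "norm (u - v) < 2 * d" by (auto simp: dist_norm)
  define t where "t = norm (u - v)"
  have t: "t > 0" "t < 2 * d" using v assms(4) by (auto simp: t_def)
  define x where "x = (1 / t) *\<^sub>R (u - v)"
  show ?thesis
  proof (rule that[of x])
    show "x \<in> V" unfolding x_def using assms v by (intro subspace_mul subspace_diff) auto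
    show "norm x = 1" using t by (simp add: x_def t_def)
    fix w assume w: "w \<in> M"
    have "x - w = (1 / t) *\<^sub>R (u - (v + t *\<^sub>R w))"
      using t by (simp add: x_def algebra_simps)
    then have "norm (x - w) = norm (u - (v + t *\<^sub>R w)) / t" using t by simp
    moreover have "d \<le> dist u (v + t *\<^sub>R w)"
      unfolding d_def using assms v w by (intro infdist_le subspace_add subspace_mul)
    ultimately have "d / t \<le> norm (x - w)" using t by (simp add: dist_norm divide_right_mono)
    moreover have "1 / 2 \<le> d / t" using t by (simp add: field_simps)
    ultimately show "1 / 2 \<le> norm (x - w)" by linarith
  qed
qed

text \<open>Otherwise there are unit vectors \<open>u n\<close> for which \<open>B (u n)\<close>
  tends to 0. Along a subsequence \<open>T (u n)\<close> converges, hence so does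
  \<open>u n\<close>, which is \<open>T (u n) - B (u n)\<close> divided by \<open>z\<close>; the
  limit is a unit vector in the kernel of \<open>B\<close>.\<close>

lemma compact_perturbation_bounded_below:
  fixes T :: "'h::complex_hilbert \<Rightarrow> 'h"
  assumes bl: "bounded_linear T"
    and cpt: "\<And>x :: nat \<Rightarrow> 'h. (\<And>m. norm (x m) \<le> 1) \<Longrightarrow> \<exists>l r. strict_mono r \<and> (\<lambda>m. T (x (r m))) \<longlonglongrightarrow> l"
    and z: "z \<noteq> 0" and inj: "\<And>x. T x = z *\<^sub>C x \<Longrightarrow> x = 0"
  obtains c where "c > 0" "\<And>x. c * norm x \<le> norm (T x - z *\<^sub>C x)"
proof -
  define B where "B x = T x - z *\<^sub>C x" for x
  have blB: "bounded_linear B"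
    unfolding B_def[abs_def] by (intro bounded_linear_sub bl bounded_linear_scaleC)
  have "\<exists>c>0. \<forall>x. c * norm x \<le> norm (B x)"
  proof (rule ccontr)
    assume "\<not> ?thesis"
    then have "\<exists>x. norm (B x) < 1 / real (Suc n) * norm x" for n
      by (metis of_nat_0_less_iff zero_less_Suc zero_less_divide_1_iff not_le)
    then obtain v where v: "\<And>n. norm (B (v n)) < 1 / real (Suc n) * norm (v n)" by metis
    have vn: "norm (v n) > 0" for n using v[of n] by (cases "v n = 0") auto
    define u where "u n = (1 / norm (v n)) *\<^sub>R v n" for n
    have u: "norm (u n) = 1" for n using vn[of n] by (simp add: u_def)
    have Bu: "norm (B (u n)) \<le> 1 / real (Suc n)" for n
    proof -
      have "norm (B (u n)) = norm (B (v n)) / norm (v n)"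
        using vn[of n] linear_scale[OF bounded_linear.linear[OF blB]] by (simp add: u_def)
      also have "\<dots> \<le> 1 / real (Suc n)" using v[of n] vn[of n] by (simp add: field_simps)
      finally show ?thesis .
    qed
    have B0: "(\<lambda>n. B (u n)) \<longlonglongrightarrow> 0"
      by (rule Lim_null_comparison[OF _ LIMSEQ_Suc[OF lim_1_over_n]]) (use Bu in auto)
    obtain l r where r: "strict_mono r" "(\<lambda>m. T (u (r m))) \<longlonglongrightarrow> l"
      using cpt[of u] u by auto
    have B0r: "(\<lambda>m. B (u (r m))) \<longlonglongrightarrow> 0"
      using LIMSEQ_subseq_LIMSEQ[OF B0 r(1)] by (simp add: o_def)
    have "(\<lambda>m. T (u (r m)) - B (u (r m))) \<longlonglongrightarrow> l - 0" by (intro tendsto_diff r B0r)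
    then have "(\<lambda>m. inverse z *\<^sub>C (T (u (r m)) - B (u (r m)))) \<longlonglongrightarrow> inverse z *\<^sub>C l"
      by (intro bounded_linear.tendsto[OF bounded_linear_scaleC]) simp
    then have lim: "(\<lambda>m. u (r m)) \<longlonglongrightarrow> inverse z *\<^sub>C l" using z by (simp add: B_def scaleC_scaleC)
    then have "(\<lambda>m. norm (u (r m))) \<longlonglongrightarrow> norm (inverse z *\<^sub>C l)" by (rule tendsto_norm)
    then have "norm (inverse z *\<^sub>C l) = 1" using u by (simp add: LIMSEQ_const_iff)
    moreover have "(\<lambda>m. B (u (r m))) \<longlonglongrightarrow> B (inverse z *\<^sub>C l)"
      by (rule bounded_linear.tendsto[OF blB lim])
    then have "B (inverse z *\<^sub>C l) = 0" using B0r LIMSEQ_unique by blast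
    then have "inverse z *\<^sub>C l = 0" by (intro inj) (simp add: B_def)
    ultimately show False by simp
  qed
  then show ?thesis using that unfolding B_def by blast
qed

text \<open>If \<open>T - z\<close> were not surjective, its iterated ranges would decrease strictly, and almost
  orthogonal unit vectors chosen in them would contradict compactness.\<close>

lemma compact_perturbation_surjective:
  fixes T :: "'h::complex_hilbert \<Rightarrow> 'h"
  assumes bl: "bounded_linear T" and Tc: "\<And>c x. T (c *\<^sub>C x) = c *\<^sub>C T x"
    and cpt: "\<And>x :: nat \<Rightarrow> 'h. (\<And>m. norm (x m) \<le> 1) \<Longrightarrow> \<exists>l r. strict_mono r \<and> (\<lambda>m. T (x (r m))) \<longlonglongrightarrow> l"
    and z: "z \<noteq> 0" and inj: "\<And>x. T x = z *\<^sub>C x \<Longrightarrow> x = 0"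
  shows "\<exists>x. T x - z *\<^sub>C x = y"
proof (rule ccontr)
  assume nex: "\<not> ?thesis"
  define B where "B x = T x - z *\<^sub>C x" for x
  obtain c where c: "c > 0" "\<And>x. c * norm x \<le> norm (B x)"
    using compact_perturbation_bounded_below[OF bl cpt z inj] unfolding B_def by blast
  have blB: "bounded_linear B"
    unfolding B_def[abs_def] by (intro bounded_linear_sub bl bounded_linear_scaleC)
  have Bc: "B (a *\<^sub>C x) = a *\<^sub>C B x" for a x
    by (simp add: B_def Tc scaleC_diff_right scaleC_scaleC mult.commute)
  have injB: "x = x'" if "B x = B x'" for x x'
    using c(2)[of "x - x'"] c(1) that linear_diff[OF bounded_linear.linear[OF blB], of x x']
    by (simp add: mult_le_0_iff)
  define V where "V k = range (B ^^ k)" for k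
  have blk: "bounded_linear (B ^^ k)" for k
  proof (induction k)
    case 0 then show ?case by (simp add: id_def bounded_linear_ident)
  next
    case (Suc k) then show ?case using bounded_linear_compose[OF blB Suc] by (simp add: o_def)
  qed
  have below: "c ^ k * norm x \<le> norm ((B ^^ k) x)" for k x
  proof (induction k)
    case (Suc k)
    have "c ^ Suc k * norm x \<le> c * norm ((B ^^ k) x)" using Suc c(1) by (simp add: mult.assoc)
    also have "\<dots> \<le> norm (B ((B ^^ k) x))" by (rule c(2))
    finally show ?case by simp
  qed simp
  have sub: "subspace (V k)" for k
    unfolding V_def by (rule linear_subspace_image[OF bounded_linear.linear[OF blk]]) simp
  \<comment> \<open>The powers of \<open>B\<close> are bounded below, which makes their ranges
    complete.\<close>
  have closed: "closed (V k)" for k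
    unfolding V_def
    by (rule complete_imp_closed, rule complete_isometric_image[OF _ _ blk, of "c ^ k"])
      (use c(1) below complete_UNIV in auto)
  have V_scale: "a *\<^sub>C x \<in> V k" if x: "x \<in> V k" for a x k
  proof -
    have "(B ^^ k) (a *\<^sub>C w) = a *\<^sub>C (B ^^ k) w" for w by (induction k) (auto simp: Bc)
    moreover obtain w where "x = (B ^^ k) w" using x unfolding V_def by blast
    ultimately have "a *\<^sub>C x = (B ^^ k) (a *\<^sub>C w)" by simp
    then show ?thesis unfolding V_def by blast
  qed
  have V_Suc: "V (Suc k) \<subseteq> V k" for k unfolding V_def by (auto simp: funpow_Suc_right simp del: funpow.simps)
  have V_mono: "V l \<subseteq> V k" if "k \<le> l" for k l
    using lift_Suc_antimono_le[of V, OF V_Suc that] .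
  have BV: "B x \<in> V (Suc k)" if "x \<in> V k" for x k using that unfolding V_def by auto
  \<comment> \<open>A vector \<open>y\<close> outside the range of \<open>B\<close> shows strict
    decrease at every level, because \<open>B\<close> is injective.\<close>
  have yV: "(B ^^ k) y \<in> V k" "(B ^^ k) y \<notin> V (Suc k)" for k
  proof -
    show "(B ^^ k) y \<in> V k" by (simp add: V_def)
    show "(B ^^ k) y \<notin> V (Suc k)"
    proof
      assume "(B ^^ k) y \<in> V (Suc k)"
      then obtain w where "(B ^^ k) y = (B ^^ k) (B w)"
        unfolding V_def by (auto simp: funpow_Suc_right simp del: funpow.simps)
      moreover have "inj B" by (rule injI) (rule injB)
      then have "inj (B ^^ k)" by (rule inj_fn)
      ultimately have "y = B w" by (simp add: inj_eq)
      then show False using nex by (auto simp: B_def)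
    qed
  qed
  have "\<exists>x. x \<in> V k \<and> norm x = 1 \<and> (\<forall>w\<in>V (Suc k). 1 / 2 \<le> norm (x - w))" for k
    using riesz_lemma[OF sub closed yV(1)[of k] yV(2)[of k] V_Suc sub] by metis
  then obtain x where x: "\<And>k. x k \<in> V k" "\<And>k. norm (x k) = 1"
    "\<And>k w. w \<in> V (Suc k) \<Longrightarrow> 1 / 2 \<le> norm (x k - w)" by metis
  \<comment> \<open>\<open>T (x k) - T (x l)\<close> equals \<open>z *\<^sub>C x k - w\<close> with
    \<open>w \<in> V (Suc k)\<close>, and \<open>x k\<close> has distance at least one half from
    that subspace.\<close>
  have far: "cmod z / 2 \<le> norm (T (x k) - T (x l))" if "k < l" for k l
  proof -
    define w where "w = B (x l) + z *\<^sub>C x l - B (x k)"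
    have "x l \<in> V (Suc k)" "B (x l) \<in> V (Suc k)" "B (x k) \<in> V (Suc k)"
      using x(1)[of l] BV[OF x(1)[of l]] BV[OF x(1)[of k]] V_mono[of "Suc k" l] V_mono[of "Suc k" "Suc l"] that
      by auto
    then have "w \<in> V (Suc k)" unfolding w_def by (intro subspace_diff subspace_add sub V_scale)
    then have "1 / 2 \<le> norm (x k - inverse z *\<^sub>C w)" by (intro x(3) V_scale)
    moreover have "T (x k) - T (x l) = z *\<^sub>C (x k - inverse z *\<^sub>C w)"
      using z by (simp add: w_def B_def scaleC_diff_right scaleC_scaleC)
    ultimately show ?thesis
      using mult_left_mono[of "1 / 2" "norm (x k - inverse z *\<^sub>C w)" "cmod z"] by (simp add: norm_scaleC)
  qed
  obtain l r where r: "strict_mono r" "(\<lambda>m. T (x (r m))) \<longlonglongrightarrow> l" using cpt[of x] x(2) by auto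
  have "Cauchy (\<lambda>m. T (x (r m)))" using r(2) by (simp add: LIMSEQ_imp_Cauchy)
  then obtain N where N: "\<And>m n. m \<ge> N \<Longrightarrow> n \<ge> N \<Longrightarrow> dist (T (x (r m))) (T (x (r n))) < cmod z / 2"
    using z metric_CauchyD[of _ "cmod z / 2"] by fastforce
  have "dist (T (x (r N))) (T (x (r (Suc N)))) < cmod z / 2" by (rule N) auto
  moreover have "cmod z / 2 \<le> dist (T (x (r N))) (T (x (r (Suc N))))"
    unfolding dist_norm by (rule far) (use r(1) in \<open>simp add: strict_mono_less\<close>)
  ultimately show False by simp
qed

section \<open>The Hardy space as a subspace of the Hilbert space\<close>

context fock
begin

lemma H2_iff:
  fixes f :: "'h op ^ 'n \<Rightarrow> 'h op"
  shows "f \<in> H2 \<longleftrightarrow> power_series f (fh_coeff f) \<and> square_summable (fh_coeff f) \<and> (\<forall>X. X \<notin> nc_ball \<longrightarrow> f X = 0)"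
  by (simp add: H2_def free_holomorphic_iff)

lemma H2I:
  fixes f :: "'h op ^ 'n \<Rightarrow> 'h op"
  assumes "power_series f a" "square_summable a" "\<And>X. X \<notin> nc_ball \<Longrightarrow> f X = 0"
  shows "f \<in> H2"
  using assms fh_coeff_eq[OF assms(1)] by (simp add: H2_iff)

lemma H2_power_series: "f \<in> H2 \<Longrightarrow> power_series (f :: 'h op ^ 'n \<Rightarrow> 'h op) (fh_coeff f)"
  and H2_square_summable: "f \<in> H2 \<Longrightarrow> square_summable (fh_coeff (f :: 'h op ^ 'n \<Rightarrow> 'h op))"
  and H2_off_ball: "f \<in> H2 \<Longrightarrow> X \<notin> nc_ball \<Longrightarrow> (f :: 'h op ^ 'n \<Rightarrow> 'h op) X = 0"
  by (auto simp: H2_iff)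

lemma H2_eqI:
  fixes f g :: "'h op ^ 'n \<Rightarrow> 'h op"
  assumes "f \<in> H2" "g \<in> H2" "fh_coeff f = fh_coeff g"
  shows "f = g"
proof
  fix X
  show "f X = g X"
  proof (cases "X \<in> nc_ball")
    case True
    then show ?thesis
      using power_series_sums[OF H2_power_series[OF assms(1)] True]
        power_series_sums[OF H2_power_series[OF assms(2)] True] assms(3) sums_unique2 by metis
  qed (simp add: H2_off_ball assms)
qed

definition H2_of :: "('n list \<Rightarrow> complex) \<Rightarrow> 'h op ^ 'n \<Rightarrow> 'h op" where
  "H2_of a X = (if X \<in> nc_ball then \<Sum>k. hom_part X a k else 0)"

lemma power_series_H2_of: "square_summable a \<Longrightarrow> power_series (H2_of a) a"
  unfolding power_series_def H2_of_def
  using subexponential_hom_part_summable[OF square_summable_imp_subexponential, of a]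
  by (auto intro: summable_sums summable_norm_cancel)

lemma H2_of_in_H2: "square_summable a \<Longrightarrow> H2_of a \<in> H2"
  by (rule H2I[OF power_series_H2_of]) (auto simp: H2_of_def)

lemma fh_coeff_H2_of: "square_summable a \<Longrightarrow> fh_coeff (H2_of a) = a"
  by (rule fh_coeff_eq[OF power_series_H2_of])

lemma H2_add: 
  fixes f g :: "'h op ^ 'n \<Rightarrow> 'h op"
  assumes "f \<in> H2" "g \<in> H2"
  shows "(\<lambda>X. f X + g X) \<in> H2" "fh_coeff (\<lambda>X. f X + g X) = (\<lambda>\<alpha>. fh_coeff f \<alpha> + fh_coeff g \<alpha>)"
proof -
  note ps = power_series_add[OF assms[THEN H2_power_series]]
  show "(\<lambda>X. f X + g X) \<in> H2"
    using assms by (intro H2I[OF ps] square_summable_add H2_square_summable) (auto simp: H2_off_ball)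
  show "fh_coeff (\<lambda>X. f X + g X) = (\<lambda>\<alpha>. fh_coeff f \<alpha> + fh_coeff g \<alpha>)" by (rule fh_coeff_eq[OF ps])
qed

lemma H2_diff: 
  fixes f g :: "'h op ^ 'n \<Rightarrow> 'h op"
  assumes "f \<in> H2" "g \<in> H2"
  shows "(\<lambda>X. f X - g X) \<in> H2" "fh_coeff (\<lambda>X. f X - g X) = (\<lambda>\<alpha>. fh_coeff f \<alpha> - fh_coeff g \<alpha>)"
proof -
  note ps = power_series_diff[OF assms[THEN H2_power_series]]
  show "(\<lambda>X. f X - g X) \<in> H2"
    using assms by (intro H2I[OF ps] square_summable_diff H2_square_summable) (auto simp: H2_off_ball)
  show "fh_coeff (\<lambda>X. f X - g X) = (\<lambda>\<alpha>. fh_coeff f \<alpha> - fh_coeff g \<alpha>)" by (rule fh_coeff_eq[OF ps])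
qed

lemma H2_cmult: 
  fixes f :: "'h op ^ 'n \<Rightarrow> 'h op"
  assumes "f \<in> H2"
  shows "(\<lambda>X. scalar_op c o\<^sub>L f X) \<in> H2" "fh_coeff (\<lambda>X. scalar_op c o\<^sub>L f X) = (\<lambda>\<alpha>. c * fh_coeff f \<alpha>)"
proof -
  note ps = power_series_cmult[OF assms[THEN H2_power_series], of c]
  show "(\<lambda>X. scalar_op c o\<^sub>L f X) \<in> H2"
    using assms by (intro H2I[OF ps] square_summable_cmult H2_square_summable) (auto simp: H2_off_ball)
  show "fh_coeff (\<lambda>X. scalar_op c o\<^sub>L f X) = (\<lambda>\<alpha>. c * fh_coeff f \<alpha>)" by (rule fh_coeff_eq[OF ps])
qed

lemma H2_zero: "(\<lambda>X. 0 :: 'h op) \<in> (H2 :: ('h op ^ 'n \<Rightarrow> 'h op) set)"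
  and fh_coeff_zero: "fh_coeff (\<lambda>X :: 'h op ^ 'n. 0 :: 'h op) = (\<lambda>\<alpha>. 0)"
  by (rule H2I[OF power_series_zero]) (auto intro: fh_coeff_eq power_series_zero)

text \<open>\<open>h2_vec\<close> maps the Hardy space isometrically onto the closed span of
  \<open>e\<close>; \<open>h2_fun\<close> inverts it and annihilates the orthogonal complement.
  Operators on the Hardy space can thus be extended by zero to all of \<open>'h\<close>.\<close>

definition h2_vec :: "('h op ^ 'n \<Rightarrow> 'h op) \<Rightarrow> 'h" where
  "h2_vec f = synth (fh_coeff f)"

definition h2_fun :: "'h \<Rightarrow> 'h op ^ 'n \<Rightarrow> 'h op" where
  "h2_fun x = H2_of (\<lambda>\<alpha>. cinner x (e \<alpha>))"

lemma H2_norm_eq: "f \<in> H2 \<Longrightarrow> H2_norm f = norm (h2_vec f)"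
  by (simp add: H2_norm_def h2_vec_def norm_synth H2_square_summable)

lemma h2_fun_in_H2: "h2_fun x \<in> H2"
  unfolding h2_fun_def by (rule H2_of_in_H2[OF bessel_summable])

lemma fh_coeff_h2_fun: "fh_coeff (h2_fun x) = (\<lambda>\<alpha>. cinner x (e \<alpha>))"
  unfolding h2_fun_def by (rule fh_coeff_H2_of[OF bessel_summable])

lemma norm_h2_vec_h2_fun: "norm (h2_vec (h2_fun x)) \<le> norm x"
  by (simp add: h2_vec_def fh_coeff_h2_fun norm_synth_le)

lemma cinner_h2_vec: "f \<in> H2 \<Longrightarrow> cinner (h2_vec f) (e \<alpha>) = fh_coeff f \<alpha>"
  by (simp add: h2_vec_def cinner_synth H2_square_summable)

lemma h2_fun_h2_vec: "f \<in> H2 \<Longrightarrow> h2_fun (h2_vec f) = f"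
  by (rule H2_eqI[OF h2_fun_in_H2]) (auto simp: fh_coeff_h2_fun cinner_h2_vec)

lemma h2_vec_inj: "f \<in> H2 \<Longrightarrow> g \<in> H2 \<Longrightarrow> h2_vec f = h2_vec g \<Longrightarrow> f = g"
  by (metis h2_fun_h2_vec)

lemma h2_vec_add: "f \<in> H2 \<Longrightarrow> g \<in> H2 \<Longrightarrow> h2_vec (\<lambda>X. f X + g X) = h2_vec f + h2_vec g"
  by (simp add: h2_vec_def H2_add synth_add H2_square_summable)

lemma h2_vec_cmult: "f \<in> H2 \<Longrightarrow> h2_vec (\<lambda>X. scalar_op c o\<^sub>L f X) = c *\<^sub>C h2_vec f"
  by (simp add: h2_vec_def H2_cmult synth_cmult H2_square_summable)

lemma h2_vec_diff: "f \<in> H2 \<Longrightarrow> g \<in> H2 \<Longrightarrow> h2_vec (\<lambda>X. f X - g X) = h2_vec f - h2_vec g"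
  using h2_vec_add[OF H2_diff(1)[of f g], of g] by simp

lemma h2_fun_add: "h2_fun (x + y) = (\<lambda>X. h2_fun x X + h2_fun y X)"
  by (rule H2_eqI[OF h2_fun_in_H2 H2_add(1)])
    (simp_all add: h2_fun_in_H2 H2_add fh_coeff_h2_fun cinner_add_left)

lemma h2_fun_cmult: "h2_fun (c *\<^sub>C x) = (\<lambda>X. scalar_op c o\<^sub>L h2_fun x X)"
  by (rule H2_eqI[OF h2_fun_in_H2 H2_cmult(1)])
    (simp_all add: h2_fun_in_H2 H2_cmult fh_coeff_h2_fun cinner_scaleC_left)

lemma H2_Metric_space: "Metric_space (H2 :: ('h op ^ 'n \<Rightarrow> 'h op) set) (\<lambda>f g. H2_norm (\<lambda>X. f X - g X))"
proof -
  have *: "H2_norm (\<lambda>X. f X - g X) = norm (h2_vec f - h2_vec g)" if "f \<in> H2" "g \<in> H2"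
    for f g :: "'h op ^ 'n \<Rightarrow> 'h op"
    using that by (simp add: H2_norm_eq H2_diff h2_vec_diff)
  have nn: "0 \<le> H2_norm f" for f :: "'h op ^ 'n \<Rightarrow> 'h op"
    by (simp add: H2_norm_def infsum_nonneg)
  \<comment> \<open>\<open>Metric_space\<close> demands symmetry for all functions, also outside
    \<open>H2\<close>. If \<open>f - g\<close> has no power series, neither has
    \<open>g - f\<close>, and then both coefficient families are the same unspecified
    choice.\<close>
  have comm: "H2_norm (\<lambda>X. f X - g X) = H2_norm (\<lambda>X. g X - f X)" for f g :: "'h op ^ 'n \<Rightarrow> 'h op"
  proof -
    have eq: "(\<lambda>X. scalar_op (-1) o\<^sub>L (u X - v X)) = (\<lambda>X. v X - u X)" for u v :: "'h op ^ 'n \<Rightarrow> 'h op"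
      by (rule ext, rule blinfun_eqI) (simp add: scalar_op_apply scaleC_minus_left blinfun.diff_left)
    have neg: "power_series (\<lambda>X. u X - v X) a \<longleftrightarrow> power_series (\<lambda>X. v X - u X) (\<lambda>\<alpha>. - a \<alpha>)"
      for u v :: "'h op ^ 'n \<Rightarrow> 'h op" and a
      using power_series_cmult[of "\<lambda>X. u X - v X" a "-1"] power_series_cmult[of "\<lambda>X. v X - u X" "\<lambda>\<alpha>. - a \<alpha>" "-1"]
      by (auto simp: eq)
    show ?thesis
    proof (cases "\<exists>a. power_series (\<lambda>X. f X - g X) a")
      case True
      then obtain a where "power_series (\<lambda>X. f X - g X) a" by blast
      then show ?thesis using neg[of f g a] by (simp add: H2_norm_def fh_coeff_eq)
    next
      case False
      then have "\<not> (\<exists>a. power_series (\<lambda>X. g X - f X) a)" using neg[of g f] by blast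
      with False have "fh_coeff (\<lambda>X. f X - g X) = fh_coeff (\<lambda>X. g X - f X)"
        unfolding fh_coeff_def free_holomorphic_coeffs_iff_power_series by metis
      then show ?thesis by (simp add: H2_norm_def)
    qed
  qed
  show ?thesis
  proof
    fix f g h :: "'h op ^ 'n \<Rightarrow> 'h op"
    show "0 \<le> H2_norm (\<lambda>X. f X - g X)" by (rule nn)
    show "H2_norm (\<lambda>X. f X - g X) = H2_norm (\<lambda>X. g X - f X)" by (rule comm)
    assume fg: "f \<in> H2" "g \<in> H2"
    show "H2_norm (\<lambda>X. f X - g X) = 0 \<longleftrightarrow> f = g" using h2_vec_inj[OF fg] by (auto simp: * fg)
    assume h: "h \<in> H2"
    show "H2_norm (\<lambda>X. f X - h X) \<le> H2_norm (\<lambda>X. f X - g X) + H2_norm (\<lambda>X. g X - h X)"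
      using norm_triangle_ineq[of "h2_vec f - h2_vec g" "h2_vec g - h2_vec h"] by (simp add: * fg h)
  qed
qed

section \<open>Compact operators on the Hardy space\<close>

lemma H2_compact_subsequence:
  fixes T :: "('h op ^ 'n \<Rightarrow> 'h op) \<Rightarrow> ('h op ^ 'n \<Rightarrow> 'h op)"
  assumes T: "H2_compact_op T" and f: "\<And>m :: nat. f m \<in> H2" "\<And>m. H2_norm (f m) \<le> 1"
  obtains g r where "g \<in> H2" "strict_mono r" "(\<lambda>m. h2_vec (T (f (r m)))) \<longlonglongrightarrow> h2_vec g"
proof -
  let ?d = "\<lambda>f g :: 'h op ^ 'n \<Rightarrow> 'h op. H2_norm (\<lambda>X. f X - g X)"
  interpret M: Metric_space H2 ?d by (rule H2_Metric_space)
  let ?U = "T ` {f \<in> H2. H2_norm f \<le> 1}"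
  have TH2: "T g \<in> H2" if "g \<in> H2" for g using T that by (simp add: H2_compact_op_def H2_bounded_op_def)
  have "?U \<subseteq> H2" using TH2 by auto
  then have "?U \<subseteq> M.mtopology closure_of ?U" by (intro closure_of_subset) simp
  then have "range (\<lambda>m. T (f m)) \<subseteq> M.mtopology closure_of ?U" using f by blast
  moreover have "compactin M.mtopology (M.mtopology closure_of ?U)"
    using T by (simp add: H2_compact_op_def H2_topology_def)
  ultimately obtain g r where gr: "strict_mono (r :: nat \<Rightarrow> nat)"
    "limitin M.mtopology ((\<lambda>m. T (f m)) \<circ> r) g sequentially"
    unfolding M.compactin_sequentially by blast
  then have g: "g \<in> H2" and lim0: "\<forall>\<epsilon>>0. \<exists>N. \<forall>n\<ge>N. T (f (r n)) \<in> H2 \<and> ?d (T (f (r n))) g < \<epsilon>"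
    by (simp_all add: M.limit_metric_sequentially)
  have lim: "\<exists>N. \<forall>n\<ge>N. ?d (T (f (r n))) g < \<epsilon>" if "\<epsilon> > 0" for \<epsilon>
    using lim0 that by meson
  have "?d (T (f (r n))) g = dist (h2_vec (T (f (r n)))) (h2_vec g)" for n
    using TH2[OF f(1)] g by (simp add: H2_norm_eq H2_diff h2_vec_diff dist_norm)
  then have "(\<lambda>m. h2_vec (T (f (r m)))) \<longlonglongrightarrow> h2_vec g"
    using lim by (simp add: lim_sequentially)
  with g gr(1) show ?thesis by (rule that)
qed

text \<open>\<open>T'\<close> extends \<open>T\<close> by zero to all of \<open>'h\<close> and is
  again compact, so for \<open>z \<noteq> 0\<close> the injective operator \<open>T' - z\<close> is
  bounded below and onto. Its inverse restricts to the Hardy space: if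
  \<open>T' x - z *\<^sub>C x\<close> lies in the copy of that space, so does
  \<open>z *\<^sub>C x\<close>, because \<open>T' x\<close> always does.\<close>

lemma not_in_H2_spectrum:
  fixes T :: "('h op ^ 'n \<Rightarrow> 'h op) \<Rightarrow> ('h op ^ 'n \<Rightarrow> 'h op)"
  assumes T: "H2_compact_op T" and z: "z \<noteq> 0"
    and inj: "\<And>f. f \<in> H2 \<Longrightarrow> T f = (\<lambda>X. scalar_op z o\<^sub>L f X) \<Longrightarrow> f = (\<lambda>X. 0)"
  shows "z \<notin> H2_spectrum T"
proof -
  have bop: "H2_bounded_op T" using T by (simp add: H2_compact_op_def)
  then have TH2: "T f \<in> H2" if "f \<in> H2" for f using that by (simp add: H2_bounded_op_def)
  obtain K where K: "\<And>f. f \<in> H2 \<Longrightarrow> H2_norm (T f) \<le> K * H2_norm f" using bop unfolding H2_bounded_op_def by blast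
  define T' where "T' x = h2_vec (T (h2_fun x))" for x
  have add: "T' (x + y) = T' x + T' y" for x y
  proof -
    have "T (h2_fun (x + y)) = (\<lambda>X. T (h2_fun x) X + T (h2_fun y) X)"
      using bop by (simp add: h2_fun_add H2_bounded_op_def h2_fun_in_H2)
    then show ?thesis by (simp add: T'_def h2_vec_add TH2 h2_fun_in_H2)
  qed
  have scale: "T' (c *\<^sub>C x) = c *\<^sub>C T' x" for c x
  proof -
    have "T (h2_fun (c *\<^sub>C x)) = (\<lambda>X. scalar_op c o\<^sub>L T (h2_fun x) X)"
      using bop by (simp add: h2_fun_cmult H2_bounded_op_def h2_fun_in_H2)
    then show ?thesis by (simp add: T'_def h2_vec_cmult TH2 h2_fun_in_H2)
  qed
  have bl: "bounded_linear T'"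
  proof (rule bounded_linear_intro[where K = "\<bar>K\<bar>"])
    show "T' (x + y) = T' x + T' y" for x y by (rule add)
    show "T' (r *\<^sub>R x) = r *\<^sub>R T' x" for r x by (simp add: scaleR_scaleC scale)
    fix x
    have "norm (T' x) \<le> K * norm (h2_vec (h2_fun x))"
      using K[OF h2_fun_in_H2[of x]] by (simp add: T'_def H2_norm_eq TH2 h2_fun_in_H2)
    also have "\<dots> \<le> \<bar>K\<bar> * norm x" by (intro mult_mono norm_h2_vec_h2_fun) auto
    finally show "norm (T' x) \<le> norm x * \<bar>K\<bar>" by (simp add: mult.commute)
  qed
  have cpt: "\<exists>l r. strict_mono r \<and> (\<lambda>m. T' (x (r m))) \<longlonglongrightarrow> l" if "\<And>m. norm (x m) \<le> 1" for x :: "nat \<Rightarrow> 'h"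
  proof -
    have "H2_norm (h2_fun (x m)) \<le> 1" for m
      using norm_h2_vec_h2_fun[of "x m"] that[of m] by (simp add: H2_norm_eq h2_fun_in_H2)
    then obtain g r where "strict_mono r" "(\<lambda>m. h2_vec (T (h2_fun (x (r m))))) \<longlonglongrightarrow> h2_vec g"
      using H2_compact_subsequence[of T "\<lambda>m. h2_fun (x m)", OF T h2_fun_in_H2] by metis
    then show ?thesis unfolding T'_def by (intro exI conjI)
  qed
  have range: "x = h2_vec (h2_fun x)" if "T' x - z *\<^sub>C x = h2_vec g" "g \<in> H2" for x g
  proof -
    have "z *\<^sub>C x = h2_vec (T (h2_fun x)) - h2_vec g" using that by (simp add: T'_def algebra_simps)
    also have "\<dots> = h2_vec (\<lambda>X. T (h2_fun x) X - g X)" using that TH2 h2_fun_in_H2 by (simp add: h2_vec_diff)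
    finally have "inverse z *\<^sub>C z *\<^sub>C x = inverse z *\<^sub>C h2_vec (\<lambda>X. T (h2_fun x) X - g X)" by simp
    then have "x = h2_vec (\<lambda>X. scalar_op (inverse z) o\<^sub>L (T (h2_fun x) X - g X))"
      using z that TH2 h2_fun_in_H2 by (simp add: scaleC_scaleC h2_vec_cmult H2_diff)
    moreover have "(\<lambda>X. scalar_op (inverse z) o\<^sub>L (T (h2_fun x) X - g X)) \<in> H2"
      using that TH2 h2_fun_in_H2 by (intro H2_cmult H2_diff) auto
    ultimately show ?thesis by (metis h2_fun_h2_vec)
  qed
  have resolvent_vec: "h2_vec (\<lambda>X. T f X - (scalar_op z o\<^sub>L f X)) = T' (h2_vec f) - z *\<^sub>C h2_vec f"
    if "f \<in> H2" for f
    using that by (simp add: T'_def h2_fun_h2_vec h2_vec_diff TH2 H2_cmult h2_vec_cmult)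
  have resolvent_H2: "(\<lambda>X. T f X - (scalar_op z o\<^sub>L f X)) \<in> H2" if "f \<in> H2" for f
    using that by (intro H2_diff H2_cmult TH2)
  have inj': "x = 0" if "T' x = z *\<^sub>C x" for x
  proof -
    have vec0: "h2_vec (\<lambda>X. 0) = 0" using h2_vec_diff[OF H2_zero H2_zero] by simp
    have x: "x = h2_vec (h2_fun x)" by (rule range[OF _ H2_zero]) (simp add: vec0 that)
    have "T (h2_fun x) = (\<lambda>X. scalar_op z o\<^sub>L h2_fun x X)"
    proof (rule h2_vec_inj[OF TH2[OF h2_fun_in_H2] H2_cmult(1)[OF h2_fun_in_H2]])
      show "h2_vec (T (h2_fun x)) = h2_vec (\<lambda>X. scalar_op z o\<^sub>L h2_fun x X)"
        using that x by (simp add: T'_def h2_vec_cmult h2_fun_in_H2)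
    qed
    from inj[OF h2_fun_in_H2 this] show ?thesis using x vec0 by simp
  qed
  obtain c where c: "c > 0" "\<And>x. c * norm x \<le> norm (T' x - z *\<^sub>C x)"
    using compact_perturbation_bounded_below[OF bl cpt z inj'] by blast
  have surj: "\<exists>x. T' x - z *\<^sub>C x = y" for y
    by (rule compact_perturbation_surjective[OF bl scale cpt z inj'])
  have uniq: "x = y" if "T' x - z *\<^sub>C x = T' y - z *\<^sub>C y" for x y
  proof -
    have "T' (x - y) = z *\<^sub>C (x - y)"
      using that by (simp add: linear_diff[OF bounded_linear.linear[OF bl]] scaleC_diff_right algebra_simps)
    then show ?thesis using inj'[of "x - y"] by simp
  qed
  define B' where "B' y = (SOME x. T' x - z *\<^sub>C x = y)" for y
  have B': "T' (B' y) - z *\<^sub>C B' y = y" for y unfolding B'_def by (rule someI_ex[OF surj])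
  have B'_eq: "B' (T' x - z *\<^sub>C x) = x" for x by (rule uniq) (rule B')
  define S where "S f = h2_fun (B' (h2_vec f))" for f
  have vec_S: "h2_vec (S g) = B' (h2_vec g)" if "g \<in> H2" for g
    unfolding S_def using range[OF B' that] by simp
  have "H2_bounded_op S"
    unfolding H2_bounded_op_def
  proof (intro conjI ballI allI)
    fix f g :: "'h op ^ 'n \<Rightarrow> 'h op" assume fg: "f \<in> H2" "g \<in> H2"
    have "B' (h2_vec f + h2_vec g) = B' (h2_vec f) + B' (h2_vec g)"
    proof (rule uniq)
      have "T' (B' (h2_vec f) + B' (h2_vec g)) - z *\<^sub>C (B' (h2_vec f) + B' (h2_vec g)) =
          (T' (B' (h2_vec f)) - z *\<^sub>C B' (h2_vec f)) + (T' (B' (h2_vec g)) - z *\<^sub>C B' (h2_vec g))"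
        by (simp add: add scaleC_add_right)
      then show "T' (B' (h2_vec f + h2_vec g)) - z *\<^sub>C B' (h2_vec f + h2_vec g) =
          T' (B' (h2_vec f) + B' (h2_vec g)) - z *\<^sub>C (B' (h2_vec f) + B' (h2_vec g))"
        by (simp only: B')
    qed
    then show "S (\<lambda>X. f X + g X) = (\<lambda>X. S f X + S g X)"
      by (simp add: S_def h2_vec_add fg h2_fun_add)
  next
    fix f :: "'h op ^ 'n \<Rightarrow> 'h op" and c assume f: "f \<in> H2"
    have "T' (c *\<^sub>C B' (h2_vec f)) - z *\<^sub>C c *\<^sub>C B' (h2_vec f) = c *\<^sub>C h2_vec f"
      by (subst (3) B'[symmetric]) (simp add: scale scaleC_diff_right scaleC_scaleC mult.commute)
    then have "B' (c *\<^sub>C h2_vec f) = c *\<^sub>C B' (h2_vec f)" using B'_eq by metis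
    then show "S (\<lambda>X. scalar_op c o\<^sub>L f X) = (\<lambda>X. scalar_op c o\<^sub>L S f X)"
      by (simp add: S_def h2_vec_cmult f h2_fun_cmult)
  next
    show "\<exists>K. \<forall>f\<in>H2. H2_norm (S f) \<le> K * H2_norm f"
    proof (intro exI[of _ "1 / c"] ballI)
      fix f :: "'h op ^ 'n \<Rightarrow> 'h op" assume f: "f \<in> H2"
      have "c * norm (B' (h2_vec f)) \<le> norm (h2_vec f)" using c(2)[of "B' (h2_vec f)"] by (simp add: B')
      then show "H2_norm (S f) \<le> 1 / c * H2_norm f"
        using c(1) f by (simp add: H2_norm_eq S_def h2_fun_in_H2 vec_S[unfolded S_def] field_simps)
    qed
  qed (simp add: S_def h2_fun_in_H2)
  moreover have "S (\<lambda>X. T f X - (scalar_op z o\<^sub>L f X)) = f" if "f \<in> H2" for f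
    using that by (simp add: S_def resolvent_vec B'_eq h2_fun_h2_vec)
  moreover have "(\<lambda>X. T (S f) X - (scalar_op z o\<^sub>L S f X)) = f" if "f \<in> H2" for f
  proof (rule h2_vec_inj[OF resolvent_H2 that])
    show SH2: "S f \<in> H2" by (simp add: S_def h2_fun_in_H2)
    show "h2_vec (\<lambda>X. T (S f) X - (scalar_op z o\<^sub>L S f X)) = h2_vec f"
      using that by (simp add: resolvent_vec SH2 vec_S B')
  qed
  ultimately show ?thesis unfolding H2_spectrum_def by blast
qed

text \<open>A bounded left inverse of \<open>T\<close> would force two distinct members of an
  orthonormal sequence to be closer than 1, since compactness makes a subsequence of their images
  Cauchy.\<close>

lemma zero_in_H2_spectrum:
  fixes T :: "('h op ^ 'n \<Rightarrow> 'h op) \<Rightarrow> ('h op ^ 'n \<Rightarrow> 'h op)"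
  assumes T: "H2_compact_op T"
  shows "0 \<in> H2_spectrum T"
proof (rule ccontr)
  assume "0 \<notin> H2_spectrum T"
  then obtain S where S: "H2_bounded_op S" "\<And>f. f \<in> H2 \<Longrightarrow> S (\<lambda>X. T f X - (scalar_op 0 o\<^sub>L f X)) = f"
    unfolding H2_spectrum_def by blast
  have ST: "S (T f) = f" if "f \<in> H2" for f using S(2)[OF that] by simp
  have TH2: "T f \<in> H2" if "f \<in> H2" for f using T that by (simp add: H2_compact_op_def H2_bounded_op_def)
  obtain K where K: "\<And>f. f \<in> H2 \<Longrightarrow> H2_norm (S f) \<le> K * H2_norm f" using S(1) unfolding H2_bounded_op_def by blast
  obtain i :: 'n where True by blast
  \<comment> \<open>Powers of a single letter give infinitely many distinct words even when there is
    only one generator.\<close>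
  define f where "f m = h2_fun (e (replicate m i))" for m
  have f: "f m \<in> H2" for m by (simp add: f_def h2_fun_in_H2)
  have vec_f: "h2_vec (f m) = e (replicate m i)" for m
  proof -
    have "(\<lambda>\<alpha>. cinner (e (replicate m i)) (e \<alpha>)) = (\<lambda>\<alpha>. if \<alpha> = replicate m i then 1 else 0)"
      by (auto simp: orth)
    then show ?thesis by (simp add: h2_vec_def f_def fh_coeff_h2_fun synth_delta)
  qed
  have "H2_norm (f m) \<le> 1" for m by (simp add: H2_norm_eq f vec_f)
  then obtain g r where r: "strict_mono r" "(\<lambda>m. h2_vec (T (f (r m)))) \<longlonglongrightarrow> h2_vec g"
    using H2_compact_subsequence[of T f, OF T f] by metis
  \<comment> \<open>Ensures \<open>\<bar>K\<bar> * \<delta> < 1\<close>, also when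
    \<open>K = 0\<close>.\<close>
  define \<delta> where "\<delta> = 1 / (\<bar>K\<bar> + 1)"
  have "Cauchy (\<lambda>m. h2_vec (T (f (r m))))" using r(2) by (rule LIMSEQ_imp_Cauchy)
  then obtain N where N: "\<And>m n. m \<ge> N \<Longrightarrow> n \<ge> N \<Longrightarrow> dist (h2_vec (T (f (r m)))) (h2_vec (T (f (r n)))) < \<delta>"
    using metric_CauchyD[of _ \<delta>] by (force simp: \<delta>_def)
  let ?f = "f (r N)" and ?g = "f (r (Suc N))"
  have sub: "S (\<lambda>X. T ?f X + (scalar_op (-1) o\<^sub>L T ?g X)) = (\<lambda>X. ?f X + (scalar_op (-1) o\<^sub>L ?g X))"
    using S(1) by (simp add: H2_bounded_op_def TH2 f H2_cmult ST)
  have "H2_norm (\<lambda>X. ?f X + (scalar_op (-1) o\<^sub>L ?g X)) \<le> K * H2_norm (\<lambda>X. T ?f X + (scalar_op (-1) o\<^sub>L T ?g X))"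
    unfolding sub[symmetric] by (intro K H2_add H2_cmult TH2 f)
  then have "norm (h2_vec ?f + (-1) *\<^sub>C h2_vec ?g) \<le> K * norm (h2_vec (T ?f) + (-1) *\<^sub>C h2_vec (T ?g))"
    by (simp add: H2_norm_eq H2_add H2_cmult f TH2 h2_vec_add h2_vec_cmult)
  also have "\<dots> \<le> \<bar>K\<bar> * dist (h2_vec (T ?f)) (h2_vec (T ?g))"
    by (simp add: scaleC_minus_left dist_norm mult_right_mono)
  also have "\<dots> \<le> \<bar>K\<bar> * \<delta>" by (rule mult_left_mono[OF less_imp_le[OF N]]) auto
  also have "\<dots> < 1"
  proof -
    have "0 < \<bar>K\<bar> + 1" by simp
    then show ?thesis unfolding \<delta>_def times_divide_eq_right by (subst divide_less_eq_1_pos) auto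
  qed
  finally have "norm (e (replicate (r N) i) - e (replicate (r (Suc N)) i)) < 1"
    by (simp add: vec_f scaleC_minus_left)
  moreover have "1 \<le> norm (e (replicate (r N) i) - e (replicate (r (Suc N)) i))"
  proof -
    have "r N \<noteq> r (Suc N)" using r(1) by (metis n_not_Suc_n strict_mono_eq)
    then have "replicate (r N) i \<noteq> replicate (r (Suc N)) i" by (metis length_replicate)
    then have "cinner (e (replicate (r N) i) - e (replicate (r (Suc N)) i)) (e (replicate (r N) i)) = 1"
      by (simp add: cinner_diff_left orth)
    then show ?thesis using cinner_norm_le[of "e (replicate (r N) i) - e (replicate (r (Suc N)) i)" "e (replicate (r N) i)"]
      by simp
  qed
  ultimately show False by simp
qed

end

section \<open>Scalar points and kernel functions\<close>

definition word_val :: "complex ^ 'n::finite \<Rightarrow> 'n list \<Rightarrow> complex" where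
  "word_val \<zeta> \<alpha> = prod_list (map (\<lambda>i. \<zeta> $ i) \<alpha>)"

lemma word_val_simps [simp]: "word_val \<zeta> [] = 1" "word_val \<zeta> (i # \<alpha>) = \<zeta> $ i * word_val \<zeta> \<alpha>"
  by (simp_all add: word_val_def)

lemma level_word_val: "(\<Sum>\<alpha> | length \<alpha> = k. (cmod (word_val \<zeta> \<alpha>))\<^sup>2) = (norm \<zeta>) ^ (2 * k)"
proof (induction k)
  case (Suc k)
  have "(\<Sum>\<alpha> | length \<alpha> = Suc k. (cmod (word_val \<zeta> \<alpha>))\<^sup>2) =
      (\<Sum>i\<in>UNIV. (cmod (\<zeta> $ i))\<^sup>2 * (\<Sum>\<alpha> | length \<alpha> = k. (cmod (word_val \<zeta> \<alpha>))\<^sup>2))"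
    by (simp add: sum_words_Suc norm_mult power_mult_distrib sum_distrib_left)
  also have "\<dots> = (norm \<zeta>)\<^sup>2 * norm \<zeta> ^ (2 * k)"
    by (simp add: Suc norm_vec_power2 sum_distrib_right)
  finally show ?case by (simp add: power_add[symmetric])
qed simp

lemma word_val_has_sum:
  assumes "norm \<zeta> < 1"
  shows "((\<lambda>\<alpha>. (cmod (word_val \<zeta> \<alpha>))\<^sup>2) has_sum 1 / (1 - (norm \<zeta>)\<^sup>2)) UNIV"
proof -
  have "(norm \<zeta>)\<^sup>2 < 1" using assms by (simp add: power_less_one_iff abs_square_less_1)
  then have geo: "(\<lambda>k. ((norm \<zeta>)\<^sup>2) ^ k) sums (1 / (1 - (norm \<zeta>)\<^sup>2))" by (intro geometric_sums) simp
  have "(\<Sum>\<alpha>\<in>F. (cmod (word_val \<zeta> \<alpha>))\<^sup>2) \<le> 1 / (1 - (norm \<zeta>)\<^sup>2)" if F: "finite F" for F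
  proof -
    obtain N where N: "\<And>\<alpha>. \<alpha> \<in> F \<Longrightarrow> length \<alpha> < N"
      using finite_nat_set_iff_bounded[of "length ` F"] F by auto
    have "(\<Sum>\<alpha>\<in>F. (cmod (word_val \<zeta> \<alpha>))\<^sup>2) \<le> (\<Sum>\<alpha> | length \<alpha> < N. (cmod (word_val \<zeta> \<alpha>))\<^sup>2)"
      by (rule sum_mono2) (use N in auto)
    also have "\<dots> = (\<Sum>k<N. ((norm \<zeta>)\<^sup>2) ^ k)"
      by (simp add: sum_words_less level_word_val power_mult)
    also have "\<dots> \<le> 1 / (1 - (norm \<zeta>)\<^sup>2)"
      using sum_le_suminf[OF sums_summable[OF geo], of "{..<N}"] sums_unique[OF geo] by simp
    finally show ?thesis .
  qed
  then have "square_summable (word_val \<zeta>)"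
    by (intro nonneg_bdd_above_summable_on bdd_aboveI2[where M = "1 / (1 - (norm \<zeta>)\<^sup>2)"]) auto
  then have *: "((\<lambda>\<alpha>. (cmod (word_val \<zeta> \<alpha>))\<^sup>2) has_sum (\<Sum>\<^sub>\<infinity>\<alpha>. (cmod (word_val \<zeta> \<alpha>))\<^sup>2)) UNIV"
    by (rule has_sum_infsum)
  then have "(\<lambda>k. ((norm \<zeta>)\<^sup>2) ^ k) sums (\<Sum>\<^sub>\<infinity>\<alpha>. (cmod (word_val \<zeta> \<alpha>))\<^sup>2)"
    using has_sum_words_imp_sums[OF *] by (simp add: level_word_val power_mult)
  with geo * show ?thesis using sums_unique2 by metis
qed

lemma word_val_square_summable: "norm \<zeta> < 1 \<Longrightarrow> square_summable (word_val \<zeta>)"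
  using word_val_has_sum by (auto simp: summable_on_def)

lemma cnj_word_val_square_summable: "norm \<zeta> < 1 \<Longrightarrow> square_summable (\<lambda>\<alpha>. cnj (word_val \<zeta> \<alpha>))"
  using word_val_square_summable by simp

lemma scaleC_scaleR_commute: "c *\<^sub>C (r *\<^sub>R x) = r *\<^sub>R (c *\<^sub>C (x :: 'a::complex_hilbert))"
  by (simp add: scaleR_scaleC scaleC_scaleC mult.commute)

lemma scalar_tuple_nth [simp]: "scalar_tuple \<zeta> $ i = scalar_op (\<zeta> $ i)"
  by (simp add: scalar_tuple_def)

lemma scalar_tuple_0 [simp]: "scalar_tuple 0 = 0"
  by (simp add: vec_eq_iff)

lemma word_op_scalar_tuple: "word_op (scalar_tuple \<zeta>) \<alpha> = scalar_op (word_val \<zeta> \<alpha>)"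
  by (induction \<alpha>) (simp_all add: scalar_op_mult)

lemma hom_part_scalar_tuple:
  "hom_part (scalar_tuple \<zeta>) a k = scalar_op (\<Sum>\<alpha> | length \<alpha> = k. a \<alpha> * word_val \<zeta> \<alpha>)"
  by (simp add: hom_part_def word_op_scalar_tuple scalar_op_mult[symmetric] scalar_op_sum)

lemma sum_mult_le_norm:
  fixes \<xi> :: "complex ^ 'n::finite" and x :: "'h::complex_hilbert ^ 'n"
  shows "norm (\<Sum>i\<in>UNIV. (\<xi> $ i) *\<^sub>C (x $ i)) \<le> norm \<xi> * norm x"
proof -
  have "norm (\<Sum>i\<in>UNIV. (\<xi> $ i) *\<^sub>C (x $ i)) \<le> (\<Sum>i\<in>UNIV. cmod (\<xi> $ i) * norm (x $ i))"
    by (intro sum_norm_le) (simp add: norm_scaleC)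
  also have "\<dots> \<le> norm \<xi> * norm x"
    using L2_set_mult_ineq[of "\<lambda>i. cmod (\<xi> $ i)" "\<lambda>i. norm (x $ i)" UNIV] by (simp add: norm_vec_def)
  finally show ?thesis .
qed

lemma norm_rowop_scalar_tuple_le: "norm (rowop (scalar_tuple \<zeta>)) \<le> norm \<zeta>"
  by (rule norm_blinfun_bound) (simp_all add: rowop_apply scalar_op_apply sum_mult_le_norm)

lemma scalar_tuple_in_nc_ball: "norm \<zeta> < 1 \<Longrightarrow> scalar_tuple \<zeta> \<in> nc_ball"
  using norm_rowop_scalar_tuple_le[of \<zeta>] by (auto simp: nc_ball_iff intro: order_le_less_trans)

lemma cnj_mult_self: "cnj z * z = complex_of_real ((cmod z)\<^sup>2)"
  by (simp add: complex_norm_square mult.commute del: of_real_power)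

lemma sum_cnj_mult_self: "(\<Sum>i\<in>UNIV. cnj (\<zeta> $ i) * \<zeta> $ i) = complex_of_real ((norm (\<zeta> :: complex ^ 'n::finite))\<^sup>2)"
  by (simp add: norm_vec_power2 cnj_mult_self del: of_real_power)

lemma norm_scaleC_vec: "norm (\<chi> i. (\<zeta> $ i) *\<^sub>C v) = norm (\<zeta> :: complex ^ 'n::finite) * norm (v :: 'h::complex_hilbert)"
proof -
  have "(norm (\<chi> i. (\<zeta> $ i) *\<^sub>C v))\<^sup>2 = (norm \<zeta> * norm v)\<^sup>2"
    by (simp add: norm_vec_power2 norm_scaleC power_mult_distrib sum_distrib_right)
  then show ?thesis by (simp add: power2_eq_iff_nonneg)
qed

text \<open>On the column with entries \<open>cnj (\<zeta> $ i) *\<^sub>C v\<close> the row of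
  scalars stretches by exactly \<open>norm \<zeta>\<close>.\<close>

lemma scalar_tuple_in_nc_ballD:
  assumes "(scalar_tuple \<zeta> :: 'h::complex_hilbert op ^ 'n::finite) \<in> nc_ball" and v: "(v :: 'h) \<noteq> 0"
  shows "norm \<zeta> < 1"
proof (cases "\<zeta> = 0")
  case False
  define x where "x = (\<chi> i. cnj (\<zeta> $ i) *\<^sub>C v)"
  have "x = (\<chi> i. ((\<chi> i. cnj (\<zeta> $ i)) $ i) *\<^sub>C v)" by (simp add: x_def)
  moreover have "norm (\<chi> i. cnj (\<zeta> $ i)) = norm \<zeta>" by (simp add: norm_vec_def)
  ultimately have x: "norm x = norm \<zeta> * norm v" by (simp only: norm_scaleC_vec)
  have "rowop (scalar_tuple \<zeta>) x = (\<Sum>i\<in>UNIV. cnj (\<zeta> $ i) * \<zeta> $ i) *\<^sub>C v"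
    by (simp add: rowop_apply scalar_op_apply x_def scaleC_scaleC scaleC_sum_left mult.commute)
  then have "norm (rowop (scalar_tuple \<zeta>) x) = (norm \<zeta>)\<^sup>2 * norm v"
    by (simp add: sum_cnj_mult_self norm_scaleC del: of_real_power)
  moreover have "norm (rowop (scalar_tuple \<zeta>) x) \<le> norm (rowop (scalar_tuple \<zeta> :: 'h op ^ 'n)) * norm x"
    by (rule norm_blinfun)
  ultimately have "norm \<zeta> * (norm \<zeta> * norm v) \<le> norm (rowop (scalar_tuple \<zeta> :: 'h op ^ 'n)) * (norm \<zeta> * norm v)"
    by (simp add: x power2_eq_square mult.assoc)
  then have "norm \<zeta> \<le> norm (rowop (scalar_tuple \<zeta> :: 'h op ^ 'n))"
    by (rule mult_right_le_imp_le) (use False v in simp)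
  then show ?thesis using nc_ball_norm[OF assms(1)] by simp
qed simp

lemma scalar_op_inj: "(v :: 'h::complex_hilbert) \<noteq> 0 \<Longrightarrow> scalar_op a = (scalar_op b :: 'h op) \<Longrightarrow> a = b"
  using scalar_op_apply[of a v] scalar_op_apply[of b v] scaleC_diff_left[of a b v] by simp

lemma scalar_tuple_inj:
  "(v :: 'h::complex_hilbert) \<noteq> 0 \<Longrightarrow> scalar_tuple \<zeta> = (scalar_tuple \<mu> :: 'h op ^ 'n::finite) \<Longrightarrow> \<zeta> = \<mu>"
  unfolding vec_eq_iff scalar_tuple_nth using scalar_op_inj by blast

section \<open>The involutive automorphisms of the ball\<close>

locale ball_point =
  fixes \<xi> :: "complex ^ 'n::finite"
  assumes norm_less_1: "norm \<xi> < 1"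
begin

definition s :: real where "s = sqrt (1 - (norm \<xi>)\<^sup>2)"

text \<open>The matrix \<open>M\<close> acts as \<open>s\<^sup>2\<close> on the line spanned by the
  conjugate of \<open>\<xi>\<close> and as the identity on its complement. Its positive root
  therefore subtracts the rank one part with the factor
  \<open>(1 - s) / (norm \<xi>)\<^sup>2\<close>. As
  \<open>(norm \<xi>)\<^sup>2 = 1 - s\<^sup>2\<close>, the factor is \<open>1 / (1 + s)\<close>, a
  form that also covers \<open>\<xi> = 0\<close>.\<close>

definition c :: real where "c = 1 / (1 + s)"

lemma s_pos: "0 < s" and s_le_1: "s \<le> 1" and s_square: "s\<^sup>2 = 1 - (norm \<xi>)\<^sup>2"
  using norm_less_1 by (simp_all add: s_def power_le_one abs_square_less_1)

lemma c_s: "c * (1 + s) = 1" and c_norm: "c * (norm \<xi>)\<^sup>2 = 1 - s"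
proof -
  show c: "c * (1 + s) = 1" using s_pos by (simp add: c_def)
  have "(norm \<xi>)\<^sup>2 = (1 + s) * (1 - s)" using s_square by (simp add: power2_eq_square algebra_simps)
  then have "c * (norm \<xi>)\<^sup>2 = (c * (1 + s)) * (1 - s)" by (simp only: mult.assoc)
  then show "c * (norm \<xi>)\<^sup>2 = 1 - s" using c by simp
qed

lemma c_pos: "0 < c" using s_pos by (simp add: c_def)

definition D :: "complex ^ 'n ^ 'n" where
  "D = (\<chi> i j. (if i = j then 1 else 0) - of_real c * cnj (\<xi> $ i) * \<xi> $ j)"

definition M :: "complex ^ 'n ^ 'n" where
  "M = mat 1 - (\<chi> i j. cnj (\<xi> $ i) * \<xi> $ j)"

definition pairing :: "complex ^ 'n \<Rightarrow> complex" where
  "pairing v = (\<Sum>j\<in>UNIV. \<xi> $ j * v $ j)"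

lemma D_apply: "(D *v v) $ i = v $ i - of_real c * cnj (\<xi> $ i) * pairing v"
  by (simp add: D_def matrix_vector_mult_def pairing_def left_diff_distrib sum_subtractf
      if_distrib[of "\<lambda>x. x * _"] sum_distrib_left mult.assoc cong: if_cong)

lemma M_apply: "(M *v v) $ i = v $ i - cnj (\<xi> $ i) * pairing v"
  by (simp add: M_def matrix_vector_mult_def pairing_def mat_def left_diff_distrib sum_subtractf
      if_distrib[of "\<lambda>x. x * _"] sum_distrib_left mult.assoc cong: if_cong)

lemma D_square: "D ** D = M"
proof -
  have "D *v (D *v v) = M *v v" for v
  proof -
    have p: "pairing (D *v v) = pairing v - of_real (c * (norm \<xi>)\<^sup>2) * pairing v"
      unfolding pairing_def[of "D *v v"] D_apply
      by (simp add: right_diff_distrib sum_subtractf pairing_def[symmetric] sum_cnj_mult_self[symmetric]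
          sum_distrib_left sum_distrib_right mult_ac del: of_real_power)
    have "c * (1 + s) * cnj (\<xi> $ i) * pairing v = cnj (\<xi> $ i) * pairing v" for i
      using c_s by simp
    then show ?thesis
      by (simp add: vec_eq_iff D_apply M_apply p c_norm algebra_simps)
  qed
  then show ?thesis by (simp add: matrix_eq matrix_vector_mul_assoc[symmetric])
qed

lemma pairing_cnj: "(\<Sum>i\<in>UNIV. cnj (v $ i) * cnj (\<xi> $ i)) = cnj (pairing v)"
  by (simp add: pairing_def mult.commute)

lemma D_form: "(\<Sum>i\<in>UNIV. cnj (v $ i) * (D *v v) $ i) = of_real ((norm v)\<^sup>2 - c * (cmod (pairing v))\<^sup>2)"
proof -
  have "(\<Sum>i\<in>UNIV. cnj (v $ i) * (D *v v) $ i) =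
      (\<Sum>i\<in>UNIV. cnj (v $ i) * v $ i) - of_real c * ((\<Sum>i\<in>UNIV. cnj (v $ i) * cnj (\<xi> $ i)) * pairing v)"
    by (simp add: D_apply right_diff_distrib sum_subtractf sum_distrib_left sum_distrib_right mult_ac)
  then show ?thesis
    by (simp only: sum_cnj_mult_self pairing_cnj, simp only: cnj_mult_self, simp del: of_real_power)
qed

lemma D_form_lower: "s * (norm v)\<^sup>2 \<le> (norm v)\<^sup>2 - c * (cmod (pairing v))\<^sup>2"
proof -
  have "cmod (pairing v) \<le> (\<Sum>j\<in>UNIV. cmod (\<xi> $ j) * cmod (v $ j))"
    unfolding pairing_def by (intro sum_norm_le) (simp add: norm_mult)
  also have "\<dots> \<le> norm \<xi> * norm v"
    using L2_set_mult_ineq[of "\<lambda>i. cmod (\<xi> $ i)" "\<lambda>i. cmod (v $ i)" UNIV] by (simp add: norm_vec_def)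
  finally have "(cmod (pairing v))\<^sup>2 \<le> (norm \<xi> * norm v)\<^sup>2" by (intro power_mono) auto
  then have "c * (cmod (pairing v))\<^sup>2 \<le> c * (norm \<xi>)\<^sup>2 * (norm v)\<^sup>2"
    using c_pos by (simp add: power_mult_distrib mult.assoc)
  then show ?thesis unfolding c_norm by (simp add: algebra_simps)
qed

text \<open>\<open>D\<close> is a polynomial in \<open>M\<close>, so it commutes with every square root \<open>B\<close> of \<open>M\<close>; then
  \<open>(B + D) w = 0\<close> for \<open>w = (B - D) v\<close>, and \<open>D\<close> is positive definite.\<close>

lemma defect_matrix_eq: "defect_matrix \<xi> = D"
  unfolding defect_matrix_def psd_sqrt_def M_def[symmetric]
proof (rule the_equality)
  have "0 \<le> (norm v)\<^sup>2 - c * (cmod (pairing v))\<^sup>2" for v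
    using D_form_lower[of v] s_pos by (meson order_trans mult_nonneg_nonneg less_imp_le zero_le_power2)
  then show "psd_matrix D \<and> D ** D = M" by (simp add: psd_matrix_def D_form D_square del: of_real_diff)
next
  fix B assume B: "psd_matrix B \<and> B ** B = M"
  have DM: "D *v v = of_real (1 - c) *s v + of_real c *s (M *v v)" for v
    by (simp add: vec_eq_iff D_apply M_apply algebra_simps)
  have BB: "B *v (B *v v) = M *v v" for v using B by (simp add: matrix_vector_mul_assoc)
  have comm: "B *v (D *v v) = D *v (B *v v)" for v
    by (simp add: DM matrix_vector_right_distrib matrix_vector_mult_diff_distrib vector_scalar_commute BB[symmetric])
  have DD: "D *v (D *v v) = M *v v" for v by (simp add: matrix_vector_mul_assoc D_square)
  have "B *v v = D *v v" for v
  proof -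
    define w where "w = B *v v - D *v v"
    have "B *v w + D *v w = 0"
      by (simp add: w_def matrix_vector_mult_diff_distrib BB DD comm)
    then have "(\<Sum>i\<in>UNIV. cnj (w $ i) * ((B *v w) $ i + (D *v w) $ i)) = 0"
      by (simp add: vec_eq_iff)
    then have "(\<Sum>i\<in>UNIV. cnj (w $ i) * (B *v w) $ i) + (\<Sum>i\<in>UNIV. cnj (w $ i) * (D *v w) $ i) = 0"
      by (simp add: distrib_left sum.distrib)
    moreover have "0 \<le> Re (\<Sum>i\<in>UNIV. cnj (w $ i) * (B *v w) $ i)"
      using B unfolding psd_matrix_def complex_nonneg_Reals_iff by blast
    ultimately have "Re (\<Sum>i\<in>UNIV. cnj (w $ i) * (D *v w) $ i) \<le> 0"
      by (simp only: complex_eq_iff plus_complex.sel zero_complex.sel) linarith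
    then have "s * (norm w)\<^sup>2 \<le> 0" using D_form_lower[of w] by (simp add: D_form del: of_real_diff)
    then have "w = 0" using s_pos by (simp add: mult_le_0_iff power2_less_0)
    then show ?thesis by (simp add: w_def)
  qed
  then show "B = D" by (simp add: matrix_eq)
qed

section \<open>The resolvent as a Neumann series\<close>

definition lin :: "'h::complex_hilbert op ^ 'n \<Rightarrow> 'h op" where
  "lin X = (\<Sum>i\<in>UNIV. scalar_op (cnj (\<xi> $ i)) o\<^sub>L X $ i)"

text \<open>Coefficients of the geometric series in \<open>lin X\<close>; as an element of the Hardy
  space this is the reproducing kernel at \<open>\<xi>\<close>.\<close>

definition kernel :: "'n list \<Rightarrow> complex" where
  "kernel \<alpha> = cnj (word_val \<xi> \<alpha>)"

definition res :: "'h::complex_hilbert op ^ 'n \<Rightarrow> 'h op" where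
  "res X = op_inv (id_blinfun - lin X)"

lemma lin_apply: "lin X x = (\<Sum>i\<in>UNIV. cnj (\<xi> $ i) *\<^sub>C (X $ i) x)"
  by (simp add: lin_def blinfun.sum_left scalar_op_apply)

lemma lin_BH: "X \<in> nc_ball \<Longrightarrow> lin X \<in> BH"
  unfolding lin_def by (intro BH_sum BH_compose BH_scalar_op nc_ball_BH)

lemma kernel_square_summable: "square_summable kernel"
  unfolding kernel_def using cnj_word_val_square_summable[OF norm_less_1] .

lemma hom_part_kernel_Suc:
  assumes "X \<in> nc_ball"
  shows "hom_part X kernel (Suc k) = lin X o\<^sub>L hom_part X kernel k"
proof (rule blinfun_eqI)
  fix x
  have "(X $ i) (a *\<^sub>C y) = a *\<^sub>C (X $ i) y" for i a y by (rule BH_apply[OF nc_ball_BH[OF assms]])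
  then show "hom_part X kernel (Suc k) x = (lin X o\<^sub>L hom_part X kernel k) x"
    by (simp add: hom_part_apply sum_words_Suc lin_apply kernel_def blinfun.sum_right
        scaleC_sum_right scaleC_scaleC) (rule sum.swap)
qed

lemma blinfun_compose_assoc: "(A o\<^sub>L B) o\<^sub>L C = A o\<^sub>L (B o\<^sub>L C)"
  by (rule blinfun_eqI) simp

lemma hom_part_kernel_Suc':
  assumes "X \<in> nc_ball"
  shows "hom_part X kernel (Suc k) = hom_part X kernel k o\<^sub>L lin X"
proof (induction k)
  case 0
  have "hom_part X kernel 0 = id_blinfun" by (simp add: hom_part_def kernel_def)
  then show ?case by (simp add: hom_part_kernel_Suc[OF assms])
next
  case (Suc k)
  have "hom_part X kernel (Suc (Suc k)) = lin X o\<^sub>L (hom_part X kernel k o\<^sub>L lin X)"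
    by (simp only: hom_part_kernel_Suc[OF assms, of "Suc k"] Suc)
  then show ?case by (simp only: hom_part_kernel_Suc[OF assms, of k] blinfun_compose_assoc)
qed

text \<open>The homogeneous parts of \<open>kernel\<close> are the powers of \<open>lin X\<close>,
  so their sum is the Neumann series. Splitting off one factor on the left or on the right shows
  that it is an inverse on both sides, as \<open>op_inv\<close> requires.\<close>

lemma res_inverse:
  fixes X :: "'h::complex_hilbert op ^ 'n"
  assumes X: "X \<in> nc_ball"
  shows "hom_part X kernel sums res X"
    and "(id_blinfun - lin X) o\<^sub>L res X = id_blinfun" and "res X o\<^sub>L (id_blinfun - lin X) = id_blinfun"
proof -
  have "summable (\<lambda>k. norm (hom_part X kernel k))"
    by (rule subexponential_hom_part_summable[OF square_summable_imp_subexponential[OF kernel_square_summable] X])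
  then obtain R where R: "hom_part X kernel sums R" using summable_norm_cancel by (auto simp: summable_def)
  have h0: "hom_part X kernel 0 = id_blinfun" by (simp add: hom_part_def kernel_def)
  have shift: "(\<lambda>k. hom_part X kernel (Suc k)) sums (R - id_blinfun)"
    using R by (simp add: sums_Suc_iff h0)
  have "(\<lambda>k. hom_part X kernel (Suc k)) sums (lin X o\<^sub>L R)"
    unfolding hom_part_kernel_Suc[OF X]
    by (rule bounded_linear.sums[OF bounded_bilinear.bounded_linear_right[OF bounded_bilinear_blinfun_compose] R])
  then have 1: "(id_blinfun - lin X) o\<^sub>L R = id_blinfun"
    using shift sums_unique2 by (simp add: bounded_bilinear.diff_left[OF bounded_bilinear_blinfun_compose]) fastforce
  have "(\<lambda>k. hom_part X kernel (Suc k)) sums (R o\<^sub>L lin X)"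
    unfolding hom_part_kernel_Suc'[OF X]
    by (rule bounded_linear.sums[OF bounded_bilinear.bounded_linear_left[OF bounded_bilinear_blinfun_compose] R])
  then have 2: "R o\<^sub>L (id_blinfun - lin X) = id_blinfun"
    using shift sums_unique2 by (simp add: bounded_bilinear.diff_right[OF bounded_bilinear_blinfun_compose]) fastforce
  have "res X = R" unfolding res_def op_inv_def
  proof (rule the_equality)
    fix S assume S: "(id_blinfun - lin X) o\<^sub>L S = id_blinfun \<and> S o\<^sub>L (id_blinfun - lin X) = id_blinfun"
    have "S = (R o\<^sub>L (id_blinfun - lin X)) o\<^sub>L S" by (simp add: 2)
    also have "\<dots> = R" using S by (simp add: blinfun_compose_assoc)
    finally show "S = R" .
  qed (use 1 2 in blast)
  with R 1 2 show "hom_part X kernel sums res X" "(id_blinfun - lin X) o\<^sub>L res X = id_blinfun"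
    "res X o\<^sub>L (id_blinfun - lin X) = id_blinfun" by simp_all
qed

lemma res_apply:
  assumes "X \<in> nc_ball"
  shows "res X x - lin X (res X x) = x" "res X (lin X x) = res X x - x"
proof -
  show "res X x - lin X (res X x) = x"
    using arg_cong[OF res_inverse(2)[OF assms], of "\<lambda>T. blinfun_apply T x"] by (simp add: blinfun.diff_left)
  have "res X x - res X (lin X x) = x"
    using arg_cong[OF res_inverse(3)[OF assms], of "\<lambda>T. blinfun_apply T x"]
    by (simp add: blinfun.diff_left blinfun.diff_right)
  then show "res X (lin X x) = res X x - x" by (simp add: algebra_simps)
qed

lemma power_series_res: "power_series res kernel"
  unfolding power_series_def
  using res_inverse(1) subexponential_hom_part_summable[OF square_summable_imp_subexponential[OF kernel_square_summable]]
  by blast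

lemma res_BH: "X \<in> nc_ball \<Longrightarrow> res X \<in> BH"
  using power_series_BH[OF power_series_res] .

lemma ball_aut_nth:
  "ball_aut \<xi> X $ j = scalar_op (\<xi> $ j) -
    (scalar_op (of_real s) o\<^sub>L (res X o\<^sub>L (X $ j - (scalar_op (of_real c * \<xi> $ j) o\<^sub>L lin X))))"
proof -
  have D: "(\<Sum>i\<in>UNIV. scalar_op (D $ i $ j) o\<^sub>L (X $ i)) = X $ j - (scalar_op (of_real c * \<xi> $ j) o\<^sub>L lin X)"
  proof (rule blinfun_eqI)
    fix x
    have "(\<Sum>i\<in>UNIV. scalar_op (D $ i $ j) o\<^sub>L (X $ i)) x =
        (\<Sum>i\<in>UNIV. (if i = j then (X $ i) x else 0) - (of_real c * \<xi> $ j) *\<^sub>C cnj (\<xi> $ i) *\<^sub>C (X $ i) x)"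
      unfolding blinfun.sum_left
      by (intro sum.cong) (auto simp: D_def scalar_op_apply scaleC_diff_left scaleC_scaleC scaleC_minus_left mult_ac)
    then show "(\<Sum>i\<in>UNIV. scalar_op (D $ i $ j) o\<^sub>L (X $ i)) x =
        (X $ j - (scalar_op (of_real c * \<xi> $ j) o\<^sub>L lin X)) x"
      by (simp add: sum_subtractf lin_apply scalar_op_apply blinfun.diff_left scaleC_sum_right)
  qed
  have "ball_aut \<xi> X $ j = scalar_op (\<xi> $ j) - s *\<^sub>R (res X o\<^sub>L (\<Sum>i\<in>UNIV. scalar_op (D $ i $ j) o\<^sub>L (X $ i)))"
    by (simp add: ball_aut_def defect_matrix_eq s_def res_def lin_def)
  then show ?thesis
    unfolding D by (auto intro!: blinfun_eqI simp: scalar_op_apply scaleC_of_real blinfun.scaleR_left blinfun.diff_left)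
qed

lemma ball_aut_apply:
  assumes X: "X \<in> nc_ball"
  shows "(ball_aut \<xi> X $ j) x = (\<xi> $ j) *\<^sub>C x - of_real s *\<^sub>C res X ((X $ j) x)
      + (of_real (s * c) * \<xi> $ j) *\<^sub>C (res X x - x)"
  by (simp add: ball_aut_nth blinfun.diff_left blinfun.diff_right scalar_op_apply scaleC_diff_right
      BH_apply[OF res_BH[OF X]] res_apply[OF X] scaleC_scaleC mult.assoc)

lemma ball_aut_BH: "X \<in> nc_ball \<Longrightarrow> ball_aut \<xi> X $ j \<in> BH"
  unfolding ball_aut_nth
  by (intro BH_diff BH_compose BH_scalar_op res_BH nc_ball_BH lin_BH)

lemma power_series_ball_aut_ex: "\<exists>p. \<forall>j. power_series (\<lambda>X. ball_aut \<xi> X $ j) (p j)"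
proof -
  have "\<exists>q. power_series (\<lambda>X. ball_aut \<xi> X $ j) q" for j
  proof -
    have "power_series lin (\<lambda>\<alpha>. \<Sum>i\<in>UNIV. cnj (\<xi> $ i) * (if \<alpha> = [i] then 1 else 0))"
      unfolding lin_def[abs_def] by (intro power_series_sum power_series_cmult power_series_var)
    note l = power_series_cmult[OF this, of "of_real c * \<xi> $ j"]
    show ?thesis
      unfolding ball_aut_nth
      by (rule exI, rule power_series_diff[OF power_series_const power_series_cmult[OF
            power_series_mult[OF power_series_res power_series_diff[OF power_series_var l]]]])
  qed
  then show ?thesis by metis
qed

lemma ball_aut_row_identity:
  fixes X :: "'h::complex_hilbert op ^ 'n"
  assumes X: "X \<in> nc_ball"
  obtains q where "s\<^sup>2 * (norm (rowop (ball_aut \<xi> X) x))\<^sup>2 =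
      s\<^sup>2 * (norm x)\<^sup>2 + (norm (rowop X q))\<^sup>2 - (norm q)\<^sup>2"
    "s\<^sup>2 * norm x \<le> norm (rowop X q) + norm q"
proof -
  define w where "w = rowop (ball_aut \<xi> X) x"
  define a where "a = (\<Sum>i\<in>UNIV. (\<xi> $ i) *\<^sub>C (x $ i))"
  define b where "b = w - a"
  define y where "y = b + (s * c) *\<^sub>R a"
  define q where "q = (\<chi> i. cnj (\<xi> $ i) *\<^sub>C y - s *\<^sub>R (x $ i))"
  have row_cnj: "rowop X (\<chi> i. cnj (\<xi> $ i) *\<^sub>C v) = lin X v" for v
    by (simp add: rowop_apply lin_apply BH_apply nc_ball_BH[OF X])
  have b: "b = - s *\<^sub>R res X (rowop X x) + (s * c) *\<^sub>R (res X a - a)"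
    unfolding b_def w_def rowop_apply[of "ball_aut \<xi> X"] ball_aut_apply[OF X]
    by (simp add: a_def sum.distrib sum_subtractf rowop_apply blinfun.sum_right scaleC_sum_right
        scaleR_sum_right scaleC_of_real scaleC_scaleC[symmetric] BH_apply[OF res_BH[OF X]] scaleC_diff_right
        scaleR_diff_right scaleR_scaleC[symmetric] mult.commute sum_negf scaleC_scaleR_commute)
  have res_eq: "res X v - lin X (res X v) = v" for v by (rule res_apply(1)[OF X])
  have "b - lin X b = - s *\<^sub>R rowop X x + (s * c) *\<^sub>R lin X a"
  proof -
    have "b - lin X b = - s *\<^sub>R (res X (rowop X x) - lin X (res X (rowop X x))) +
        (s * c) *\<^sub>R ((res X a - lin X (res X a)) - a + lin X a)"
      unfolding b by (simp add: blinfun.add_right blinfun.diff_right blinfun.scaleR_right blinfun.minus_right algebra_simps)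
    then show ?thesis by (simp add: res_eq)
  qed
  moreover have "rowop X q = lin X y - s *\<^sub>R rowop X x"
  proof -
    have "q = (\<chi> i. cnj (\<xi> $ i) *\<^sub>C y) - s *\<^sub>R x" by (simp add: q_def vec_eq_iff)
    then show ?thesis by (simp add: blinfun.diff_right blinfun.scaleR_right row_cnj)
  qed
  ultimately have bq: "rowop X q = b"
    by (simp add: y_def blinfun.add_right blinfun.scaleR_right algebra_simps) (metis add_right_cancel)
  have inner_cnj: "inner (cnj z *\<^sub>C u) v = inner u (z *\<^sub>C v)" for z and u v :: 'h
    by (simp add: Re_cinner[symmetric] cinner_scaleC_left cinner_scaleC_right)
  have nq: "(norm q)\<^sup>2 = (norm \<xi>)\<^sup>2 * (norm y)\<^sup>2 - 2 * s * inner y a + s\<^sup>2 * (norm x)\<^sup>2"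
  proof -
    have "(norm (q $ i))\<^sup>2 = (cmod (\<xi> $ i))\<^sup>2 * (norm y)\<^sup>2 - 2 * s * inner y ((\<xi> $ i) *\<^sub>C x $ i) + s\<^sup>2 * (norm (x $ i))\<^sup>2" for i
    proof -
      have "(norm (q $ i))\<^sup>2 = (norm (cnj (\<xi> $ i) *\<^sub>C y))\<^sup>2 - 2 * s * inner (cnj (\<xi> $ i) *\<^sub>C y) (x $ i) + s\<^sup>2 * (norm (x $ i))\<^sup>2"
        unfolding q_def power2_norm_eq_inner
        by (simp add: inner_diff_left inner_diff_right inner_commute power2_eq_square algebra_simps)
      then show ?thesis by (simp add: norm_scaleC power_mult_distrib inner_cnj)
    qed
    then show ?thesis
      by (simp add: norm_vec_power2 sum.distrib sum_subtractf sum_distrib_left sum_distrib_right a_def inner_sum_right)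
  qed
  have ny: "(norm y)\<^sup>2 = (norm b)\<^sup>2 + 2 * (s * c) * inner b a + (s * c)\<^sup>2 * (norm a)\<^sup>2"
    unfolding y_def power2_norm_eq_inner
    by (simp add: inner_add_left inner_add_right inner_commute power2_eq_square algebra_simps)
  have nya: "inner y a = inner b a + s * c * (norm a)\<^sup>2"
    by (simp add: y_def inner_add_left power2_norm_eq_inner)
  have nw: "(norm w)\<^sup>2 = (norm b)\<^sup>2 + 2 * inner b a + (norm a)\<^sup>2"
  proof -
    have "w = b + a" by (simp add: b_def)
    then show ?thesis by (simp only: power2_norm_eq_inner inner_add_left inner_add_right inner_commute[of a b])
  qed
  have "(norm q)\<^sup>2 = (norm b)\<^sup>2 - s\<^sup>2 * (norm w)\<^sup>2 + s\<^sup>2 * (norm x)\<^sup>2"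
  proof -
    let ?n = "(norm \<xi>)\<^sup>2"
    have n: "?n = 1 - s\<^sup>2" using s_square by simp
    have e1: "?n * (2 * (s * c)) - 2 * s = - 2 * s\<^sup>2"
    proof -
      have "?n * (2 * (s * c)) - 2 * s = 2 * s * (c * ?n) - 2 * s" by simp
      then show ?thesis unfolding c_norm by (simp add: algebra_simps power2_eq_square)
    qed
    have e2: "?n * (s * c)\<^sup>2 - 2 * s * (s * c) = - s\<^sup>2"
    proof -
      have "?n * (s * c)\<^sup>2 - 2 * s * (s * c) = s\<^sup>2 * c * (c * ?n) - 2 * s\<^sup>2 * c" by (simp add: power2_eq_square)
      also have "\<dots> = - s\<^sup>2 * (c * (1 + s))" unfolding c_norm by (simp add: algebra_simps)
      finally show ?thesis unfolding c_s by simp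
    qed
    have "(norm q)\<^sup>2 = ?n * (norm b)\<^sup>2 + (?n * (2 * (s * c)) - 2 * s) * inner b a
        + (?n * (s * c)\<^sup>2 - 2 * s * (s * c)) * (norm a)\<^sup>2 + s\<^sup>2 * (norm x)\<^sup>2"
      unfolding nq ny nya by (simp add: algebra_simps)
    then have "(norm q)\<^sup>2 = ?n * (norm b)\<^sup>2 + (- 2 * s\<^sup>2) * inner b a + (- s\<^sup>2) * (norm a)\<^sup>2 + s\<^sup>2 * (norm x)\<^sup>2"
      unfolding e1 e2 .
    then show ?thesis unfolding n nw by (simp add: algebra_simps)
  qed
  then have 1: "s\<^sup>2 * (norm (rowop (ball_aut \<xi> X) x))\<^sup>2 = s\<^sup>2 * (norm x)\<^sup>2 + (norm (rowop X q))\<^sup>2 - (norm q)\<^sup>2"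
    by (simp add: bq w_def)
  have a_le: "norm a \<le> norm \<xi> * norm x" unfolding a_def by (rule sum_mult_le_norm)
  have "s *\<^sub>R x = (\<chi> i. ((\<chi> i. cnj (\<xi> $ i)) $ i) *\<^sub>C y) - q" by (simp add: q_def vec_eq_iff)
  then have "s * norm x \<le> norm (\<chi> i. ((\<chi> i. cnj (\<xi> $ i)) $ i) *\<^sub>C y) + norm q"
    using norm_triangle_ineq4 s_pos by (metis abs_of_pos norm_scaleR)
  moreover have "norm (\<chi> i. cnj (\<xi> $ i)) = norm \<xi>" by (simp add: norm_vec_def)
  ultimately have "s * norm x \<le> norm \<xi> * norm y + norm q" by (simp only: norm_scaleC_vec)
  also have "norm \<xi> * norm y \<le> norm b + (1 - s) * s * norm x"
  proof -
    have "norm y \<le> norm b + s * c * norm a"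
      using norm_triangle_ineq[of b "(s * c) *\<^sub>R a"] s_pos c_pos by (simp add: y_def)
    also have "\<dots> \<le> norm b + s * c * (norm \<xi> * norm x)" using a_le s_pos c_pos by simp
    finally have "norm \<xi> * norm y \<le> norm \<xi> * (norm b + s * c * (norm \<xi> * norm x))" by (intro mult_left_mono) auto
    also have "\<dots> = norm \<xi> * norm b + (c * (norm \<xi>)\<^sup>2) * s * norm x" by (simp add: algebra_simps power2_eq_square)
    also have "norm \<xi> * norm b \<le> 1 * norm b" using norm_less_1 by (intro mult_right_mono) auto
    finally show ?thesis unfolding c_norm by simp
  qed
  finally have 2: "s\<^sup>2 * norm x \<le> norm (rowop X q) + norm q" by (simp add: bq algebra_simps power2_eq_square)
  from 1 2 show ?thesis by (rule that)
qed

lemma ball_aut_in_nc_ball: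
  fixes X :: "'h::complex_hilbert op ^ 'n"
  assumes X: "X \<in> nc_ball"
  shows "ball_aut \<xi> X \<in> nc_ball"
proof -
  define \<rho> where "\<rho> = norm (rowop X)"
  have \<rho>: "0 \<le> \<rho>" "\<rho> < 1" using nc_ball_norm[OF X] by (auto simp: \<rho>_def)
  \<comment> \<open>From \<open>s\<^sup>2 * norm x \<le> 2 * norm q\<close> the loss
    \<open>(1 - \<rho>\<^sup>2) * (norm q)\<^sup>2\<close> is at least
    \<open>d * s\<^sup>2 * (norm x)\<^sup>2\<close>.\<close>
  define d where "d = (1 - \<rho>\<^sup>2) * s\<^sup>2 / 4"
  have \<rho>2: "\<rho>\<^sup>2 < 1" using \<rho> by (simp add: abs_square_less_1)
  have d: "0 < d" using \<rho>2 s_pos by (simp add: d_def)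
  have bound: "(norm (rowop (ball_aut \<xi> X) x))\<^sup>2 \<le> (1 - d) * (norm x)\<^sup>2" for x
  proof -
    obtain q where q: "s\<^sup>2 * (norm (rowop (ball_aut \<xi> X) x))\<^sup>2 =
        s\<^sup>2 * (norm x)\<^sup>2 + (norm (rowop X q))\<^sup>2 - (norm q)\<^sup>2"
      "s\<^sup>2 * norm x \<le> norm (rowop X q) + norm q" using ball_aut_row_identity[OF X] by blast
    have rq: "norm (rowop X q) \<le> \<rho> * norm q" unfolding \<rho>_def by (rule norm_blinfun)
    also have "\<dots> \<le> 1 * norm q" using \<rho> by (intro mult_right_mono) auto
    finally have "s\<^sup>2 * norm x \<le> 2 * norm q" using q(2) by simp
    then have "(s\<^sup>2 * norm x)\<^sup>2 \<le> (2 * norm q)\<^sup>2" by (intro power_mono) auto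
    then have nq: "s\<^sup>2 * (s\<^sup>2 * (norm x)\<^sup>2) / 4 \<le> (norm q)\<^sup>2" by (simp add: power_mult_distrib power2_eq_square mult_ac)
    have "(norm (rowop X q))\<^sup>2 \<le> (\<rho> * norm q)\<^sup>2" using rq by (intro power_mono) auto
    then have "s\<^sup>2 * (norm (rowop (ball_aut \<xi> X) x))\<^sup>2 \<le> s\<^sup>2 * (norm x)\<^sup>2 - (1 - \<rho>\<^sup>2) * (norm q)\<^sup>2"
      using q(1) by (simp add: power_mult_distrib algebra_simps)
    also have "\<dots> \<le> s\<^sup>2 * (norm x)\<^sup>2 - (1 - \<rho>\<^sup>2) * (s\<^sup>2 * (s\<^sup>2 * (norm x)\<^sup>2) / 4)"
      using nq \<rho>2 by (intro diff_left_mono mult_left_mono) auto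
    also have "\<dots> = s\<^sup>2 * ((1 - d) * (norm x)\<^sup>2)" by (simp add: d_def algebra_simps)
    finally show ?thesis using s_pos by simp
  qed
  have "norm (rowop (ball_aut \<xi> X)) \<le> sqrt (1 - d)"
  proof (rule norm_blinfun_bound)
    have "d \<le> 1"
    proof -
      have "(1 - \<rho>\<^sup>2) * s\<^sup>2 \<le> 1 * 1" using \<rho>2 s_le_1 s_pos by (intro mult_mono) (auto simp: power_le_one)
      then show ?thesis by (simp add: d_def)
    qed
    then show "0 \<le> sqrt (1 - d)" by simp
    show "norm (rowop (ball_aut \<xi> X) x) \<le> sqrt (1 - d) * norm x" for x
      using real_le_rsqrt[OF bound[of x]] by (simp add: real_sqrt_mult)
  qed
  also have "\<dots> < 1" using d by simp
  finally show ?thesis using ball_aut_BH[OF X] by (simp add: nc_ball_iff)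
qed

lemma ball_aut_involution:
  fixes X :: "'h::complex_hilbert op ^ 'n"
  assumes X: "X \<in> nc_ball"
  shows "ball_aut \<xi> (ball_aut \<xi> X) = X"
proof -
  define Y where "Y = ball_aut \<xi> X"
  have Y: "Y \<in> nc_ball" unfolding Y_def by (rule ball_aut_in_nc_ball[OF X])
  \<comment> \<open>In other words \<open>id_blinfun - lin Y\<close> is \<open>s\<^sup>2\<close>
    times \<open>res X\<close>, so \<open>res Y\<close> is \<open>id_blinfun - lin X\<close> divided
    by \<open>s\<^sup>2\<close>, and the second application undoes the first.\<close>
  have lin_Y: "lin Y x = x - of_real (s\<^sup>2) *\<^sub>C res X x" for x
  proof -
    have n: "(\<Sum>i\<in>UNIV. (cnj (\<xi> $ i) * \<xi> $ i) *\<^sub>C v) = of_real (1 - s\<^sup>2) *\<^sub>C v" for v :: 'h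
      by (simp only: scaleC_sum_left[symmetric] sum_cnj_mult_self) (simp add: s_square)
    have "lin Y x = (\<Sum>i\<in>UNIV. (cnj (\<xi> $ i) * \<xi> $ i) *\<^sub>C x) - of_real s *\<^sub>C res X (lin X x)
        + of_real (s * c) *\<^sub>C (\<Sum>i\<in>UNIV. (cnj (\<xi> $ i) * \<xi> $ i) *\<^sub>C (res X x - x))"
      unfolding lin_apply Y_def ball_aut_apply[OF X]
      by (simp add: scaleC_diff_right scaleC_add_right sum.distrib sum_subtractf scaleC_scaleC blinfun.sum_right
          BH_apply[OF res_BH[OF X]] scaleC_sum_right mult_ac)
    also have "\<dots> = of_real (1 - s\<^sup>2) *\<^sub>C x - of_real s *\<^sub>C (res X x - x)
        + of_real (s * c * (1 - s\<^sup>2)) *\<^sub>C (res X x - x)"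
      by (simp only: n res_apply(2)[OF X] scaleC_scaleC of_real_mult mult.assoc)
    also have "s * c * (1 - s\<^sup>2) = s * (1 - s)"
      using c_norm s_square by (simp add: mult.assoc)
    also have "of_real (1 - s\<^sup>2) *\<^sub>C x - of_real s *\<^sub>C (res X x - x)
        + of_real (s * (1 - s)) *\<^sub>C (res X x - x) = x - of_real (s\<^sup>2) *\<^sub>C res X x"
      unfolding scaleC_of_real by (simp add: algebra_simps power2_eq_square)
    finally show ?thesis .
  qed
  have "(ball_aut \<xi> Y $ j) x = (X $ j) x" for j x
  proof -
    let ?r = "res X x" and ?t = "res X ((X $ j) x)" and ?z = "\<xi> $ j"
    have "res Y (of_real (s\<^sup>2) *\<^sub>C res X v) = v" for v
      using res_apply(2)[OF Y, of v] by (simp add: lin_Y blinfun.diff_right algebra_simps)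
    then have resY: "of_real s *\<^sub>C res Y (of_real s *\<^sub>C res X v) = v" for v
      by (simp add: BH_apply[OF res_BH[OF Y]] scaleC_scaleC power2_eq_square)
    have Yj: "(Y $ j) x = ?z *\<^sub>C x - of_real s *\<^sub>C ?t + (of_real (s * c) * ?z) *\<^sub>C (?r - x)"
      unfolding Y_def by (rule ball_aut_apply[OF X])
    have lY: "res Y (lin Y x) = res Y x - x" by (rule res_apply(2)[OF Y])
    have "(ball_aut \<xi> Y $ j) x = ?z *\<^sub>C x - of_real s *\<^sub>C res Y ((Y $ j) x - (of_real c * ?z) *\<^sub>C lin Y x)"
      by (simp add: ball_aut_apply[OF Y] blinfun.diff_right BH_apply[OF res_BH[OF Y]] lY
          scaleC_diff_right scaleC_scaleC mult.assoc)
    also have "(Y $ j) x - (of_real c * ?z) *\<^sub>C lin Y x = of_real s *\<^sub>C res X (?z *\<^sub>C x - (X $ j) x)"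
    proof -
      let ?s = "complex_of_real s" and ?c = "complex_of_real c"
      have cs: "?c * (1 + ?s) = 1" using arg_cong[OF c_s, of complex_of_real] by simp
      have s1: "?s * ?c * ?z + ?c * ?s\<^sup>2 * ?z = ?s * ?z"
      proof -
        have "?s * ?c * ?z + ?c * ?s\<^sup>2 * ?z = ?s * (?c * (1 + ?s)) * ?z"
          by (simp add: power2_eq_square algebra_simps)
        then show ?thesis unfolding cs by simp
      qed
      have s2: "?z - ?s * ?c * ?z - ?c * ?z = 0"
      proof -
        have "?z - ?s * ?c * ?z - ?c * ?z = ?z - (?c * (1 + ?s)) * ?z" by (simp add: algebra_simps)
        then show ?thesis unfolding cs by simp
      qed
      have "(Y $ j) x - (of_real c * ?z) *\<^sub>C lin Y x =
          (?z - ?s * ?c * ?z - ?c * ?z) *\<^sub>C x + (?s * ?c * ?z + ?c * ?s\<^sup>2 * ?z) *\<^sub>C ?r - ?s *\<^sub>C ?t"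
        unfolding Yj lin_Y
        by (simp add: scaleC_diff_left scaleC_add_left scaleC_diff_right scaleC_scaleC algebra_simps)
      then show ?thesis
        unfolding s1 s2 by (simp add: blinfun.diff_right BH_apply[OF res_BH[OF X]] scaleC_diff_right scaleC_scaleC)
    qed
    finally show ?thesis by (simp add: resY)
  qed
  then show ?thesis unfolding Y_def[symmetric] by (simp add: vec_eq_iff blinfun_eqI)
qed

section \<open>Action of the automorphism on scalar points\<close>

definition aut_pt :: "complex ^ 'n \<Rightarrow> complex ^ 'n" where
  "aut_pt \<zeta> = (\<chi> j. \<xi> $ j - of_real s * (\<zeta> $ j - of_real c * \<xi> $ j * (\<Sum>i\<in>UNIV. cnj (\<xi> $ i) * \<zeta> $ i)) /
      (1 - (\<Sum>i\<in>UNIV. cnj (\<xi> $ i) * \<zeta> $ i)))"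

lemma cmod_pairing_le: "cmod (\<Sum>i\<in>UNIV. cnj (\<xi> $ i) * \<zeta> $ i) \<le> norm \<xi> * norm \<zeta>"
proof -
  have "cmod (\<Sum>i\<in>UNIV. cnj (\<xi> $ i) * \<zeta> $ i) \<le> (\<Sum>j\<in>UNIV. cmod (\<xi> $ j) * cmod (\<zeta> $ j))"
    by (intro sum_norm_le) (simp add: norm_mult)
  also have "\<dots> \<le> norm \<xi> * norm \<zeta>"
    using L2_set_mult_ineq[of "\<lambda>i. cmod (\<xi> $ i)" "\<lambda>i. cmod (\<zeta> $ i)" UNIV] by (simp add: norm_vec_def)
  finally show ?thesis .
qed

lemma pairing_bounds:
  assumes "norm \<zeta> < 1"
  shows "1 - norm \<xi> \<le> cmod (1 - (\<Sum>i\<in>UNIV. cnj (\<xi> $ i) * \<zeta> $ i))"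
    "cmod (1 - (\<Sum>i\<in>UNIV. cnj (\<xi> $ i) * \<zeta> $ i)) \<le> 2"
proof -
  have "norm \<xi> * norm \<zeta> \<le> norm \<xi> * 1" using assms by (intro mult_left_mono) auto
  then have u: "cmod (\<Sum>i\<in>UNIV. cnj (\<xi> $ i) * \<zeta> $ i) \<le> norm \<xi>" using cmod_pairing_le[of \<zeta>] by simp
  then show "1 - norm \<xi> \<le> cmod (1 - (\<Sum>i\<in>UNIV. cnj (\<xi> $ i) * \<zeta> $ i))"
    using norm_triangle_ineq2[of 1 "\<Sum>i\<in>UNIV. cnj (\<xi> $ i) * \<zeta> $ i"] by simp
  show "cmod (1 - (\<Sum>i\<in>UNIV. cnj (\<xi> $ i) * \<zeta> $ i)) \<le> 2"
    using u norm_less_1 norm_triangle_ineq4[of 1 "\<Sum>i\<in>UNIV. cnj (\<xi> $ i) * \<zeta> $ i"] by simp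
qed

lemma ball_aut_scalar_tuple:
  assumes "norm \<zeta> < 1"
  shows "ball_aut \<xi> (scalar_tuple \<zeta>) = (scalar_tuple (aut_pt \<zeta>) :: 'h::complex_hilbert op ^ 'n)"
proof -
  define u where "u = (\<Sum>i\<in>UNIV. cnj (\<xi> $ i) * \<zeta> $ i)"
  let ?X = "scalar_tuple \<zeta> :: 'h op ^ 'n"
  have X: "?X \<in> nc_ball" by (rule scalar_tuple_in_nc_ball[OF assms])
  have u1: "1 - u \<noteq> 0" using pairing_bounds(1)[OF assms] norm_less_1 by (auto simp: u_def[symmetric])
  have lin: "lin ?X x = u *\<^sub>C x" for x
    by (simp add: lin_apply scalar_op_apply scaleC_scaleC u_def scaleC_sum_left)
  have "res ?X x = (1 / (1 - u)) *\<^sub>C x" for x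
  proof -
    have "(1 - u) *\<^sub>C res ?X x = x" using res_apply(1)[OF X, of x] by (simp add: lin scaleC_diff_left)
    then have "(1 / (1 - u)) *\<^sub>C (1 - u) *\<^sub>C res ?X x = (1 / (1 - u)) *\<^sub>C x" by simp
    then show ?thesis using u1 by (simp add: scaleC_scaleC)
  qed
  then have "(ball_aut \<xi> ?X $ j) x = (scalar_tuple (aut_pt \<zeta>) $ j) x" for j x
    using u1 by (simp add: ball_aut_nth blinfun.diff_left scalar_op_apply lin scaleC_scaleC aut_pt_def u_def[symmetric]
        scaleC_diff_left[symmetric] scaleC_diff_right[symmetric])
  then show ?thesis by (simp add: vec_eq_iff blinfun_eqI)
qed

text \<open>The classical Moebius identity of the Euclidean ball. With \<open>pairing_bounds\<close>
  it compares the distances to the sphere before and after the automorphism.\<close>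

lemma aut_pt_norm:
  assumes "norm \<zeta> < 1"
  shows "1 - (norm (aut_pt \<zeta>))\<^sup>2 =
    s\<^sup>2 * (1 - (norm \<zeta>)\<^sup>2) / (cmod (1 - (\<Sum>i\<in>UNIV. cnj (\<xi> $ i) * \<zeta> $ i)))\<^sup>2"
proof -
  define u where "u = (\<Sum>i\<in>UNIV. cnj (\<xi> $ i) * \<zeta> $ i)"
  define g where "g = 1 - of_real c * u"
  have u1: "1 - u \<noteq> 0" using pairing_bounds(1)[OF assms] norm_less_1 by (auto simp: u_def[symmetric])
  have cu: "cnj u = (\<Sum>i\<in>UNIV. cnj (\<zeta> $ i) * \<xi> $ i)" by (simp add: u_def mult.commute)
  have sc: "s * c = 1 - c" using c_s by (simp add: algebra_simps)
  have comp: "(1 - u) * aut_pt \<zeta> $ j = g * \<xi> $ j - of_real s * \<zeta> $ j" for j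
  proof -
    define N where "N = of_real s * (\<zeta> $ j - of_real c * \<xi> $ j * u)"
    have "aut_pt \<zeta> $ j = \<xi> $ j - N / (1 - u)" by (simp add: aut_pt_def u_def[symmetric] N_def)
    then have "(1 - u) * aut_pt \<zeta> $ j = (1 - u) * \<xi> $ j - (1 - u) * (N / (1 - u))"
      by (simp only: right_diff_distrib)
    also have "(1 - u) * (N / (1 - u)) = N" using u1 by simp
    finally have "(1 - u) * aut_pt \<zeta> $ j = (1 - u) * \<xi> $ j - of_real s * \<zeta> $ j + of_real (s * c) * \<xi> $ j * u"
      by (simp add: N_def right_diff_distrib mult_ac)
    then show ?thesis unfolding sc by (simp add: g_def algebra_simps)
  qed
  have "complex_of_real ((cmod (1 - u))\<^sup>2 * (norm (aut_pt \<zeta>))\<^sup>2) =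
      (\<Sum>j\<in>UNIV. cnj ((1 - u) * aut_pt \<zeta> $ j) * ((1 - u) * aut_pt \<zeta> $ j))"
    by (simp add: sum_cnj_mult_self[symmetric] cnj_mult_self[symmetric] sum_distrib_left mult_ac del: of_real_power)
  also have "\<dots> = (\<Sum>j\<in>UNIV. cnj g * g * (cnj (\<xi> $ j) * \<xi> $ j) - of_real s * cnj g * (cnj (\<xi> $ j) * \<zeta> $ j)
      - of_real s * g * (cnj (\<zeta> $ j) * \<xi> $ j) + of_real s * of_real s * (cnj (\<zeta> $ j) * \<zeta> $ j))"
    unfolding comp by (intro sum.cong) (auto simp: algebra_simps)
  also have "\<dots> = cnj g * g * of_real ((norm \<xi>)\<^sup>2) - of_real s * cnj g * u - of_real s * g * cnj u
      + of_real s * of_real s * of_real ((norm \<zeta>)\<^sup>2)"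
    by (simp only: sum.distrib sum_subtractf sum_distrib_left[symmetric] u_def[symmetric] cu[symmetric] sum_cnj_mult_self)
  finally have "(cmod (1 - u))\<^sup>2 * (norm (aut_pt \<zeta>))\<^sup>2 = Re (cnj g * g * of_real ((norm \<xi>)\<^sup>2) - of_real s * cnj g * u
      - of_real s * g * cnj u + of_real s * of_real s * of_real ((norm \<zeta>)\<^sup>2))"
    by (metis Re_complex_of_real)
  also have "\<dots> = (cmod g)\<^sup>2 * (norm \<xi>)\<^sup>2 - 2 * s * Re (cnj g * u) + s\<^sup>2 * (norm \<zeta>)\<^sup>2"
    unfolding cmod_power2[of g] by (simp add: power2_eq_square algebra_simps)
  also have "\<dots> = (cmod (1 - u))\<^sup>2 - s\<^sup>2 * (1 - (norm \<zeta>)\<^sup>2)"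
  proof -
    let ?n = "(norm \<xi>)\<^sup>2"
    have n: "?n = 1 - s\<^sup>2" using s_square by simp
    have g2: "(cmod g)\<^sup>2 = 1 - 2 * c * Re u + c\<^sup>2 * (cmod u)\<^sup>2"
      unfolding g_def cmod_power2 by (simp add: power2_eq_square algebra_simps)
    have gu: "Re (cnj g * u) = Re u - c * (cmod u)\<^sup>2"
      unfolding g_def cmod_power2 by (simp add: power2_eq_square algebra_simps)
    have u2: "(cmod (1 - u))\<^sup>2 = 1 - 2 * Re u + (cmod u)\<^sup>2"
      unfolding cmod_power2 by (simp add: power2_eq_square algebra_simps)
    \<comment> \<open>The coefficients of \<open>Re u\<close> and of \<open>(cmod u)\<^sup>2\<close>
      both reduce to 1; this is where the special value of \<open>c\<close> enters.\<close>
    have e1: "c * ?n + s = 1" using c_norm by simp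
    have e2: "c\<^sup>2 * ?n + 2 * s * c = 1"
    proof -
      have "c\<^sup>2 * ?n + 2 * s * c = c * (c * ?n) + 2 * s * c" by (simp add: power2_eq_square)
      also have "\<dots> = c * (1 + s)" unfolding c_norm by (simp add: algebra_simps)
      finally show ?thesis using c_s by simp
    qed
    have "(cmod g)\<^sup>2 * ?n - 2 * s * Re (cnj g * u) + s\<^sup>2 * (norm \<zeta>)\<^sup>2 =
        ?n - 2 * Re u * (c * ?n + s) + (cmod u)\<^sup>2 * (c\<^sup>2 * ?n + 2 * s * c) + s\<^sup>2 * (norm \<zeta>)\<^sup>2"
      unfolding g2 gu by (simp add: algebra_simps)
    also have "\<dots> = ?n - 2 * Re u * 1 + (cmod u)\<^sup>2 * 1 + s\<^sup>2 * (norm \<zeta>)\<^sup>2" unfolding e1 e2 ..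
    finally show ?thesis unfolding u2 n by (simp add: algebra_simps)
  qed
  finally show ?thesis using u1 unfolding u_def[symmetric] by (simp add: field_simps)
qed

lemma aut_pt_0: "aut_pt 0 = \<xi>"
  by (simp add: aut_pt_def vec_eq_iff)

lemma aut_pt_in_ball: "norm \<zeta> < 1 \<Longrightarrow> norm (aut_pt \<zeta>) < 1"
proof -
  assume \<zeta>: "norm \<zeta> < 1"
  have "0 < cmod (1 - (\<Sum>i\<in>UNIV. cnj (\<xi> $ i) * \<zeta> $ i))" by (rule less_le_trans[OF _ pairing_bounds(1)[OF \<zeta>]]) (simp add: norm_less_1)
  moreover have "(norm \<zeta>)\<^sup>2 < 1" using \<zeta> by (simp add: abs_square_less_1)
  ultimately have "0 < 1 - (norm (aut_pt \<zeta>))\<^sup>2"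
    unfolding aut_pt_norm[OF \<zeta>] using s_pos by simp
  then show ?thesis by (simp add: abs_square_less_1)
qed

end

section \<open>Fixed points\<close>

context fock
begin

definition scalar_value :: "'h op \<Rightarrow> complex" where
  "scalar_value T = cinner (T (e [])) (e [])"

lemma scalar_value_scalar_op [simp]: "scalar_value (scalar_op z) = z"
  by (simp add: scalar_value_def scalar_op_apply cinner_scaleC_left orth)

lemma bounded_linear_scalar_value: "bounded_linear scalar_value"
  unfolding scalar_value_def[abs_def]
  by (rule bounded_linear_compose[OF bounded_linear_cinner_left blinfun.bounded_linear_left])

lemma e_nonzero: "e \<alpha> \<noteq> 0"
  by (metis norm_e norm_zero zero_neq_one)

text \<open>Explicit form of \<open>scalar_rep\<close>, with which it agrees in the ball for maps
  given by power series. As \<open>scalar_value\<close> is bounded and linear, continuity and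
  convergent expansions pass from operators to scalars.\<close>

definition scalar_map :: "('h op ^ 'n \<Rightarrow> 'h op ^ 'n) \<Rightarrow> complex ^ 'n \<Rightarrow> complex ^ 'n" where
  "scalar_map \<phi> \<zeta> = (\<chi> i. scalar_value (\<phi> (scalar_tuple \<zeta>) $ i))"

lemma power_series_scalar_value:
  fixes f :: "'h op ^ 'n \<Rightarrow> 'h op"
  assumes f: "power_series f a" and \<zeta>: "norm \<zeta> < 1"
  shows "(\<lambda>k. \<Sum>\<alpha> | length \<alpha> = k. a \<alpha> * word_val \<zeta> \<alpha>) sums scalar_value (f (scalar_tuple \<zeta>))"
    and "f (scalar_tuple \<zeta>) = scalar_op (scalar_value (f (scalar_tuple \<zeta>)))"
proof -
  have s: "hom_part (scalar_tuple \<zeta>) a sums f (scalar_tuple \<zeta>)"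
    by (rule power_series_sums[OF f scalar_tuple_in_nc_ball[OF \<zeta>]])
  from bounded_linear.sums[OF bounded_linear_scalar_value this]
  show 1: "(\<lambda>k. \<Sum>\<alpha> | length \<alpha> = k. a \<alpha> * word_val \<zeta> \<alpha>) sums scalar_value (f (scalar_tuple \<zeta>))"
    by (simp add: hom_part_scalar_tuple)
  have "hom_part (scalar_tuple \<zeta> :: 'h op ^ 'n) a = (\<lambda>k. scalar_op (\<Sum>\<alpha> | length \<alpha> = k. a \<alpha> * word_val \<zeta> \<alpha>))"
    by (rule ext) (rule hom_part_scalar_tuple)
  then have "hom_part (scalar_tuple \<zeta> :: 'h op ^ 'n) a sums scalar_op (scalar_value (f (scalar_tuple \<zeta>)))"
    using bounded_linear.sums[OF bounded_linear_scalar_op 1] by (simp only:)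
  with s show "f (scalar_tuple \<zeta>) = scalar_op (scalar_value (f (scalar_tuple \<zeta>)))"
    by (rule sums_unique2)
qed

lemma selfmap_scalar_tuple:
  fixes \<phi> :: "'h op ^ 'n \<Rightarrow> 'h op ^ 'n"
  assumes \<phi>: "\<And>i. power_series (\<lambda>X. \<phi> X $ i) (p i)" and \<zeta>: "norm \<zeta> < 1"
  shows "\<phi> (scalar_tuple \<zeta>) = scalar_tuple (scalar_map \<phi> \<zeta>)"
  using power_series_scalar_value(2)[OF \<phi> \<zeta>] by (simp add: vec_eq_iff scalar_map_def)

lemma selfmap_scalar_map_norm:
  fixes \<phi> :: "'h op ^ 'n \<Rightarrow> 'h op ^ 'n"
  assumes \<phi>: "\<And>i. power_series (\<lambda>X. \<phi> X $ i) (p i)"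
    and maps: "\<And>X. X \<in> nc_ball \<Longrightarrow> \<phi> X \<in> nc_ball" and \<zeta>: "norm \<zeta> < 1"
  shows "norm (scalar_map \<phi> \<zeta>) < 1"
proof (rule scalar_tuple_in_nc_ballD[OF _ e_nonzero])
  show "(scalar_tuple (scalar_map \<phi> \<zeta>) :: 'h op ^ 'n) \<in> nc_ball"
    using maps[OF scalar_tuple_in_nc_ball[OF \<zeta>]] selfmap_scalar_tuple[OF \<phi> \<zeta>] by simp
qed

lemma scalar_rep_eq:
  fixes \<phi> :: "'h op ^ 'n \<Rightarrow> 'h op ^ 'n"
  assumes \<phi>: "\<And>i. power_series (\<lambda>X. \<phi> X $ i) (p i)" and \<zeta>: "norm \<zeta> < 1"
  shows "scalar_rep \<phi> \<zeta> = scalar_map \<phi> \<zeta>"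
  unfolding scalar_rep_def selfmap_scalar_tuple[OF \<phi> \<zeta>]
  by (rule the_equality) (use scalar_tuple_inj[OF e_nonzero[of "[]"]] in auto)

lemma continuous_on_scalar_map:
  fixes \<phi> :: "'h op ^ 'n \<Rightarrow> 'h op ^ 'n"
  assumes \<phi>: "\<And>i. power_series (\<lambda>X. \<phi> X $ i) (p i)" and r: "r < 1"
  shows "continuous_on (cball 0 r) (scalar_map \<phi>)"
  unfolding scalar_map_def
proof (rule continuous_on_vec_lambda)
  fix i
  have c2: "continuous_on (cball 0 r) (\<lambda>\<zeta>. scalar_tuple \<zeta> :: 'h op ^ 'n)"
    unfolding scalar_tuple_def
    by (intro continuous_on_vec_lambda bounded_linear.continuous_on[OF bounded_linear_scalar_op]
        continuous_on_component continuous_on_id)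
  have c1: "continuous_on {X :: 'h op ^ 'n. X \<in> nc_ball \<and> norm (rowop X) \<le> r} (\<lambda>X. \<phi> X $ i)"
    by (rule power_series_continuous_on[OF \<phi> power_series_imp_subexponential[OF \<phi>] r])
  have "scalar_tuple \<zeta> \<in> {X :: 'h op ^ 'n. X \<in> nc_ball \<and> norm (rowop X) \<le> r}" if "\<zeta> \<in> cball 0 r" for \<zeta>
    using that r scalar_tuple_in_nc_ball[of \<zeta>] order_trans[OF norm_rowop_scalar_tuple_le[of \<zeta>], of r] by auto
  then have "continuous_on (cball 0 r) (\<lambda>\<zeta>. \<phi> (scalar_tuple \<zeta>) $ i)"
    by (intro continuous_on_compose2[OF c1 c2]) auto
  then show "continuous_on (cball 0 r) (\<lambda>\<zeta>. scalar_value (\<phi> (scalar_tuple \<zeta>) $ i))"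
    by (rule bounded_linear.continuous_on[OF bounded_linear_scalar_value])
qed

section \<open>Reproducing kernels\<close>

definition kernel_vec :: "complex ^ 'n \<Rightarrow> 'h" where
  "kernel_vec \<zeta> = synth (\<lambda>\<alpha>. cnj (word_val \<zeta> \<alpha>))"

lemma cinner_kernel_vec: "norm \<zeta> < 1 \<Longrightarrow> cinner (kernel_vec \<zeta>) (e \<alpha>) = cnj (word_val \<zeta> \<alpha>)"
  unfolding kernel_vec_def by (rule cinner_synth[OF cnj_word_val_square_summable])

lemma norm_kernel_vec:
  assumes "norm \<zeta> < 1"
  shows "(norm (kernel_vec \<zeta>))\<^sup>2 = 1 / (1 - (norm \<zeta>)\<^sup>2)"
proof -
  have "((\<lambda>\<alpha>. (cmod (word_val \<zeta> \<alpha>))\<^sup>2) has_sum (norm (kernel_vec \<zeta>))\<^sup>2) UNIV"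
    using norm_synth_has_sum[OF cnj_word_val_square_summable[OF assms]] by (simp add: kernel_vec_def)
  then show ?thesis using word_val_has_sum[OF assms] has_sum_unique by blast
qed

lemma norm_kernel_vec_pos: "norm \<zeta> < 1 \<Longrightarrow> 0 < norm (kernel_vec \<zeta>)"
proof -
  assume \<zeta>: "norm \<zeta> < 1"
  then have "(norm \<zeta>)\<^sup>2 < 1" by (simp add: abs_square_less_1)
  then have "(norm (kernel_vec \<zeta>))\<^sup>2 \<noteq> 0" unfolding norm_kernel_vec[OF \<zeta>] by simp
  then show ?thesis by simp
qed

lemma H2_reproducing:
  fixes f :: "'h op ^ 'n \<Rightarrow> 'h op"
  assumes f: "f \<in> H2" and \<zeta>: "norm \<zeta> < 1"
  shows "scalar_value (f (scalar_tuple \<zeta>)) = cinner (h2_vec f) (kernel_vec \<zeta>)"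
proof -
  have "((\<lambda>\<alpha>. fh_coeff f \<alpha> * word_val \<zeta> \<alpha>) has_sum cinner (h2_vec f) (kernel_vec \<zeta>)) UNIV"
  proof -
    have "cinner (e \<alpha>) (kernel_vec \<zeta>) = word_val \<zeta> \<alpha>" for \<alpha>
      by (subst cinner_commute) (simp add: cinner_kernel_vec[OF \<zeta>])
    then show ?thesis
      using cinner_synth_has_sum[OF H2_square_summable[OF f], of "kernel_vec \<zeta>"] by (simp add: h2_vec_def)
  qed
  from has_sum_words_imp_sums[OF this] show ?thesis
    using power_series_scalar_value(1)[OF H2_power_series[OF f] \<zeta>] sums_unique2 by blast
qed

lemma cmod_word_val_le: "norm \<zeta> < 1 \<Longrightarrow> cmod (word_val \<zeta> \<alpha>) \<le> 1"
proof (induction \<alpha>)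
  case (Cons i \<alpha>)
  have "cmod (\<zeta> $ i) \<le> 1" using Finite_Cartesian_Product.norm_nth_le[of \<zeta> i] Cons.prems by simp
  then have "cmod (\<zeta> $ i) * cmod (word_val \<zeta> \<alpha>) \<le> 1 * 1" using Cons by (intro mult_mono) auto
  then show ?case by (simp add: norm_mult)
qed simp

text \<open>Kernels pair with a finite combination of the \<open>e \<alpha>\<close> to a bounded
  number, while their norms tend to infinity at the sphere; finite combinations approximate
  \<open>synth c\<close>.\<close>

lemma kernel_vec_weakly_null:
  assumes \<zeta>: "\<And>m. norm (\<zeta> m) < 1" "(\<lambda>m. norm (\<zeta> m)) \<longlonglongrightarrow> 1" and c: "square_summable c"
  shows "(\<lambda>m. cinner (synth c) (kernel_vec (\<zeta> m)) / norm (kernel_vec (\<zeta> m))) \<longlonglongrightarrow> 0"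
proof (rule tendstoI)
  fix \<delta> :: real assume \<delta>: "\<delta> > 0"
  obtain F where F: "finite F" "dist (\<Sum>\<alpha>\<in>F. c \<alpha> *\<^sub>C e \<alpha>) (synth c) \<le> \<delta> / 2"
    using infsum_finite_approximation[OF synth_summable[OF c], of "\<delta> / 2"] \<delta> unfolding synth_def by auto
  define S where "S = (\<Sum>\<alpha>\<in>F. cmod (c \<alpha>))"
  have "(\<lambda>m. S * sqrt (1 - (norm (\<zeta> m))\<^sup>2)) \<longlonglongrightarrow> S * sqrt (1 - 1\<^sup>2)" by (intro tendsto_intros \<zeta>)
  then have "\<forall>\<^sub>F m in sequentially. S * sqrt (1 - (norm (\<zeta> m))\<^sup>2) < \<delta> / 2"
    by (rule order_tendstoD) (use \<delta> in simp)
  then show "\<forall>\<^sub>F m in sequentially. dist (cinner (synth c) (kernel_vec (\<zeta> m)) / norm (kernel_vec (\<zeta> m))) 0 < \<delta>"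
  proof eventually_elim
    case (elim m)
    let ?k = "kernel_vec (\<zeta> m)" and ?p = "\<Sum>\<alpha>\<in>F. c \<alpha> *\<^sub>C e \<alpha>"
    have k: "0 < norm ?k" by (rule norm_kernel_vec_pos[OF \<zeta>(1)])
    have "(norm (\<zeta> m))\<^sup>2 < 1" using \<zeta>(1)[of m] by (simp add: abs_square_less_1)
    then have "1 = (norm ?k)\<^sup>2 * (1 - (norm (\<zeta> m))\<^sup>2)"
      using norm_kernel_vec[OF \<zeta>(1)[of m]] by simp
    then have "1 = norm ?k * sqrt (1 - (norm (\<zeta> m))\<^sup>2)"
      by (metis abs_norm_cancel real_sqrt_abs real_sqrt_mult real_sqrt_one)
    then have inv: "sqrt (1 - (norm (\<zeta> m))\<^sup>2) = 1 / norm ?k" using k by (simp add: field_simps)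
    have "cinner ?p ?k = (\<Sum>\<alpha>\<in>F. c \<alpha> * word_val (\<zeta> m) \<alpha>)"
    proof -
      have "cinner (e \<alpha>) ?k = word_val (\<zeta> m) \<alpha>" for \<alpha>
        by (subst cinner_commute) (simp add: cinner_kernel_vec[OF \<zeta>(1)])
      then show ?thesis by (simp add: cinner_sum_left cinner_scaleC_left)
    qed
    also have "cmod \<dots> \<le> S"
      unfolding S_def
      by (intro sum_norm_le) (simp add: norm_mult mult_left_le cmod_word_val_le[OF \<zeta>(1)])
    finally have p: "cmod (cinner ?p ?k) \<le> S" .
    have "cmod (cinner (synth c - ?p) ?k) \<le> \<delta> / 2 * norm ?k"
      using cinner_norm_le[of "synth c - ?p" ?k] F(2) k
      by (smt (verit) dist_norm mult_right_mono norm_minus_commute)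
    then have "cmod (cinner (synth c) ?k) \<le> \<delta> / 2 * norm ?k + S"
      using p norm_triangle_ineq[of "cinner (synth c - ?p) ?k" "cinner ?p ?k"] by (simp add: cinner_diff_left)
    then have "cmod (cinner (synth c) ?k) / norm ?k \<le> (\<delta> / 2 * norm ?k + S) / norm ?k"
      using k by (intro divide_right_mono) auto
    also have "\<dots> = \<delta> / 2 + S * (1 / norm ?k)" using k by (simp add: add_divide_distrib)
    also have "\<dots> < \<delta>" using elim unfolding inv by linarith
    finally show ?case by (simp add: norm_divide)
  qed
qed

end

section \<open>Boundary behaviour and existence of the fixed point\<close>

locale compact_composition = fock e for e :: "'n::finite list \<Rightarrow> 'h::complex_hilbert" +
  fixes \<phi> :: "'h op ^ 'n \<Rightarrow> 'h op ^ 'n"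
  assumes selfmap: "free_holomorphic_selfmap \<phi>"
    and compact: "H2_compact_op (composition_op \<phi>)"
begin

lemma maps_ball: "X \<in> nc_ball \<Longrightarrow> \<phi> X \<in> nc_ball"
  using selfmap by (simp add: free_holomorphic_selfmap_def)

definition p :: "'n \<Rightarrow> 'n list \<Rightarrow> complex" where
  "p i = fh_coeff (\<lambda>X. \<phi> X $ i)"

lemma power_series_\<phi>: "power_series (\<lambda>X. \<phi> X $ i) (p i)"
  using selfmap unfolding free_holomorphic_selfmap_def free_holomorphic_iff p_def by blast

abbreviation \<phi>pt :: "complex ^ 'n \<Rightarrow> complex ^ 'n" where
  "\<phi>pt \<equiv> scalar_map \<phi>"

lemmas \<phi>_scalar_tuple = selfmap_scalar_tuple[of \<phi> p, OF power_series_\<phi>]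
lemmas norm_\<phi>pt = selfmap_scalar_map_norm[of \<phi> p, OF power_series_\<phi> maps_ball]

text \<open>Test \<open>C\<^sub>\<phi>\<close> on the normalised kernel functions at \<open>\<phi> \<zeta>\<close>: their images, paired with the
  normalised kernel functions at \<open>\<zeta>\<close>, which tend weakly to zero, give the square root of the ratio.\<close>

lemma boundary_ratio:
  assumes \<epsilon>: "\<epsilon> > 0"
  obtains r where "0 \<le> r" "r < 1"
    "\<And>\<zeta>. r \<le> norm \<zeta> \<Longrightarrow> norm \<zeta> < 1 \<Longrightarrow> 1 - (norm \<zeta>)\<^sup>2 \<le> \<epsilon> * (1 - (norm (\<phi>pt \<zeta>))\<^sup>2)"
proof -
  have "\<exists>r. 0 \<le> r \<and> r < 1 \<and>
      (\<forall>\<zeta>. r \<le> norm \<zeta> \<and> norm \<zeta> < 1 \<longrightarrow> 1 - (norm \<zeta>)\<^sup>2 \<le> \<epsilon> * (1 - (norm (\<phi>pt \<zeta>))\<^sup>2))"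
  proof (rule ccontr)
    assume neg: "\<not> ?thesis"
    have "\<exists>\<zeta>. 1 - 1 / real (Suc m) \<le> norm \<zeta> \<and> norm \<zeta> < 1 \<and>
        \<epsilon> * (1 - (norm (\<phi>pt \<zeta>))\<^sup>2) < 1 - (norm \<zeta>)\<^sup>2" for m
    proof -
      have "0 \<le> 1 - 1 / real (Suc m)" "1 - 1 / real (Suc m) < 1" by auto
      with neg show ?thesis by (meson not_le)
    qed
    then obtain \<zeta> where \<zeta>: "\<And>m. 1 - 1 / real (Suc m) \<le> norm (\<zeta> m)" "\<And>m. norm (\<zeta> m) < 1"
      "\<And>m. \<epsilon> * (1 - (norm (\<phi>pt (\<zeta> m)))\<^sup>2) < 1 - (norm (\<zeta> m))\<^sup>2" by metis
    have "(\<lambda>m. 1 - 1 / real (Suc m)) \<longlonglongrightarrow> 1 - 0"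
      by (intro tendsto_diff tendsto_const LIMSEQ_Suc[OF lim_1_over_n])
    then have lower: "(\<lambda>m. 1 - 1 / real (Suc m)) \<longlonglongrightarrow> 1" by simp
    have lim\<zeta>: "(\<lambda>m. norm (\<zeta> m)) \<longlonglongrightarrow> 1"
    proof (rule tendsto_sandwich[OF _ _ lower tendsto_const])
      show "\<forall>\<^sub>F m in sequentially. 1 - 1 / real (Suc m) \<le> norm (\<zeta> m)"
        using \<zeta>(1) by (intro always_eventually allI)
      show "\<forall>\<^sub>F m in sequentially. norm (\<zeta> m) \<le> 1"
        using \<zeta>(2) by (intro always_eventually allI less_imp_le)
    qed
    define k where "k m = kernel_vec (\<phi>pt (\<zeta> m))" for m
    have npt: "norm (\<phi>pt (\<zeta> m)) < 1" for m by (rule norm_\<phi>pt[OF _ \<zeta>(2)])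
    have k_pos: "0 < norm (k m)" for m unfolding k_def by (rule norm_kernel_vec_pos[OF npt])
    define f where "f m = h2_fun ((1 / norm (k m)) *\<^sub>C k m)" for m
    have fH: "f m \<in> H2" for m by (simp add: f_def h2_fun_in_H2)
    have vec_f: "h2_vec (f m) = (1 / norm (k m)) *\<^sub>C k m" for m
    proof -
      have ss: "square_summable (\<lambda>\<alpha>. 1 / norm (k m) * cnj (word_val (\<phi>pt (\<zeta> m)) \<alpha>))"
        by (rule square_summable_cmult[OF cnj_word_val_square_summable[OF npt]])
      have "(1 / norm (k m)) *\<^sub>C k m = synth (\<lambda>\<alpha>. 1 / norm (k m) * cnj (word_val (\<phi>pt (\<zeta> m)) \<alpha>))"
        unfolding synth_cmult[OF cnj_word_val_square_summable[OF npt]] by (simp add: k_def kernel_vec_def)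
      then show ?thesis
        unfolding h2_vec_def f_def fh_coeff_h2_fun using synth_coeff_synth[OF ss] by simp
    qed
    have "H2_norm (f m) \<le> 1" for m
      using k_pos[of m] by (simp add: H2_norm_eq fH vec_f norm_scaleC norm_divide)
    then obtain g r where g: "g \<in> H2" and r: "strict_mono (r :: nat \<Rightarrow> nat)"
      and lim: "(\<lambda>m. h2_vec (composition_op \<phi> (f (r m)))) \<longlonglongrightarrow> h2_vec g"
      using H2_compact_subsequence[of "composition_op \<phi>" f, OF compact fH] by metis
    have TH: "composition_op \<phi> (f m) \<in> H2" for m
      using compact fH by (simp add: H2_compact_op_def H2_bounded_op_def)
    define \<kappa> where "\<kappa> m = kernel_vec (\<zeta> m)" for m
    have \<kappa>_pos: "0 < norm (\<kappa> m)" for m unfolding \<kappa>_def by (rule norm_kernel_vec_pos[OF \<zeta>(2)])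
    have pair: "cinner (h2_vec (composition_op \<phi> (f m))) (\<kappa> m) = norm (k m)" for m
    proof -
      have "cinner (h2_vec (composition_op \<phi> (f m))) (\<kappa> m) =
          scalar_value (composition_op \<phi> (f m) (scalar_tuple (\<zeta> m)))"
        unfolding \<kappa>_def by (rule H2_reproducing[OF TH \<zeta>(2), symmetric])
      also have "\<dots> = scalar_value (f m (scalar_tuple (\<phi>pt (\<zeta> m))))"
        by (simp add: composition_op_def scalar_tuple_in_nc_ball \<zeta>(2) \<phi>_scalar_tuple)
      also have "\<dots> = cinner (h2_vec (f m)) (k m)" unfolding k_def by (rule H2_reproducing[OF fH npt])
      also have "\<dots> = norm (k m)"
        using k_pos[of m] by (simp add: vec_f cinner_scaleC_left cinner_same power2_eq_square)
      finally show ?thesis .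
    qed
    \<comment> \<open>By \<open>norm_kernel_vec\<close> the negated estimate compares the norms of
      the kernels at \<open>\<zeta> m\<close> and at its image.\<close>
    have big: "sqrt \<epsilon> * norm (\<kappa> m) \<le> norm (k m)" for m
    proof (rule power2_le_imp_le)
      have "0 < 1 - (norm (\<zeta> m))\<^sup>2" "0 < 1 - (norm (\<phi>pt (\<zeta> m)))\<^sup>2"
        using \<zeta>(2)[of m] npt[of m] by (simp_all add: abs_square_less_1)
      then have "\<epsilon> / (1 - (norm (\<zeta> m))\<^sup>2) \<le> 1 / (1 - (norm (\<phi>pt (\<zeta> m)))\<^sup>2)"
        using \<zeta>(3)[of m] by (simp add: field_simps)
      then show "(sqrt \<epsilon> * norm (\<kappa> m))\<^sup>2 \<le> (norm (k m))\<^sup>2"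
        using \<epsilon> by (simp add: power_mult_distrib \<kappa>_def k_def norm_kernel_vec[OF \<zeta>(2)] norm_kernel_vec[OF npt])
    qed simp
    have "(\<lambda>m. cinner (h2_vec g) (\<kappa> m) / norm (\<kappa> m)) \<longlonglongrightarrow> 0"
      unfolding \<kappa>_def h2_vec_def by (rule kernel_vec_weakly_null[OF \<zeta>(2) lim\<zeta> H2_square_summable[OF g]])
    from LIMSEQ_subseq_LIMSEQ[OF this r]
    have l1: "(\<lambda>m. cinner (h2_vec g) (\<kappa> (r m)) / norm (\<kappa> (r m))) \<longlonglongrightarrow> 0" by (simp add: o_def)
    have l2: "(\<lambda>m. norm (h2_vec (composition_op \<phi> (f (r m))) - h2_vec g)) \<longlonglongrightarrow> 0"
      using lim by (simp add: tendsto_norm_zero LIM_zero)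
    \<comment> \<open>The images converge in norm and the normalised kernels are weakly null, so
      both terms on the right tend to 0.\<close>
    have "sqrt \<epsilon> \<le> norm (h2_vec (composition_op \<phi> (f (r m))) - h2_vec g) +
        norm (cinner (h2_vec g) (\<kappa> (r m)) / norm (\<kappa> (r m)))" for m
    proof -
      let ?v = "h2_vec (composition_op \<phi> (f (r m)))" and ?\<kappa> = "\<kappa> (r m)"
      have "sqrt \<epsilon> * norm ?\<kappa> \<le> cmod (cinner ?v ?\<kappa>)" using big[of "r m"] by (simp add: pair)
      also have "cinner ?v ?\<kappa> = cinner (?v - h2_vec g) ?\<kappa> + cinner (h2_vec g) ?\<kappa>" by (simp add: cinner_diff_left)
      also have "cmod \<dots> \<le> norm (?v - h2_vec g) * norm ?\<kappa> + cmod (cinner (h2_vec g) ?\<kappa>)"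
        by (rule order_trans[OF norm_triangle_ineq]) (simp add: cinner_norm_le)
      finally have "sqrt \<epsilon> * norm ?\<kappa> \<le> norm (?v - h2_vec g) * norm ?\<kappa> + cmod (cinner (h2_vec g) ?\<kappa>)" .
      then have "sqrt \<epsilon> \<le> (norm (?v - h2_vec g) * norm ?\<kappa> + cmod (cinner (h2_vec g) ?\<kappa>)) / norm ?\<kappa>"
        using \<kappa>_pos[of "r m"] by (simp add: pos_le_divide_eq)
      then show ?thesis using \<kappa>_pos[of "r m"] by (simp add: add_divide_distrib norm_divide)
    qed
    then have "sqrt \<epsilon> \<le> 0 + 0"
      by (intro tendsto_lowerbound[OF tendsto_add[OF l2 tendsto_norm_zero[OF l1]]]) auto
    then show False using \<epsilon> by simp
  qed
  then show ?thesis using that by blast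
qed

text \<open>The ratio estimate moves the sphere of radius \<open>r\<close> inwards but says nothing
  about its interior, so Brouwer's theorem is applied to \<open>\<phi>pt\<close> followed by the
  radial retraction onto the ball. A fixed point at which the retraction really acts would lie on
  the sphere and have its image outside, against \<open>inward\<close>.\<close>

lemma fixed_point_ex: "\<exists>\<xi>. norm \<xi> < 1 \<and> \<phi>pt \<xi> = \<xi>"
proof -
  obtain r0 where r0: "0 \<le> r0" "r0 < 1"
    "\<And>\<zeta>. r0 \<le> norm \<zeta> \<Longrightarrow> norm \<zeta> < 1 \<Longrightarrow> 1 - (norm \<zeta>)\<^sup>2 \<le> 1 / 2 * (1 - (norm (\<phi>pt \<zeta>))\<^sup>2)"
    using boundary_ratio[of "1 / 2"] by auto
  \<comment> \<open>The value one half keeps the radius positive when \<open>r0 = 0\<close>.\<close>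
  define r where "r = max r0 (1 / 2)"
  have r: "0 < r" "r < 1" "r0 \<le> r" using r0 by (auto simp: r_def)
  have inward: "norm (\<phi>pt \<zeta>) < norm \<zeta>" if "norm \<zeta> = r" for \<zeta>
  proof -
    have "norm (\<phi>pt \<zeta>) < 1" using norm_\<phi>pt that r by auto
    then have "0 < 1 - (norm (\<phi>pt \<zeta>))\<^sup>2" by (simp add: abs_square_less_1)
    then have "(norm (\<phi>pt \<zeta>))\<^sup>2 < (norm \<zeta>)\<^sup>2" using r0(3)[of \<zeta>] that r by simp
    then show ?thesis by (simp add: power2_less_imp_less)
  qed
  define G where "G \<zeta> = (r / max r (norm (\<phi>pt \<zeta>))) *\<^sub>R \<phi>pt \<zeta>" for \<zeta>
  have "continuous_on (cball 0 r) G"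
    unfolding G_def
    by (intro continuous_intros continuous_on_scalar_map[OF power_series_\<phi>] r) (use r in auto)
  moreover have "G \<in> cball 0 r \<rightarrow> cball 0 r"
  proof
    fix \<zeta> :: "complex ^ 'n"
    have m: "0 < max r (norm (\<phi>pt \<zeta>))" "norm (\<phi>pt \<zeta>) \<le> max r (norm (\<phi>pt \<zeta>))" using r by auto
    have "norm (G \<zeta>) = r * norm (\<phi>pt \<zeta>) / max r (norm (\<phi>pt \<zeta>))" using m(1) r by (simp add: G_def)
    also have "\<dots> \<le> r" using m r by (simp add: pos_divide_le_eq)
    finally show "G \<zeta> \<in> cball 0 r" by simp
  qed
  ultimately obtain x where x: "x \<in> cball 0 r" "G x = x"
    using brouwer_ball[OF r(1)] by blast
  have "norm (\<phi>pt x) \<le> r"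
  proof (rule ccontr)
    assume "\<not> norm (\<phi>pt x) \<le> r"
    then have gt: "r < norm (\<phi>pt x)" by simp
    then have "max r (norm (\<phi>pt x)) = norm (\<phi>pt x)" by simp
    then have "norm x = r" using x(2) gt r unfolding G_def by (smt (verit) abs_of_pos divide_pos_pos nonzero_eq_divide_eq norm_scaleR)
    then show False using inward[of x] gt by simp
  qed
  then have "max r (norm (\<phi>pt x)) = r" by simp
  then have "\<phi>pt x = x" using x(2) r by (simp add: G_def)
  then show ?thesis using x(1) r by (intro exI[of _ x]) auto
qed

end

section \<open>The map centred at its fixed point, and uniqueness\<close>

locale fixed_point = compact_composition e \<phi> + ball_point \<xi>
  for e :: "'n::finite list \<Rightarrow> 'h::complex_hilbert" and \<phi> :: "'h op ^ 'n \<Rightarrow> 'h op ^ 'n" and \<xi> :: "complex ^ 'n" +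
  assumes fixed: "scalar_map \<phi> \<xi> = \<xi>"
begin

definition \<psi> :: "'h op ^ 'n \<Rightarrow> 'h op ^ 'n" where
  "\<psi> = ball_aut \<xi> \<circ> \<phi> \<circ> ball_aut \<xi>"

lemma \<psi>_maps_ball: "X \<in> nc_ball \<Longrightarrow> \<psi> X \<in> nc_ball"
  by (simp add: \<psi>_def ball_aut_in_nc_ball maps_ball)

lemma power_series_\<psi>_ex: "\<exists>q. \<forall>i. power_series (\<lambda>X. \<psi> X $ i) (q i)"
proof -
  obtain b where b: "\<And>i. power_series (\<lambda>X. ball_aut \<xi> X $ i :: 'h op) (b i)"
    using power_series_ball_aut_ex by blast
  have "\<exists>q. power_series (\<lambda>X. \<phi> (ball_aut \<xi> X) $ i) q" for i
    using power_series_comp[OF power_series_\<phi>[of i], of "ball_aut \<xi>" b, OF b ball_aut_in_nc_ball] by blast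
  then obtain q where q: "\<And>i. power_series (\<lambda>X. \<phi> (ball_aut \<xi> X) $ i) (q i)" by metis
  have "\<exists>q'. power_series (\<lambda>X. \<psi> X $ i) q'" for i
    using power_series_comp[OF b[of i], of "\<lambda>X. \<phi> (ball_aut \<xi> X)" q, OF q] maps_ball ball_aut_in_nc_ball
    by (auto simp: \<psi>_def)
  then show ?thesis by metis
qed

definition q :: "'n \<Rightarrow> 'n list \<Rightarrow> complex" where
  "q i = fh_coeff (\<lambda>X. \<psi> X $ i)"

lemma power_series_\<psi>: "power_series (\<lambda>X. \<psi> X $ i) (q i)"
proof -
  obtain q' where q': "\<And>i. power_series (\<lambda>X. \<psi> X $ i) (q' i)" using power_series_\<psi>_ex by blast
  then show ?thesis by (simp add: q_def fh_coeff_eq[OF q'])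
qed

lemma aut_pt_involution: "norm \<zeta> < 1 \<Longrightarrow> aut_pt (aut_pt \<zeta>) = \<zeta>"
proof (rule scalar_tuple_inj[OF e_nonzero[of "[]"]])
  assume \<zeta>: "norm \<zeta> < 1"
  have "ball_aut \<xi> (ball_aut \<xi> (scalar_tuple \<zeta> :: 'h op ^ 'n)) = scalar_tuple \<zeta>"
    by (rule ball_aut_involution[OF scalar_tuple_in_nc_ball[OF \<zeta>]])
  then show "scalar_tuple (aut_pt (aut_pt \<zeta>)) = (scalar_tuple \<zeta> :: 'h op ^ 'n)"
    by (simp add: ball_aut_scalar_tuple \<zeta> aut_pt_in_ball)
qed

lemma \<psi>pt: "norm \<zeta> < 1 \<Longrightarrow> scalar_map \<psi> \<zeta> = aut_pt (\<phi>pt (aut_pt \<zeta>))"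
proof (rule scalar_tuple_inj[OF e_nonzero[of "[]"]])
  assume \<zeta>: "norm \<zeta> < 1"
  have "scalar_tuple (scalar_map \<psi> \<zeta>) = \<psi> (scalar_tuple \<zeta>)"
    by (rule selfmap_scalar_tuple[OF power_series_\<psi> \<zeta>, symmetric])
  also have "\<dots> = scalar_tuple (aut_pt (\<phi>pt (aut_pt \<zeta>)))"
    by (simp add: \<psi>_def ball_aut_scalar_tuple \<zeta> aut_pt_in_ball \<phi>_scalar_tuple norm_\<phi>pt)
  finally show "scalar_tuple (scalar_map \<psi> \<zeta>) = (scalar_tuple (aut_pt (\<phi>pt (aut_pt \<zeta>))) :: 'h op ^ 'n)" .
qed

lemma \<psi>_zero: "\<psi> 0 = 0"
proof -
  have "aut_pt \<xi> = 0" using aut_pt_involution[of 0] by (simp add: aut_pt_0)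
  then have "scalar_map \<psi> 0 = 0" by (simp add: \<psi>pt aut_pt_0 fixed)
  then show ?thesis using selfmap_scalar_tuple[OF power_series_\<psi>, of 0] by simp
qed

text \<open>By the Schwarz lemma a second fixed point would make the slice of \<open>\<psi>\<close> through it isometric,
  which bounds the boundary ratio from below.\<close>

lemma fixed_point_unique:
  assumes \<eta>: "norm \<eta> < 1" "\<phi>pt \<eta> = \<eta>"
  shows "\<eta> = \<xi>"
proof (rule ccontr)
  assume "\<eta> \<noteq> \<xi>"
  define w where "w = aut_pt \<eta>"
  have w: "norm w < 1" unfolding w_def by (rule aut_pt_in_ball[OF \<eta>(1)])
  have "aut_pt w = \<eta>" unfolding w_def by (rule aut_pt_involution[OF \<eta>(1)])
  then have "w \<noteq> 0" using \<open>\<eta> \<noteq> \<xi>\<close> aut_pt_0 by auto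
  have \<psi>w: "scalar_map \<psi> w = w" using \<open>aut_pt w = \<eta>\<close> by (simp add: \<psi>pt w \<eta>(2)) (simp add: w_def)
  define v where "v = (1 / norm w) *\<^sub>R w"
  have v_nth: "v $ i = of_real (1 / norm w) * w $ i" for i
    unfolding v_def vector_scaleR_component by (rule scaleR_conv_of_real)
  have v: "norm v = 1" using \<open>w \<noteq> 0\<close> by (simp add: v_def)
  have tv: "norm (t *s v) = cmod t" for t
  proof -
    have "(norm (t *s v))\<^sup>2 = (cmod t)\<^sup>2 * (norm v)\<^sup>2"
      by (simp add: norm_vec_power2 norm_mult power_mult_distrib sum_distrib_left)
    then show ?thesis by (simp add: v)
  qed
  \<comment> \<open>Component along \<open>v\<close> of \<open>\<psi>\<close> on the disc through
    \<open>w\<close>. It maps the unit disc into itself, fixes 0 and has modulus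
    \<open>norm w\<close> at \<open>norm w\<close>, so the equality case of the Schwarz lemma makes
    it a rotation.\<close>
  define g where "g t = (\<Sum>i\<in>UNIV. cnj (v $ i) * scalar_map \<psi> (t *s v) $ i)" for t
  have g_le: "cmod (g t) \<le> norm (scalar_map \<psi> (t *s v))" for t
  proof -
    have "cmod (g t) \<le> (\<Sum>j\<in>UNIV. cmod (v $ j) * cmod (scalar_map \<psi> (t *s v) $ j))"
      unfolding g_def by (intro sum_norm_le) (simp add: norm_mult)
    also have "\<dots> \<le> norm v * norm (scalar_map \<psi> (t *s v))"
      using L2_set_mult_ineq[of "\<lambda>i. cmod (v $ i)" "\<lambda>i. cmod (scalar_map \<psi> (t *s v) $ i)" UNIV]
      by (simp add: norm_vec_def)
    finally show ?thesis by (simp add: v)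
  qed
  have \<psi>_lt: "norm (scalar_map \<psi> (t *s v)) < 1" if "cmod t < 1" for t
    by (rule selfmap_scalar_map_norm[OF power_series_\<psi> \<psi>_maps_ball]) (use that tv in auto)
  have "(\<lambda>t. scalar_map \<psi> (t *s v) $ i) holomorphic_on ball 0 1" for i
  proof (rule power_series_holomorphic[of _ _ "\<lambda>k. \<Sum>\<alpha> | length \<alpha> = k. q i \<alpha> * word_val v \<alpha>"])
    fix t :: complex assume "t \<in> ball 0 1"
    then have t: "norm (t *s v) < 1" by (simp add: tv)
    have wv: "word_val (t *s v) \<alpha> = t ^ length \<alpha> * word_val v \<alpha>" for \<alpha>
      by (induction \<alpha>) (auto simp: mult_ac)
    have "(\<Sum>\<alpha> | length \<alpha> = k. q i \<alpha> * word_val (t *s v) \<alpha>) = (\<Sum>\<alpha> | length \<alpha> = k. q i \<alpha> * word_val v \<alpha>) * t ^ k" for k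
      unfolding sum_distrib_right by (intro sum.cong) (auto simp: wv mult_ac)
    then show "(\<lambda>k. (\<Sum>\<alpha> | length \<alpha> = k. q i \<alpha> * word_val v \<alpha>) * (t - 0) ^ k) sums scalar_map \<psi> (t *s v) $ i"
      using power_series_scalar_value(1)[OF power_series_\<psi> t, of i] by (simp add: scalar_map_def)
  qed
  then have hol: "g holomorphic_on ball 0 1" unfolding g_def by (intro holomorphic_intros) auto
  have "g 0 = 0"
  proof -
    have "scalar_map \<psi> 0 = 0" by (simp add: scalar_map_def \<psi>_zero vec_eq_iff) (simp add: scalar_value_def)
    then show ?thesis by (simp add: g_def)
  qed
  have g_lt: "cmod (g t) < 1" if "cmod t < 1" for t using g_le[of t] \<psi>_lt[OF that] by simp
  have "of_real (norm w) *s v = w" using \<open>w \<noteq> 0\<close> by (simp add: vec_eq_iff v_nth)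
  then have "g (of_real (norm w)) = (\<Sum>i\<in>UNIV. cnj (v $ i) * w $ i)" by (simp add: g_def \<psi>w)
  also have "\<dots> = of_real (norm w)"
  proof -
    have "(\<Sum>i\<in>UNIV. cnj (v $ i) * w $ i) = of_real (1 / norm w) * (\<Sum>i\<in>UNIV. cnj (w $ i) * w $ i)"
      by (simp add: v_nth sum_distrib_left mult.assoc)
    then show ?thesis using \<open>w \<noteq> 0\<close> by (simp add: sum_cnj_mult_self power2_eq_square)
  qed
  finally have "\<exists>z. norm z < 1 \<and> z \<noteq> 0 \<and> norm (g z) = norm z"
    using w \<open>w \<noteq> 0\<close> by (intro exI[of _ "of_real (norm w)"]) simp
  then obtain a where a: "\<And>z. norm z < 1 \<Longrightarrow> g z = a * z" "norm a = 1"
    using Schwarz_Lemma(3)[OF hol \<open>g 0 = 0\<close> g_lt, of 0] by auto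
  have \<psi>_ge: "cmod t \<le> norm (scalar_map \<psi> (t *s v))" if "cmod t < 1" for t
    using g_le[of t] a(1)[OF that] a(2) by (simp add: norm_mult)
  \<comment> \<open>The squared denominators in \<open>aut_pt_norm\<close> lie between
    \<open>(1 - norm \<xi>)\<^sup>2\<close> and 4. Their quotient bounds the distortion of the
    boundary ratio by the automorphism, and along the slice that ratio is at least 1 for
    \<open>\<psi>\<close>. The estimate with \<open>c0 / 2\<close> then contradicts it.\<close>
  define c0 where "c0 = (1 - norm \<xi>)\<^sup>2 / 4"
  have \<xi>1: "0 < 1 - norm \<xi>" using norm_less_1 by simp
  have c0: "0 < c0" using \<xi>1 by (simp add: c0_def)
  obtain r where r: "0 \<le> r" "r < 1"
    "\<And>\<zeta>. r \<le> norm \<zeta> \<Longrightarrow> norm \<zeta> < 1 \<Longrightarrow> 1 - (norm \<zeta>)\<^sup>2 \<le> c0 / 2 * (1 - (norm (\<phi>pt \<zeta>))\<^sup>2)"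
    using boundary_ratio[of "c0 / 2"] c0 by auto
  \<comment> \<open>Small enough to give \<open>r \<le> norm \<zeta>\<close>: the factor
    \<open>(1 - norm \<xi>)\<^sup>2\<close> compensates the denominator in
    \<open>aut_pt_norm\<close>.\<close>
  define \<delta> where "\<delta> = (1 - r\<^sup>2) * (1 - norm \<xi>)\<^sup>2"
  have r2: "0 < 1 - r\<^sup>2" "1 - r\<^sup>2 \<le> 1" using r by (auto simp: abs_square_less_1)
  have x2: "(1 - norm \<xi>)\<^sup>2 \<le> 1" using \<xi>1 by (simp add: power_le_one)
  have \<delta>: "0 < \<delta>" "\<delta> \<le> 1"
    using r2 \<xi>1 mult_mono[OF r2(2) x2] by (auto simp: \<delta>_def)
  define t where "t = complex_of_real (sqrt (1 - \<delta>))"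
  have t2: "(cmod t)\<^sup>2 = 1 - \<delta>" using \<delta> by (simp add: t_def)
  have t1: "cmod t < 1" using \<delta> by (simp add: t_def)
  define \<zeta> where "\<zeta> = aut_pt (t *s v)"
  have tv1: "norm (t *s v) < 1" using t1 tv by simp
  have \<zeta>1: "norm \<zeta> < 1" unfolding \<zeta>_def by (rule aut_pt_in_ball[OF tv1])
  have \<phi>\<zeta>: "\<phi>pt \<zeta> = aut_pt (scalar_map \<psi> (t *s v))"
    unfolding \<psi>pt[OF tv1] \<zeta>_def[symmetric] by (rule aut_pt_involution[symmetric, OF norm_\<phi>pt[OF _ \<zeta>1]])
  define d1 where "d1 = (cmod (1 - (\<Sum>i\<in>UNIV. cnj (\<xi> $ i) * (t *s v) $ i)))\<^sup>2"
  define d2 where "d2 = (cmod (1 - (\<Sum>i\<in>UNIV. cnj (\<xi> $ i) * (scalar_map \<psi> (t *s v)) $ i)))\<^sup>2"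
  have d1: "(1 - norm \<xi>)\<^sup>2 \<le> d1" "d1 \<le> 4"
    using power_mono[OF pairing_bounds(1)[OF tv1], of 2] power_mono[OF pairing_bounds(2)[OF tv1], of 2] \<xi>1
    by (auto simp: d1_def)
  have d2: "(1 - norm \<xi>)\<^sup>2 \<le> d2"
    using power_mono[OF pairing_bounds(1)[OF \<psi>_lt[OF t1]], of 2] \<xi>1 by (auto simp: d2_def)
  have x2pos: "0 < (1 - norm \<xi>)\<^sup>2" using \<xi>1 by simp
  have pos: "0 < d1" "0 < d2" using x2pos d1(1) d2 by linarith+
  have e1: "1 - (norm \<zeta>)\<^sup>2 = s\<^sup>2 * \<delta> / d1"
    unfolding \<zeta>_def aut_pt_norm[OF tv1] d1_def by (simp add: tv t2)
  have e2: "1 - (norm (\<phi>pt \<zeta>))\<^sup>2 = s\<^sup>2 * (1 - (norm (scalar_map \<psi> (t *s v)))\<^sup>2) / d2"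
    unfolding \<phi>\<zeta> aut_pt_norm[OF \<psi>_lt[OF t1]] d2_def ..
  have "(cmod t)\<^sup>2 \<le> (norm (scalar_map \<psi> (t *s v)))\<^sup>2" by (intro power_mono \<psi>_ge t1) simp
  then have "1 - (norm (scalar_map \<psi> (t *s v)))\<^sup>2 \<le> \<delta>" using t2 by simp
  then have "1 - (norm (\<phi>pt \<zeta>))\<^sup>2 \<le> s\<^sup>2 * \<delta> / d2"
    unfolding e2 using less_le_trans[OF x2pos d2] by (intro divide_right_mono mult_left_mono) auto
  also have "\<dots> \<le> s\<^sup>2 * \<delta> / (1 - norm \<xi>)\<^sup>2"
    by (rule divide_left_mono[OF d2]) (use \<delta> pos x2pos in auto)
  finally have "c0 * (1 - (norm (\<phi>pt \<zeta>))\<^sup>2) \<le> c0 * (s\<^sup>2 * \<delta> / (1 - norm \<xi>)\<^sup>2)"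
    using c0 by (intro mult_left_mono) auto
  also have "\<dots> = s\<^sup>2 * \<delta> / 4" using x2pos by (simp add: c0_def)
  also have "\<dots> \<le> 1 - (norm \<zeta>)\<^sup>2"
    unfolding e1 by (rule divide_left_mono[OF d1(2)]) (use \<delta> pos(1) in simp_all)
  finally have lower: "c0 * (1 - (norm (\<phi>pt \<zeta>))\<^sup>2) \<le> 1 - (norm \<zeta>)\<^sup>2" .
  have "1 - (norm \<zeta>)\<^sup>2 \<le> s\<^sup>2 * \<delta> / (1 - norm \<xi>)\<^sup>2"
    unfolding e1 by (rule divide_left_mono[OF d1(1)]) (use \<delta> mult_pos_pos[OF pos(1) x2pos] in \<open>simp_all del: zero_less_power2\<close>)
  also have "\<dots> = s\<^sup>2 * (1 - r\<^sup>2)" using x2pos by (simp add: \<delta>_def)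
  also have "\<dots> \<le> 1 * (1 - r\<^sup>2)" using s_pos s_le_1 r2 by (intro mult_right_mono) (auto simp: power_le_one)
  finally have "r\<^sup>2 \<le> (norm \<zeta>)\<^sup>2" by simp
  then have "r \<le> norm \<zeta>" by (rule power2_le_imp_le) simp
  then have "1 - (norm \<zeta>)\<^sup>2 \<le> c0 / 2 * (1 - (norm (\<phi>pt \<zeta>))\<^sup>2)" by (rule r(3)[OF _ \<zeta>1])
  moreover have "0 < 1 - (norm (\<phi>pt \<zeta>))\<^sup>2" using norm_\<phi>pt[OF _ \<zeta>1] by (simp add: abs_square_less_1)
  ultimately have "c0 * (1 - (norm (\<phi>pt \<zeta>))\<^sup>2) \<le> c0 / 2 * (1 - (norm (\<phi>pt \<zeta>))\<^sup>2)"
    using lower by simp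
  moreover have "0 < c0 * (1 - (norm (\<phi>pt \<zeta>))\<^sup>2)" using c0 \<open>0 < 1 - (norm (\<phi>pt \<zeta>))\<^sup>2\<close> by simp
  ultimately show False by simp
qed

end

section \<open>Eigenvalues of tensor powers\<close>

text \<open>Entries of the tensor powers of \<open>A\<close>, with rows and columns indexed by words
  of equal length.\<close>

definition tensor_entry :: "complex ^ 'n ^ 'n \<Rightarrow> 'n list \<Rightarrow> 'n list \<Rightarrow> complex" where
  "tensor_entry A \<alpha> \<beta> = prod_list (map2 (\<lambda>i j. A $ i $ j) \<alpha> \<beta>)"

lemma tensor_entry_simps [simp]:
  "tensor_entry A [] \<beta> = 1"
  "tensor_entry A (i # \<alpha>) (j # \<beta>) = A $ i $ j * tensor_entry A \<alpha> \<beta>"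
  by (simp_all add: tensor_entry_def)

lemma eigenvalues_iff_not_invertible:
  "c \<in> eigenvalues A \<longleftrightarrow> \<not> invertible (A - mat c)"
proof -
  have "(A - mat c) *v v = A *v v - c *s v" for v
    by (simp add: matrix_vector_mult_diff_rdistrib)
      (simp add: matrix_vector_mult_def mat_def vec_eq_iff if_distrib[of "\<lambda>x. x * _"] cong: if_cong)
  then have "c \<in> eigenvalues A \<longleftrightarrow> \<not> (\<forall>v. (A - mat c) *v v = 0 \<longrightarrow> v = 0)"
    by (auto simp: eigenvalues_def)
  then show ?thesis by (simp add: matrix_left_invertible_ker[symmetric] invertible_left_inverse)
qed

lemma eigenvalues_transpose: "eigenvalues (transpose A) = eigenvalues A"
proof -
  have "transpose A - mat c = transpose (A - mat c)" for c
    by (simp add: vec_eq_iff transpose_def mat_def)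
  then show ?thesis
    by (auto simp: eigenvalues_iff_not_invertible invertible_det_nz det_transpose)
qed

text \<open>A matrix and its transpose have the same eigenvalues. The left-sided form is the one
  that occurs, since families of coefficients are multiplied by \<open>A\<close> from the
  right.\<close>

lemma left_eigenvector_imp_eigenvalue:
  fixes A :: "complex ^ 'n::finite ^ 'n"
  assumes "v i \<noteq> 0" "\<And>j. (\<Sum>i\<in>UNIV. v i * A $ i $ j) = c * v j"
  shows "c \<in> eigenvalues A"
proof -
  define w where "w = (\<chi> i. v i)"
  have "w \<noteq> 0" using assms(1) by (auto simp: w_def vec_eq_iff)
  moreover have "transpose A *v w = c *s w"
    using assms(2) by (simp add: vec_eq_iff w_def matrix_vector_mult_def transpose_def mult.commute)
  ultimately have "c \<in> eigenvalues (transpose A)" unfolding eigenvalues_def by blast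
  then show ?thesis by (simp add: eigenvalues_transpose)
qed

section \<open>Annihilating polynomials and eigenvectors\<close>

primrec mat_pow :: "complex ^ 'n::finite ^ 'n \<Rightarrow> nat \<Rightarrow> complex ^ 'n ^ 'n" where
  "mat_pow A 0 = mat 1"
| "mat_pow A (Suc k) = mat_pow A k ** A"

lemma annihilating_polynomial_ex:
  fixes A :: "complex ^ 'n::finite ^ 'n"
  obtains p :: "complex poly" where "p \<noteq> 0" "\<And>i j. (\<Sum>k\<le>degree p. coeff p k * mat_pow A k $ i $ j) = 0"
proof -
  define d where "d = DIM(complex ^ 'n ^ 'n)"
  have "\<exists>u :: nat \<Rightarrow> real. (\<exists>k\<le>d. u k \<noteq> 0) \<and> (\<Sum>k\<le>d. u k *\<^sub>R mat_pow A k) = 0"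
  \<comment> \<open>\<open>dependent\<close> speaks of a set of vectors; if two powers coincide,
    their difference gives the linear relation instead.\<close>
  proof (cases "inj_on (mat_pow A) {..d}")
    case True
    then have "card (mat_pow A ` {..d}) = Suc d" by (simp add: card_image)
    then have "dependent (mat_pow A ` {..d})" by (intro dependent_biggerset) (simp_all add: d_def)
    then obtain u where u: "\<exists>v\<in>mat_pow A ` {..d}. u v \<noteq> 0" "(\<Sum>v\<in>mat_pow A ` {..d}. u v *\<^sub>R v) = 0"
      using dependent_finite[of "mat_pow A ` {..d}"] by auto
    then show ?thesis
      by (intro exI[of _ "\<lambda>k. u (mat_pow A k)"]) (auto simp: sum.reindex[OF True])
  next
    case False
    then obtain k l where kl: "k \<le> d" "l \<le> d" "k \<noteq> l" "mat_pow A k = mat_pow A l" by (auto simp: inj_on_def)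
    define u where "u m = (if m = k then 1 else if m = l then -1 else 0 :: real)" for m
    have "(\<Sum>m\<le>d. u m *\<^sub>R mat_pow A m) = (\<Sum>m\<in>{k, l}. u m *\<^sub>R mat_pow A m)"
      by (rule sum.mono_neutral_right) (use kl in \<open>auto simp: u_def\<close>)
    also have "\<dots> = 0" using kl by (simp add: u_def)
    finally show ?thesis using kl(1) by (intro exI[of _ u]) (auto simp: u_def)
  qed
  then obtain u :: "nat \<Rightarrow> real" and m where u: "m \<le> d" "u m \<noteq> 0" "(\<Sum>k\<le>d. u k *\<^sub>R mat_pow A k) = 0" by blast
  define p where "p = (\<Sum>k\<le>d. monom (complex_of_real (u k)) k)"
  have c: "coeff p k = (if k \<le> d then of_real (u k) else 0)" for k
    by (simp add: p_def coeff_sum)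
  have "p \<noteq> 0" using u(1,2) c[of m] by auto
  moreover have "(\<Sum>k\<le>degree p. coeff p k * mat_pow A k $ i $ j) = 0" for i j
  proof -
    have "degree p \<le> d" by (rule degree_le) (simp add: c)
    then have "(\<Sum>k\<le>degree p. coeff p k * mat_pow A k $ i $ j) = (\<Sum>k\<le>d. coeff p k * mat_pow A k $ i $ j)"
      by (intro sum.mono_neutral_left) (auto simp: coeff_eq_0)
    also have "\<dots> = (\<Sum>k\<le>d. u k *\<^sub>R mat_pow A k) $ i $ j"
    proof -
      have "(u k *\<^sub>R mat_pow A k) $ i $ j = of_real (u k) * mat_pow A k $ i $ j" for k
        unfolding vector_scaleR_component by (rule scaleR_conv_of_real)
      then show ?thesis unfolding sum_component by (simp only: c) simp
    qed
    finally show ?thesis using u(3) by simp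
  qed
  ultimately show ?thesis by (rule that)
qed

text \<open>Factor the annihilating polynomial as a linear factor with root \<open>r\<close> times
  \<open>q\<close>. Either \<open>c\<close> is an eigenvector for \<open>r\<close>, or
  \<open>N c - r c\<close> is a nonzero function with property \<open>P\<close> that is annihilated
  by \<open>q\<close>, which has smaller degree.\<close>

lemma eigenvector_in_invariant_set:
  fixes N :: "('b \<Rightarrow> complex) \<Rightarrow> 'b \<Rightarrow> complex" and p :: "complex poly"
  assumes add: "\<And>x y. N (\<lambda>t. x t + y t) = (\<lambda>t. N x t + N y t)"
    and scale: "\<And>a x. N (\<lambda>t. a * x t) = (\<lambda>t. a * N x t)"
    and inv: "\<And>x r. P x \<Longrightarrow> P (\<lambda>t. N x t - r * x t)"
    and "p \<noteq> 0" "P c" "c \<noteq> (\<lambda>t. 0)" "\<And>t. (\<Sum>k\<le>degree p. coeff p k * (N ^^ k) c t) = 0"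
  shows "\<exists>r d. P d \<and> d \<noteq> (\<lambda>t. 0) \<and> N d = (\<lambda>t. r * d t)"
  using assms(4-)
proof (induction "degree p" arbitrary: p c)
  case 0
  obtain t where "c t \<noteq> 0" using 0(4) by blast
  have "coeff p 0 \<noteq> 0" using 0(1,2) by (metis leading_coeff_0_iff)
  then show ?case using 0(5)[of t] \<open>c t \<noteq> 0\<close> 0(1)[symmetric] by simp
next
  case (Suc n)
  have "degree p > 0" using Suc(2) by simp
  from alg_closed_imp_poly_has_root[OF this] obtain r where "poly p r = 0" ..
  then obtain q where q: "p = [:- r, 1:] * q" by (auto simp: poly_eq_0_iff_dvd)
  have "q \<noteq> 0" using q \<open>p \<noteq> 0\<close> by auto
  then have "degree p = Suc (degree q)" unfolding q by (subst degree_mult_eq) auto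
  then have dq: "n = degree q" using Suc(2) by simp
  define c' where "c' = (\<lambda>t. N c t - r * c t)"
  have Nk: "(N ^^ k) (\<lambda>t. x t - a * y t) = (\<lambda>t. (N ^^ k) x t - a * (N ^^ k) y t)" for k x a y
  proof (induction k)
    case (Suc k)
    have "N (\<lambda>t. u t - a * v t) = (\<lambda>t. N u t - a * N v t)" for u v
      using add[of u "\<lambda>t. - a * v t"] scale[of "- a" v] by simp
    then show ?case by (simp add: Suc)
  qed simp
  have cp: "coeff p k = (if k = 0 then 0 else coeff q (k - 1)) - r * coeff q k" for k
    by (cases k) (simp_all add: q coeff_pCons)
  have "(\<Sum>k\<le>degree q. coeff q k * (N ^^ k) c' t) = (\<Sum>k\<le>degree p. coeff p k * (N ^^ k) c t)" for t
  proof -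
    have 1: "(\<Sum>k\<le>degree p. (if k = 0 then 0 else coeff q (k - 1)) * (N ^^ k) c t) =
        (\<Sum>k\<le>degree q. coeff q k * (N ^^ Suc k) c t)"
      unfolding \<open>degree p = Suc (degree q)\<close> by (subst sum.atMost_Suc_shift) simp
    have 2: "(\<Sum>k\<le>degree p. coeff q k * (N ^^ k) c t) = (\<Sum>k\<le>degree q. coeff q k * (N ^^ k) c t)"
      unfolding \<open>degree p = Suc (degree q)\<close> by (simp add: coeff_eq_0)
    have "(\<Sum>k\<le>degree p. coeff p k * (N ^^ k) c t) =
        (\<Sum>k\<le>degree p. (if k = 0 then 0 else coeff q (k - 1)) * (N ^^ k) c t) -
        r * (\<Sum>k\<le>degree p. coeff q k * (N ^^ k) c t)"
      unfolding cp by (simp add: left_diff_distrib sum_subtractf sum_distrib_left mult.assoc)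
    also have "\<dots> = (\<Sum>k\<le>degree q. coeff q k * ((N ^^ k) (N c) t - r * (N ^^ k) c t))"
      unfolding 1 2 by (simp add: sum_subtractf sum_distrib_left right_diff_distrib funpow_swap1 mult_ac)
    finally show ?thesis by (simp add: c'_def Nk)
  qed
  then have zero: "(\<Sum>k\<le>degree q. coeff q k * (N ^^ k) c' t) = 0" for t using Suc(6) by simp
  show ?case
  proof (cases "c' = (\<lambda>t. 0)")
    case True
    then have "N c = (\<lambda>t. r * c t)" by (simp add: c'_def fun_eq_iff)
    then show ?thesis using Suc(4,5) by blast
  next
    case False
    show ?thesis
      by (rule Suc(1)[OF dq \<open>q \<noteq> 0\<close> _ False zero]) (simp add: c'_def inv Suc(4))
  qed
qed

text \<open>The operator acting on the first letter only commutes with the tensor power and is annihilated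
  by a polynomial, so it has an eigenvector inside the eigenspace; this splits off one eigenvalue.\<close>

lemma tensor_eigenvalue_imp_product:
  fixes A :: "complex ^ 'n::finite ^ 'n"
  assumes "z \<noteq> 0" "length \<alpha>0 = k" "c \<alpha>0 \<noteq> 0"
    and "\<And>\<beta>. length \<beta> = k \<Longrightarrow> (\<Sum>\<alpha> | length \<alpha> = k. c \<alpha> * tensor_entry A \<alpha> \<beta>) = z * c \<beta>"
  shows "\<exists>cs. length cs = k \<and> set cs \<subseteq> eigenvalues A \<and> z = prod_list cs"
  using assms
proof (induction k arbitrary: z c \<alpha>0)
  case 0
  then have "z = 1" using "0"(4)[of "[]"] by simp
  then show ?case by (intro exI[of _ "[]"]) simp
next
  case (Suc k)
  define N :: "('n list \<Rightarrow> complex) \<Rightarrow> 'n list \<Rightarrow> complex" where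
    "N x \<beta> = (case \<beta> of [] \<Rightarrow> 0 | i # \<alpha> \<Rightarrow> \<Sum>j\<in>UNIV. x (j # \<alpha>) * A $ j $ i)" for x \<beta>
  \<comment> \<open>The left eigenspace of the tensor power for \<open>z\<close>. The support
    condition ensures that a nonzero element has a nonzero value at a word of length
    \<open>Suc k\<close>.\<close>
  define P where "P x \<longleftrightarrow> (\<forall>\<beta>. length \<beta> \<noteq> Suc k \<longrightarrow> x \<beta> = 0) \<and>
      (\<forall>\<beta>. length \<beta> = Suc k \<longrightarrow> (\<Sum>\<alpha> | length \<alpha> = Suc k. x \<alpha> * tensor_entry A \<alpha> \<beta>) = z * x \<beta>)"
    for x :: "'n list \<Rightarrow> complex"
  have N_len: "N x \<beta> = 0" if "P x" "length \<beta> \<noteq> Suc k" for x \<beta>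
    using that by (cases \<beta>) (auto simp: N_def P_def)
  have split: "(\<Sum>\<alpha> | length \<alpha> = Suc k. x \<alpha> * tensor_entry A \<alpha> (i # \<beta>)) =
      (\<Sum>\<alpha> | length \<alpha> = k. N x (i # \<alpha>) * tensor_entry A \<alpha> \<beta>)" for x i \<beta>
    by (simp add: sum_words_Suc N_def sum_distrib_right mult.assoc) (rule sum.swap)
  have comm: "(\<Sum>\<alpha> | length \<alpha> = Suc k. N x \<alpha> * tensor_entry A \<alpha> \<beta>) = z * N x \<beta>"
    if x: "P x" and \<beta>: "length \<beta> = Suc k" for x \<beta>
  proof -
    obtain i \<gamma> where \<gamma>: "\<beta> = i # \<gamma>" "length \<gamma> = k" using \<beta> by (cases \<beta>) auto
    have "(\<Sum>\<alpha> | length \<alpha> = Suc k. N x \<alpha> * tensor_entry A \<alpha> \<beta>) =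
        (\<Sum>j\<in>UNIV. (\<Sum>\<alpha> | length \<alpha> = k. N x (j # \<alpha>) * tensor_entry A \<alpha> \<gamma>) * A $ j $ i)"
      by (simp add: \<gamma>(1) sum_words_Suc sum_distrib_left mult_ac)
    also have "\<dots> = (\<Sum>j\<in>UNIV. z * x (j # \<gamma>) * A $ j $ i)"
      using x \<gamma>(2) by (simp add: split[symmetric] P_def)
    also have "\<dots> = z * N x \<beta>" by (simp add: \<gamma>(1) N_def sum_distrib_left mult.assoc)
    finally show ?thesis .
  qed
  define c0 where "c0 \<beta> = (if length \<beta> = Suc k then c \<beta> else 0)" for \<beta>
  have Pc0: "P c0" using Suc.prems(4) by (simp add: P_def c0_def)
  have c0_ne: "c0 \<noteq> (\<lambda>t. 0)" using Suc.prems(2,3) by (auto simp: c0_def fun_eq_iff)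
  obtain p :: "complex poly" where p: "p \<noteq> 0"
    "\<And>i j. (\<Sum>k\<le>degree p. coeff p k * mat_pow A k $ i $ j) = 0"
    using annihilating_polynomial_ex[of A] by blast
  \<comment> \<open>Powers of \<open>N\<close> act through powers of \<open>A\<close>, so a
    polynomial that annihilates \<open>A\<close> annihilates \<open>N\<close> on words with a first
    letter.\<close>
  have Nk: "(N ^^ m) x (i # \<alpha>) = (\<Sum>j\<in>UNIV. x (j # \<alpha>) * mat_pow A m $ j $ i)" for m x i \<alpha>
  proof (induction m arbitrary: i)
    case 0
    then show ?case by (simp add: mat_def if_distrib[of "(*) _"] cong: if_cong)
  next
    case (Suc m)
    have "(N ^^ Suc m) x (i # \<alpha>) = (\<Sum>l\<in>UNIV. (N ^^ m) x (l # \<alpha>) * A $ l $ i)" by (simp add: N_def)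
    also have "\<dots> = (\<Sum>j\<in>UNIV. \<Sum>l\<in>UNIV. x (j # \<alpha>) * (mat_pow A m $ j $ l * A $ l $ i))"
      by (simp add: Suc sum_distrib_right mult.assoc) (rule sum.swap)
    finally show ?case by (simp add: matrix_matrix_mult_def sum_distrib_left)
  qed
  have ann: "(\<Sum>m\<le>degree p. coeff p m * (N ^^ m) c0 t) = 0" for t
  proof (cases t)
    case Nil
    have "(N ^^ m) c0 [] = 0" for m by (cases m) (auto simp: N_def c0_def)
    then show ?thesis by (simp add: Nil)
  next
    case (Cons i \<alpha>)
    have "(\<Sum>m\<le>degree p. coeff p m * (N ^^ m) c0 t) =
        (\<Sum>j\<in>UNIV. c0 (j # \<alpha>) * (\<Sum>m\<le>degree p. coeff p m * mat_pow A m $ j $ i))"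
      by (simp add: Cons Nk sum_distrib_left mult_ac) (rule sum.swap)
    then show ?thesis by (simp add: p(2))
  qed
  have "\<exists>r d. P d \<and> d \<noteq> (\<lambda>t. 0) \<and> N d = (\<lambda>t. r * d t)"
  proof (rule eigenvector_in_invariant_set[where N = N and P = P, OF _ _ _ p(1) Pc0 c0_ne ann])
    show "N (\<lambda>t. x t + y t) = (\<lambda>t. N x t + N y t)" for x y
      by (auto simp: N_def fun_eq_iff distrib_right sum.distrib split: list.split)
    show "N (\<lambda>t. a * x t) = (\<lambda>t. a * N x t)" for a x
      by (auto simp: N_def fun_eq_iff sum_distrib_left mult.assoc split: list.split)
    show "P (\<lambda>t. N x t - r * x t)" if x: "P x" for x r
      unfolding P_def
    proof (intro conjI allI impI)
      fix \<beta> :: "'n list"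
      show "N x \<beta> - r * x \<beta> = 0" if "length \<beta> \<noteq> Suc k" using N_len[OF x that] x that by (simp add: P_def)
      assume \<beta>: "length \<beta> = Suc k"
      have "(\<Sum>\<alpha> | length \<alpha> = Suc k. (N x \<alpha> - r * x \<alpha>) * tensor_entry A \<alpha> \<beta>) =
          (\<Sum>\<alpha> | length \<alpha> = Suc k. N x \<alpha> * tensor_entry A \<alpha> \<beta>) - r * (\<Sum>\<alpha> | length \<alpha> = Suc k. x \<alpha> * tensor_entry A \<alpha> \<beta>)"
        by (simp add: left_diff_distrib sum_subtractf sum_distrib_left mult.assoc)
      then show "(\<Sum>\<alpha> | length \<alpha> = Suc k. (N x \<alpha> - r * x \<alpha>) * tensor_entry A \<alpha> \<beta>) = z * (N x \<beta> - r * x \<beta>)"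
        using x \<beta> by (simp add: comm P_def right_diff_distrib mult_ac)
    qed
  qed
  then obtain r d where d: "P d" "d \<noteq> (\<lambda>t. 0)" "N d = (\<lambda>t. r * d t)" by blast
  then obtain \<beta> where "d \<beta> \<noteq> 0" by blast
  then have "length \<beta> = Suc k" using d(1) by (auto simp: P_def)
  then obtain i \<alpha>1 where \<alpha>1: "\<beta> = i # \<alpha>1" "length \<alpha>1 = k" by (cases \<beta>) auto
  have Nd: "(\<Sum>j\<in>UNIV. d (j # \<alpha>) * A $ j $ l) = r * d (l # \<alpha>)" for l \<alpha>
    using fun_cong[OF d(3), of "l # \<alpha>"] by (simp add: N_def)
  have r_eig: "r \<in> eigenvalues A"
    by (rule left_eigenvector_imp_eigenvalue[of "\<lambda>j. d (j # \<alpha>1)" i, OF _ Nd]) (use \<open>d \<beta> \<noteq> 0\<close> \<alpha>1 in simp)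
  \<comment> \<open>With the first letter \<open>i\<close> fixed, the eigenvalue \<open>r\<close> of
    the first factor splits off; what remains is a left eigenvector of the k-fold tensor power for
    \<open>z / r\<close>.\<close>
  have eq: "r * (\<Sum>\<alpha> | length \<alpha> = k. d (i # \<alpha>) * tensor_entry A \<alpha> \<gamma>) = z * d (i # \<gamma>)" if "length \<gamma> = k" for \<gamma>
    using d(1) that split[of d i \<gamma>] by (simp add: P_def d(3) sum_distrib_left mult.assoc)
  have "r \<noteq> 0"
  proof
    assume "r = 0"
    then have "z * d \<beta> = 0" using eq[OF \<alpha>1(2)] \<alpha>1(1) by simp
    then show False using Suc.prems(1) \<open>d \<beta> \<noteq> 0\<close> by simp
  qed
  have "\<exists>cs. length cs = k \<and> set cs \<subseteq> eigenvalues A \<and> z / r = prod_list cs"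
  proof (rule Suc.IH[of "z / r" \<alpha>1 "\<lambda>\<alpha>. d (i # \<alpha>)"])
    show "z / r \<noteq> 0" using Suc.prems(1) \<open>r \<noteq> 0\<close> by simp
    show "(\<Sum>\<alpha> | length \<alpha> = k. d (i # \<alpha>) * tensor_entry A \<alpha> \<gamma>) = z / r * d (i # \<gamma>)" if "length \<gamma> = k" for \<gamma>
      using eq[OF that] \<open>r \<noteq> 0\<close> by (simp add: field_simps)
  qed (use \<alpha>1 \<open>d \<beta> \<noteq> 0\<close> in auto)
  then obtain cs where cs: "length cs = k" "set cs \<subseteq> eigenvalues A" "z / r = prod_list cs" by blast
  show ?case
    by (rule exI[of _ "r # cs"]) (use cs r_eig \<open>r \<noteq> 0\<close> in \<open>auto simp: field_simps\<close>)
qed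

text \<open>A tensor product of right eigenvectors of \<open>A\<close>. It is on the right because
  it will be paired with families of coefficients to form a functional.\<close>

lemma product_imp_tensor_eigenvalue:
  fixes A :: "complex ^ 'n::finite ^ 'n"
  assumes "set cs \<subseteq> eigenvalues A"
  shows "\<exists>v. (\<exists>\<alpha>. length \<alpha> = length cs \<and> v \<alpha> \<noteq> 0) \<and>
    (\<forall>\<alpha>. length \<alpha> = length cs \<longrightarrow>
       (\<Sum>\<beta> | length \<beta> = length cs. tensor_entry A \<alpha> \<beta> * v \<beta>) = prod_list cs * v \<alpha>)"
  using assms
proof (induction cs)
  case Nil
  show ?case by (intro exI[of _ "\<lambda>_. 1"]) auto
next
  case (Cons c cs)
  then obtain v \<alpha>0 where v: "length \<alpha>0 = length cs" "v \<alpha>0 \<noteq> 0"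
    "\<And>\<alpha>. length \<alpha> = length cs \<Longrightarrow> (\<Sum>\<beta> | length \<beta> = length cs. tensor_entry A \<alpha> \<beta> * v \<beta>) = prod_list cs * v \<alpha>"
    by auto
  obtain w where w: "w \<noteq> 0" "A *v w = c *s w" using Cons.prems by (auto simp: eigenvalues_def)
  have Aw: "(\<Sum>j\<in>UNIV. A $ i $ j * w $ j) = c * w $ i" for i
    using arg_cong[OF w(2), of "\<lambda>x. x $ i"] by (simp add: matrix_vector_mult_def)
  obtain i where "w $ i \<noteq> 0" using w(1) by (auto simp: vec_eq_iff)
  define v' where "v' \<alpha> = w $ hd \<alpha> * v (tl \<alpha>)" for \<alpha>
  have "(\<Sum>\<beta> | length \<beta> = length (c # cs). tensor_entry A \<alpha> \<beta> * v' \<beta>) = prod_list (c # cs) * v' \<alpha>"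
    if "length \<alpha> = length (c # cs)" for \<alpha>
  proof -
    obtain l \<gamma> where \<gamma>: "\<alpha> = l # \<gamma>" "length \<gamma> = length cs" using \<open>length \<alpha> = length (c # cs)\<close> by (cases \<alpha>) auto
    have "(\<Sum>\<beta> | length \<beta> = length (c # cs). tensor_entry A \<alpha> \<beta> * v' \<beta>) =
        (\<Sum>j\<in>UNIV. A $ l $ j * w $ j) * (\<Sum>\<beta> | length \<beta> = length cs. tensor_entry A \<gamma> \<beta> * v \<beta>)"
      by (simp add: \<gamma>(1) sum_words_Suc v'_def sum_product mult_ac)
    also have "\<dots> = (c * w $ l) * (prod_list cs * v \<gamma>)" by (simp only: Aw v(3)[OF \<gamma>(2)])
    finally show ?thesis by (simp add: \<gamma>(1) v'_def mult_ac)
  qed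
  moreover have "v' (i # \<alpha>0) \<noteq> 0" using \<open>w $ i \<noteq> 0\<close> v(2) by (simp add: v'_def)
  moreover have "length (i # \<alpha>0) = length (c # cs)" using v(1) by simp
  ultimately show ?case by blast
qed

section \<open>The spectrum\<close>

context fixed_point
begin

abbreviation A :: "complex ^ 'n ^ 'n" where
  "A \<equiv> linear_part_matrix \<psi>"

lemma A_nth: "A $ i $ j = q i [j]"
  by (simp add: linear_part_matrix_def q_def)

lemma q_Nil: "q i [] = 0"
proof -
  have "creation 0 = (0 :: 'h op ^ 'n)"
    by (auto simp: vec_eq_iff creation_apply intro: blinfun_eqI)
  then show ?thesis
    using cinner_power_series_creation[OF power_series_\<psi>[of i], of 0 "[]"] by (simp add: \<psi>_zero)
qed

text \<open>Every factor has zero constant term, so a product of \<open>length \<alpha>\<close>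
  factors starts in degree \<open>length \<alpha>\<close>.\<close>

lemma word_coeff_q_low: "length \<gamma> < length \<alpha> \<Longrightarrow> word_coeff q \<alpha> \<gamma> = 0"
proof (induction \<alpha> arbitrary: \<gamma>)
  case (Cons i \<alpha>)
  have "q i (take j \<gamma>) * word_coeff q \<alpha> (drop j \<gamma>) = 0" if "j \<le> length \<gamma>" for j
  proof (cases j)
    case (Suc m)
    then have "length (drop j \<gamma>) < length \<alpha>" using that Cons.prems by simp
    then show ?thesis using Cons.IH by simp
  qed (simp add: q_Nil)
  then show ?case unfolding word_coeff.simps word_conv_def by (intro sum.neutral) auto
qed simp

text \<open>In the lowest degree only the splitting of \<open>\<gamma>\<close> into single letters
  survives, and it picks the linear coefficients.\<close>

lemma word_coeff_q_top: "length \<gamma> = length \<alpha> \<Longrightarrow> word_coeff q \<alpha> \<gamma> = tensor_entry A \<alpha> \<gamma>"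
proof (induction \<alpha> arbitrary: \<gamma>)
  case (Cons i \<alpha>)
  then obtain l \<delta> where \<gamma>: "\<gamma> = l # \<delta>" "length \<delta> = length \<alpha>" by (cases \<gamma>) auto
  have "q i (take j \<gamma>) * word_coeff q \<alpha> (drop j \<gamma>) = 0" if "j \<le> length \<gamma>" "j \<noteq> 1" for j
  proof (cases "j = 0")
    case False
    then have "length (drop j \<gamma>) < length \<alpha>" using that \<gamma> by simp
    then show ?thesis by (simp add: word_coeff_q_low)
  qed (simp add: q_Nil)
  then have "(\<Sum>j\<le>length \<gamma>. q i (take j \<gamma>) * word_coeff q \<alpha> (drop j \<gamma>)) =
      (\<Sum>j\<in>{1}. q i (take j \<gamma>) * word_coeff q \<alpha> (drop j \<gamma>))"
    by (intro sum.mono_neutral_right) (auto simp: \<gamma>(1))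
  also have "\<dots> = q i [l] * tensor_entry A \<alpha> \<delta>" using \<gamma> by (simp add: Cons.IH)
  finally show ?case by (simp add: word_conv_def \<gamma>(1) A_nth)
qed simp

text \<open>Words longer than \<open>\<beta>\<close> do not reach its coefficient, and words shorter
  than \<open>k\<close> have \<open>d \<alpha> = 0\<close>. The truncated coefficients are therefore
  constant for \<open>N > k\<close>, and their limit is a finite sum.\<close>

lemma comp_\<psi>_lowest_coeff:
  fixes g :: "'h op ^ 'n \<Rightarrow> 'h op"
  assumes g: "power_series g d" and b: "power_series (\<lambda>X. g (\<psi> X)) b"
    and low: "\<And>\<alpha>. length \<alpha> < k \<Longrightarrow> d \<alpha> = 0" and \<beta>: "length \<beta> \<le> k"
  shows "b \<beta> = (\<Sum>\<alpha> | length \<alpha> = k. d \<alpha> * (if length \<beta> = k then tensor_entry A \<alpha> \<beta> else 0))"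
proof -
  obtain b' where b': "power_series (\<lambda>X. g (\<psi> X)) b'" "\<And>\<gamma>. (\<lambda>N. partial_coeff d q N \<gamma>) \<longlonglongrightarrow> b' \<gamma>"
    using power_series_comp[OF g power_series_\<psi> \<psi>_maps_ball] by blast
  have "b' = b" by (rule power_series_unique[OF b'(1) b])
  have "partial_coeff d q N \<beta> = (\<Sum>\<alpha> | length \<alpha> = k. d \<alpha> * (if length \<beta> = k then tensor_entry A \<alpha> \<beta> else 0))"
    if "N > k" for N
  proof -
    have "partial_coeff d q N \<beta> = (\<Sum>\<alpha> | length \<alpha> = k. d \<alpha> * word_coeff q \<alpha> \<beta>)"
      unfolding partial_coeff_def
    proof (rule sum.mono_neutral_right)
      show "\<forall>\<alpha>\<in>{\<alpha>. length \<alpha> < N} - {\<alpha>. length \<alpha> = k}. d \<alpha> * word_coeff q \<alpha> \<beta> = 0"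
      proof
        fix \<alpha> :: "'n list" assume "\<alpha> \<in> {\<alpha>. length \<alpha> < N} - {\<alpha>. length \<alpha> = k}"
        then consider "length \<alpha> < k" | "length \<beta> < length \<alpha>" using \<beta> by force
        then show "d \<alpha> * word_coeff q \<alpha> \<beta> = 0" by cases (simp_all add: low word_coeff_q_low)
      qed
    qed (use that in auto)
    also have "\<dots> = (\<Sum>\<alpha> | length \<alpha> = k. d \<alpha> * (if length \<beta> = k then tensor_entry A \<alpha> \<beta> else 0))"
      using \<beta> by (intro sum.cong) (auto simp: word_coeff_q_top word_coeff_q_low)
    finally show ?thesis .
  qed
  then have "\<forall>\<^sub>F N in sequentially. partial_coeff d q N \<beta> =
      (\<Sum>\<alpha> | length \<alpha> = k. d \<alpha> * (if length \<beta> = k then tensor_entry A \<alpha> \<beta> else 0))"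
    using eventually_gt_at_top[of k] by (rule eventually_mono[rotated])
  then have "(\<lambda>N. partial_coeff d q N \<beta>) \<longlonglongrightarrow>
      (\<Sum>\<alpha> | length \<alpha> = k. d \<alpha> * (if length \<beta> = k then tensor_entry A \<alpha> \<beta> else 0))"
    by (rule tendsto_eventually)
  then show ?thesis using b'(2)[of \<beta>] LIMSEQ_unique unfolding \<open>b' = b\<close> by blast
qed

section \<open>Expansion about the fixed point\<close>

definition centred_coeff :: "('h op ^ 'n \<Rightarrow> 'h op) \<Rightarrow> 'n list \<Rightarrow> complex" where
  "centred_coeff f = fh_coeff (\<lambda>X. f (ball_aut \<xi> X))"

lemma power_series_centred:
  assumes "power_series f a"
  shows "power_series (\<lambda>X. f (ball_aut \<xi> X)) (centred_coeff f)"
proof -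
  obtain b where b: "\<And>i. power_series (\<lambda>X. ball_aut \<xi> X $ i :: 'h op) (b i)"
    using power_series_ball_aut_ex by blast
  obtain d where "power_series (\<lambda>X. f (ball_aut \<xi> X)) d"
    using power_series_comp[OF assms, of "ball_aut \<xi>" b, OF b ball_aut_in_nc_ball] by blast
  then show ?thesis using fh_coeff_eq unfolding centred_coeff_def by metis
qed

abbreviation T :: "('h op ^ 'n \<Rightarrow> 'h op) \<Rightarrow> ('h op ^ 'n \<Rightarrow> 'h op)" where
  "T \<equiv> composition_op \<phi>"

lemma T_H2: "f \<in> H2 \<Longrightarrow> T f \<in> H2"
  using compact by (simp add: H2_compact_op_def H2_bounded_op_def)

lemma centred_resolvent:
  assumes "f \<in> H2"
  shows "centred_coeff (\<lambda>X. T f X - (scalar_op z o\<^sub>L f X)) \<beta> = centred_coeff (T f) \<beta> - z * centred_coeff f \<beta>"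
proof -
  have "power_series (\<lambda>X. T f (ball_aut \<xi> X) - (scalar_op z o\<^sub>L f (ball_aut \<xi> X)))
      (\<lambda>\<beta>. centred_coeff (T f) \<beta> - z * centred_coeff f \<beta>)"
    by (intro power_series_diff power_series_cmult power_series_centred[OF H2_power_series] T_H2 assms)
  from fh_coeff_eq[OF this] show ?thesis by (simp add: centred_coeff_def)
qed

lemma centred_T:
  assumes f: "f \<in> H2" and low: "\<And>\<alpha>. length \<alpha> < k \<Longrightarrow> centred_coeff f \<alpha> = 0" and \<beta>: "length \<beta> \<le> k"
  shows "centred_coeff (T f) \<beta> =
    (\<Sum>\<alpha> | length \<alpha> = k. centred_coeff f \<alpha> * (if length \<beta> = k then tensor_entry A \<alpha> \<beta> else 0))"
proof (rule comp_\<psi>_lowest_coeff[OF power_series_centred[OF H2_power_series[OF f]] _ low \<beta>])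
  show "power_series (\<lambda>X. f (ball_aut \<xi> (\<psi> X))) (centred_coeff (T f))"
  proof (rule power_series_cong[OF power_series_centred[OF H2_power_series[OF T_H2[OF f]]]])
    fix X :: "'h op ^ 'n" assume "X \<in> nc_ball"
    then have X: "ball_aut \<xi> X \<in> nc_ball" by (rule ball_aut_in_nc_ball)
    have "ball_aut \<xi> (\<psi> X) = \<phi> (ball_aut \<xi> X)"
      unfolding \<psi>_def o_def by (rule ball_aut_involution[OF maps_ball[OF X]])
    then show "T f (ball_aut \<xi> X) = f (ball_aut \<xi> (\<psi> X))" using X by (simp add: composition_op_def)
  qed
qed

text \<open>In degree \<open>k\<close> the equation says that the centred coefficients of
  \<open>f\<close> form a left eigenvector of the tensor power for \<open>z\<close>; were one of
  them nonzero, \<open>z\<close> would be a product of \<open>k\<close> eigenvalues. Both directions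
  use this step: eigenfunctions in every degree, the converse in the degrees below the least number
  of factors.\<close>

lemma centred_order_step:
  assumes f: "f \<in> H2" and z: "z \<noteq> 0"
    and low: "\<And>\<alpha>. length \<alpha> < k \<Longrightarrow> centred_coeff f \<alpha> = 0"
    and res: "\<And>\<alpha>. length \<alpha> \<le> k \<Longrightarrow> centred_coeff (\<lambda>X. T f X - (scalar_op z o\<^sub>L f X)) \<alpha> = 0"
    and np: "\<And>cs. length cs = k \<Longrightarrow> set cs \<subseteq> eigenvalues A \<Longrightarrow> z \<noteq> prod_list cs"
  shows "length \<alpha> < Suc k \<Longrightarrow> centred_coeff f \<alpha> = 0"
proof (rule ccontr)
  assume \<alpha>: "length \<alpha> < Suc k" and ne: "centred_coeff f \<alpha> \<noteq> 0"
  then have "length \<alpha> = k" using low by (metis less_SucE)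
  moreover have "(\<Sum>\<alpha> | length \<alpha> = k. centred_coeff f \<alpha> * tensor_entry A \<alpha> \<beta>) = z * centred_coeff f \<beta>"
    if "length \<beta> = k" for \<beta>
    using centred_T[OF f low, of k \<beta>] res[of \<beta>] that by (simp add: centred_resolvent[OF f])
  ultimately show False
    using tensor_eigenvalue_imp_product[of z \<alpha> k "centred_coeff f" A, OF z _ ne] np by blast
qed

text \<open>By \<open>not_in_H2_spectrum\<close> it is enough to exclude eigenfunctions, and an
  eigenfunction loses its centred coefficients degree by degree.\<close>

lemma spectrum_imp_product:
  assumes z: "z \<noteq> 0" "z \<in> H2_spectrum T"
  shows "\<exists>cs. set cs \<subseteq> eigenvalues A \<and> z = prod_list cs"
proof (rule ccontr)
  assume np: "\<not> ?thesis"
  have "z \<notin> H2_spectrum T"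
  proof (rule not_in_H2_spectrum[OF compact z(1)])
    fix f :: "'h op ^ 'n \<Rightarrow> 'h op"
    assume f: "f \<in> H2" and eig: "T f = (\<lambda>X. scalar_op z o\<^sub>L f X)"
    have "centred_coeff (\<lambda>X. T f X - (scalar_op z o\<^sub>L f X)) = (\<lambda>\<alpha>. 0)"
      by (simp add: eig centred_coeff_def fh_coeff_zero)
    then have "\<forall>\<alpha>. length \<alpha> < k \<longrightarrow> centred_coeff f \<alpha> = 0" for k
    proof (induction k)
      case (Suc k)
      then show ?case using centred_order_step[OF f z(1), of k] np by metis
    qed simp
    then have "centred_coeff f = (\<lambda>\<alpha>. 0)" by (meson ext lessI)
    then have ps: "power_series (\<lambda>X. f (ball_aut \<xi> X)) (\<lambda>\<alpha>. 0)"
      using power_series_centred[OF H2_power_series[OF f]] by simp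
    have zero: "f (ball_aut \<xi> X) = 0" if "X \<in> nc_ball" for X
      using power_series_sums[OF ps that] power_series_sums[OF power_series_zero that] sums_unique2 by blast
    show "f = (\<lambda>X. 0)"
    proof
      fix X
      show "f X = 0"
      proof (cases "X \<in> nc_ball")
        case True
        then show ?thesis using zero[OF ball_aut_in_nc_ball[OF True]] by (simp add: ball_aut_involution)
      qed (simp add: H2_off_ball f)
    qed
  qed
  with z(2) show False by simp
qed

lemma product_imp_spectrum:
  assumes z: "z \<noteq> 0" and cs: "set cs \<subseteq> eigenvalues A" "z = prod_list cs"
  shows "z \<in> H2_spectrum T"
proof (rule ccontr)
  assume "z \<notin> H2_spectrum T"
  then obtain S where S: "H2_bounded_op S"
    "\<And>f. f \<in> H2 \<Longrightarrow> (\<lambda>X. T (S f) X - (scalar_op z o\<^sub>L S f X)) = f"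
    unfolding H2_spectrum_def by blast
  define k where "k = (LEAST k. \<exists>cs. length cs = k \<and> set cs \<subseteq> eigenvalues A \<and> z = prod_list cs)"
  have "\<exists>cs. length cs = k \<and> set cs \<subseteq> eigenvalues A \<and> z = prod_list cs"
    unfolding k_def by (rule LeastI[of _ "length cs"]) (use cs in blast)
  then obtain ds where ds: "length ds = k" "set ds \<subseteq> eigenvalues A" "z = prod_list ds" by blast
  have minimal: "z \<noteq> prod_list cs" if "length cs = j" "set cs \<subseteq> eigenvalues A" "j < k" for cs j
    using that not_less_Least[of j] unfolding k_def by blast
  obtain v \<alpha>0 where v: "length \<alpha>0 = k" "v \<alpha>0 \<noteq> 0"
    "\<And>\<alpha>. length \<alpha> = k \<Longrightarrow> (\<Sum>\<beta> | length \<beta> = k. tensor_entry A \<alpha> \<beta> * v \<beta>) = z * v \<alpha>"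
    using product_imp_tensor_eigenvalue[OF ds(2)] ds(1,3) by auto
  \<comment> \<open>Pairing with the right eigenvector turns the tensor power into multiplication by
    \<open>z\<close>, so \<open>L\<close> vanishes on the image of \<open>f\<close> under
    \<open>T - z\<close> once \<open>f\<close> has no centred coefficients below degree
    \<open>k\<close>.\<close>
  define L where "L h = (\<Sum>\<beta> | length \<beta> = k. centred_coeff h \<beta> * v \<beta>)" for h
  \<comment> \<open>The word \<open>\<alpha>0\<close> in centred coordinates: its only centred
    coefficient sits at \<open>\<alpha>0\<close>, where \<open>v\<close> is nonzero, so
    \<open>L g \<noteq> 0\<close>. Words in a row contraction have norm at most 1, and boundedness
    puts \<open>g\<close> into the Hardy space.\<close>
  define g :: "'h op ^ 'n \<Rightarrow> 'h op" where "g X = (if X \<in> nc_ball then word_op (ball_aut \<xi> X) \<alpha>0 else 0)" for X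
  obtain b where b: "\<And>i. power_series (\<lambda>X. ball_aut \<xi> X $ i :: 'h op) (b i)"
    using power_series_ball_aut_ex by blast
  have psg: "power_series g (word_coeff b \<alpha>0)"
    by (rule power_series_cong[OF power_series_word_op[of "ball_aut \<xi>" b, OF b]]) (simp add: g_def)
  have "norm (word_op Y \<alpha>) \<le> 1" if "Y \<in> nc_ball" for Y :: "'h op ^ 'n" and \<alpha>
  proof (induction \<alpha>)
    case Nil
    show ?case by (simp add: norm_blinfun_id_le)
  next
    case (Cons i \<alpha>)
    have "norm (Y $ i) \<le> 1" using norm_component_le_rowop[of Y i] nc_ball_norm[OF that] by simp
    then have "norm (Y $ i) * norm (word_op Y \<alpha>) \<le> 1 * 1" using Cons by (intro mult_mono) auto
    then show ?case using norm_blinfun_compose[of "Y $ i" "word_op Y \<alpha>"] by simp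
  qed
  then have "norm (g X) \<le> 1" if "X \<in> nc_ball" for X
    using ball_aut_in_nc_ball[OF that] that by (simp add: g_def)
  then have gH: "g \<in> H2"
    by (intro H2I[OF psg] bounded_power_series_square_summable[OF psg]) (auto simp: g_def)
  have "power_series (\<lambda>X. g (ball_aut \<xi> X)) (\<lambda>\<alpha>. if \<alpha> = \<alpha>0 then 1 else 0)"
    by (rule power_series_cong[OF power_series_word]) (simp add: g_def ball_aut_in_nc_ball ball_aut_involution)
  then have cg: "centred_coeff g = (\<lambda>\<alpha>. if \<alpha> = \<alpha>0 then 1 else 0)"
    unfolding centred_coeff_def by (rule fh_coeff_eq)
  have Lg: "L g = v \<alpha>0"
  proof -
    have "L g = (\<Sum>\<beta> | length \<beta> = k. if \<beta> = \<alpha>0 then v \<alpha>0 else 0)"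
      unfolding L_def cg by (intro sum.cong) auto
    then show ?thesis using v(1) by simp
  qed
  define f where "f = S g"
  have f: "f \<in> H2" using S(1) gH by (simp add: f_def H2_bounded_op_def)
  have res: "(\<lambda>X. T f X - (scalar_op z o\<^sub>L f X)) = g" using S(2)[OF gH] by (simp add: f_def)
  \<comment> \<open>\<open>g\<close> has no centred coefficient below degree \<open>k\<close>, and
    by minimality \<open>z\<close> is not a product of fewer than \<open>k\<close> eigenvalues, so
    the step applies in each of these degrees.\<close>
  have "j \<le> k \<longrightarrow> (\<forall>\<alpha>. length \<alpha> < j \<longrightarrow> centred_coeff f \<alpha> = 0)" for j
  proof (induction j)
    case (Suc j)
    show ?case
    proof (intro impI allI)
      fix \<alpha> :: "'n list" assume j: "Suc j \<le> k" and \<alpha>: "length \<alpha> < Suc j"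
      show "centred_coeff f \<alpha> = 0"
      proof (rule centred_order_step[OF f z _ _ _ \<alpha>])
        show "centred_coeff f \<alpha> = 0" if "length \<alpha> < j" for \<alpha> using Suc.IH j that by simp
        show "centred_coeff (\<lambda>X. T f X - (scalar_op z o\<^sub>L f X)) \<alpha> = 0" if "length \<alpha> \<le> j" for \<alpha>
          using that j v(1) by (auto simp: res cg)
        show "z \<noteq> prod_list cs" if "length cs = j" "set cs \<subseteq> eigenvalues A" for cs
          using minimal[OF that] j by simp
      qed
    qed
  qed simp
  then have low: "centred_coeff f \<alpha> = 0" if "length \<alpha> < k" for \<alpha> using that by blast
  have "L (T f) = (\<Sum>\<beta> | length \<beta> = k. (\<Sum>\<alpha> | length \<alpha> = k. centred_coeff f \<alpha> * tensor_entry A \<alpha> \<beta>) * v \<beta>)"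
    unfolding L_def by (intro sum.cong) (auto simp: centred_T[OF f low])
  also have "\<dots> = (\<Sum>\<alpha> | length \<alpha> = k. centred_coeff f \<alpha> * (\<Sum>\<beta> | length \<beta> = k. tensor_entry A \<alpha> \<beta> * v \<beta>))"
    unfolding sum_distrib_right sum_distrib_left by (subst sum.swap) (simp add: mult.assoc)
  also have "\<dots> = (\<Sum>\<alpha> | length \<alpha> = k. centred_coeff f \<alpha> * (z * v \<alpha>))"
    by (intro sum.cong) (auto simp: v(3))
  also have "\<dots> = z * L f" by (simp add: L_def sum_distrib_left mult_ac)
  finally have LT: "L (T f) = z * L f" .
  have "L g = L (T f) - z * L f"
    unfolding L_def res[symmetric] centred_resolvent[OF f]
    by (simp add: left_diff_distrib sum_subtractf sum_distrib_left mult.assoc)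
  then show False using LT Lg v(2) by simp
qed

lemma spectrum_eq:
  "H2_spectrum T = {0, 1} \<union> {prod_list cs | cs. cs \<noteq> [] \<and> set cs \<subseteq> eigenvalues A}"
proof (intro equalityI subsetI)
  fix z assume z: "z \<in> H2_spectrum T"
  show "z \<in> {0, 1} \<union> {prod_list cs | cs. cs \<noteq> [] \<and> set cs \<subseteq> eigenvalues A}"
  proof (cases "z = 0")
    case False
    obtain cs where "set cs \<subseteq> eigenvalues A" "z = prod_list cs"
      using spectrum_imp_product[OF False z] by blast
    \<comment> \<open>The empty product accounts for the value 1.\<close>
    then show ?thesis by (cases "cs = []") auto
  qed simp
next
  fix z assume "z \<in> {0, 1} \<union> {prod_list cs | cs. cs \<noteq> [] \<and> set cs \<subseteq> eigenvalues A}"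
  then have "z = 0 \<or> (\<exists>cs. set cs \<subseteq> eigenvalues A \<and> z = prod_list cs)"
    by (auto intro: exI[of _ "[]"])
  then show "z \<in> H2_spectrum T"
    using product_imp_spectrum zero_in_H2_spectrum[OF compact] by (cases "z = 0") auto
qed

end

theorem theorem6p5:
  fixes \<phi> :: "'h::complex_hilbert op ^ 'n::finite \<Rightarrow> 'h op ^ 'n"
  assumes separable: "separable_space (euclidean :: 'h topology)"
    and infinite_dim: "\<not> (\<exists>B :: 'h set. finite B \<and> module.span scaleC B = UNIV)"
    and selfmap: "free_holomorphic_selfmap \<phi>"
    and compact: "H2_compact_op (composition_op \<phi>)"
  shows "\<exists>\<xi>. \<xi> \<in> ball 0 1 \<and> scalar_rep \<phi> \<xi> = \<xi> \<and>
           (\<forall>\<eta>\<in>ball 0 1. scalar_rep \<phi> \<eta> = \<eta> \<longrightarrow> \<eta> = \<xi>) \<and>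
           H2_spectrum (composition_op \<phi>) =
             {0, 1} \<union> {prod_list cs | cs. cs \<noteq> [] \<and>
               set cs \<subseteq> eigenvalues (linear_part_matrix (ball_aut \<xi> \<circ> \<phi> \<circ> ball_aut \<xi>))}"
proof -
  obtain e :: "'n list \<Rightarrow> 'h" where "fock e" using fock_ex[OF infinite_dim] by blast
  then interpret compact_composition e \<phi>
    using selfmap compact by (simp add: compact_composition_def compact_composition_axioms_def)
  obtain \<xi> where \<xi>: "norm \<xi> < 1" "\<phi>pt \<xi> = \<xi>" using fixed_point_ex by blast
  interpret fixed_point e \<phi> \<xi>
    using \<xi> by unfold_locales
  have rep: "scalar_rep \<phi> \<zeta> = \<phi>pt \<zeta>" if "norm \<zeta> < 1" for \<zeta>
    by (rule scalar_rep_eq[OF power_series_\<phi> that])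
  show ?thesis
  proof (intro exI[of _ \<xi>] conjI ballI impI)
    show "\<eta> = \<xi>" if "\<eta> \<in> ball 0 1" "scalar_rep \<phi> \<eta> = \<eta>" for \<eta>
      using that by (intro fixed_point_unique) (simp_all add: rep)
    show "H2_spectrum (composition_op \<phi>) =
        {0, 1} \<union> {prod_list cs | cs. cs \<noteq> [] \<and>
          set cs \<subseteq> eigenvalues (linear_part_matrix (ball_aut \<xi> \<circ> \<phi> \<circ> ball_aut \<xi>))}"
      using spectrum_eq by (simp add: \<psi>_def)
  qed (simp_all add: \<xi> rep)
qed

end
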